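(* Let $\widetilde D$ be a domain in $\Gamma\subset\mathbb R^6$ such that $\partial\widetilde D\cap U$ is a smooth, connected (three-dimensional) hypersurface in the four-dimensional space $\Gamma$ for some open neighborhood $U\subset\Gamma$. Suppose that for some $j\in\{1,2,3\}$ the intersection of $\partial\widetilde D\cap U$ with some $j$-th coordinate slice is a plane curve of nonzero curvature. Then the trilinear form $\Lambda_{\widetilde D}$ fails to be of type $(p_1,p_2,p_3)$ whenever $\frac1{p_1}+\frac1{p_2}+\frac1{p_3}=1$, $1<p_1,p_2,p_3<\infty$, and $p_i<2$ for some $i\neq j$.
   Context: Identify $\mathbb R^6$ with $\mathbb R^2\times\mathbb R^2\times\mathbb R^2$ and let $\Gamma=\{(\xi_1,\xi_2,\xi_3)\in\mathbb R^2\times\mathbb R^2\times\mathbb R^2 : \xi_1+\xi_2+\xi_3=0\}$, a four-dimensional subspace of $\mathbb R^6$. A $j$-th coordinate slice is a 4-plane in $\mathbb R^6$ of the form $\{(\xi_1,\xi_2,\xi_3)\in\mathbb R^6 : \xi_j=\xi_0\}$ for some fixed $\xi_0\in\mathbb R^2$; its intersection with $\Gamma$ is a 2-plane. For a domain $\widetilde D\subset\Gamma$, the trilinear form $\Lambda_{\widetilde D}$ on $\mathcal S(\mathbb R^2)\times\mathcal S(\mathbb R^2)\times\mathcal S(\mathbb R^2)$ is $$\Lambda_{\widetilde D}(f_1,f_2,f_3)=\iiint\delta(\xi_1+\xi_2+\xi_3)\,\chi_{\widetilde D}(\xi_1,\xi_2,\xi_3)\prod_{k=1}^3\widehat{f_k}(\xi_k)\,d\xi_1\,d\xi_2\,d\xi_3,$$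 i.e. $\Lambda_{\widetilde D}(f_1,f_2,f_3)=\int_{\mathbb R^2}\int_{\mathbb R^2}\chi_{\widetilde D}(\xi_1,\xi_2,-\xi_1-\xi_2)\widehat{f_1}(\xi_1)\widehat{f_2}(\xi_2)\widehat{f_3}(-\xi_1-\xi_2)\,d\xi_1\,d\xi_2$, where $\widehat f(\xi)=\int f(x)e^{-2\pi i x\cdot\xi}\,dx$. A trilinear form $\Lambda$ is of type $(p_1,p_2,p_3)$ (with $1\le p_k\le\infty$) if there is a constant $C$ with $|\Lambda(f_1,f_2,f_3)|\le C\prod_{k=1}^3\|f_k\|_{L^{p_k}(\mathbb R^2)}$ for all $f_1,f_2,f_3\in\mathcal S(\mathbb R^2)$. Convention: the smooth boundary piece $\partial\widetilde D\cap U$ is oriented as the boundary of $\widetilde D$, with $\widetilde D$ lying locally on exactly one side of it. *)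

theory Defs
  imports "HOL-Analysis.Analysis"
begin

section \<open>Smooth functions, Schwartz functions and the Fourier transform\<close>

primrec iter_deriv :: "'a list \<Rightarrow> ('a::euclidean_space \<Rightarrow> 'b::real_normed_vector) \<Rightarrow> 'a \<Rightarrow> 'b" where
  "iter_deriv [] f = f"
| "iter_deriv (v # vs) f = (\<lambda>x. frechet_derivative (iter_deriv vs f) (at x) v)"

text \<open>For open \<open>S\<close> this is the class of C-infinity functions: all iterated partial derivatives
  exist and are Frechet differentiable (hence continuous) at every point of \<open>S\<close>.\<close>

definition smooth_on :: "'a set \<Rightarrow> ('a::euclidean_space \<Rightarrow> 'b::real_normed_vector) \<Rightarrow> bool" where
  "smooth_on S f \<longleftrightarrow>
     (\<forall>vs \<in> lists Basis. \<forall>x\<in>S. (iter_deriv vs f) differentiable (at x))"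

definition schwartz :: "('a::euclidean_space \<Rightarrow> complex) \<Rightarrow> bool" where
  "schwartz f \<longleftrightarrow> smooth_on UNIV f \<and>
     (\<forall>vs \<in> lists Basis. \<forall>N::nat. bounded (range (\<lambda>x. norm x ^ N *\<^sub>R iter_deriv vs f x)))"

definition fourier :: "('a::euclidean_space \<Rightarrow> complex) \<Rightarrow> 'a \<Rightarrow> complex" where
  "fourier f \<xi> = (LINT x|lborel. f x * exp (- (2 * of_real pi * \<i> * of_real (x \<bullet> \<xi>))))"

definition Lp_norm :: "real \<Rightarrow> ('a::euclidean_space \<Rightarrow> complex) \<Rightarrow> real" where
  "Lp_norm p f = (LINT x|lborel. norm (f x) powr p) powr (1 / p)"

section \<open>Trilinear forms\<close>

text \<open>The space \<open>\<real>\<^sup>6 = \<real>\<^sup>2 \<times> \<real>\<^sup>2 \<times> \<real>\<^sup>2\<close> is rendered as the type \<open>(real^2)^3\<close>. The three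
  coordinates are indexed by the numeral type \<open>3\<close>, whose elements are exactly \<open>1\<close>, \<open>2\<close>, \<open>3\<close>
  (with \<open>3 = 0\<close>).\<close>

definition \<Gamma> :: "((real^2)^3) set" where
  "\<Gamma> = {\<xi>. \<xi> $ 1 + \<xi> $ 2 + \<xi> $ 3 = 0}"

definition coordinate_slice :: "3 \<Rightarrow> real^2 \<Rightarrow> ((real^2)^3) set" where
  "coordinate_slice j \<xi>\<^sub>0 = {\<xi>. \<xi> $ j = \<xi>\<^sub>0}"

definition trilinear_form :: "((real^2)^3) set \<Rightarrow> (3 \<Rightarrow> real^2 \<Rightarrow> complex) \<Rightarrow> complex" where
  "trilinear_form D f =
     (LINT \<xi>\<^sub>1|lborel. LINT \<xi>\<^sub>2|lborel.
        indicator D (vector [\<xi>\<^sub>1, \<xi>\<^sub>2, - \<xi>\<^sub>1 - \<xi>\<^sub>2] :: (real^2)^3) *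
        fourier (f 1) \<xi>\<^sub>1 * fourier (f 2) \<xi>\<^sub>2 * fourier (f 3) (- \<xi>\<^sub>1 - \<xi>\<^sub>2))"

definition of_type :: "((3 \<Rightarrow> real^2 \<Rightarrow> complex) \<Rightarrow> complex) \<Rightarrow> (3 \<Rightarrow> real) \<Rightarrow> bool" where
  "of_type \<Lambda> p \<longleftrightarrow>
     (\<exists>C. \<forall>f. (\<forall>k. schwartz (f k)) \<longrightarrow> norm (\<Lambda> f) \<le> C * (\<Prod>k\<in>UNIV. Lp_norm (p k) (f k)))"

section \<open>Boundary hypersurfaces and curves\<close>

abbreviation bdry :: "((real^2)^3) set \<Rightarrow> ((real^2)^3) set" where
  "bdry D \<equiv> top_of_set \<Gamma> frontier_of D"

text \<open>\<open>bdry D \<inter> U\<close> is a smooth hypersurface of the four-dimensional space \<open>\<Gamma>\<close>, with \<open>D\<close> lying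
  locally on exactly one side. Local defining functions \<open>\<rho>\<close> are taken on open subsets of the ambient
  space; their restriction to \<open>\<Gamma>\<close> is what matters, so the differential is required to be nonzero
  on \<open>\<Gamma>\<close>, which is its own tangent space.\<close>

definition smooth_boundary_piece :: "((real^2)^3) set \<Rightarrow> ((real^2)^3) set \<Rightarrow> bool" where
  "smooth_boundary_piece D U \<longleftrightarrow>
     (\<forall>q \<in> bdry D \<inter> U. \<exists>V (\<rho> :: (real^2)^3 \<Rightarrow> real).
        open V \<and> q \<in> V \<and> smooth_on V \<rho> \<and>
        (\<forall>\<xi> \<in> bdry D \<inter> U \<inter> V. \<exists>v\<in>\<Gamma>. frechet_derivative \<rho> (at \<xi>) v \<noteq> 0) \<and>
        bdry D \<inter> U \<inter> V = {\<xi> \<in> \<Gamma> \<inter> V. \<rho> \<xi> = 0} \<and>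
        D \<inter> V = {\<xi> \<in> \<Gamma> \<inter> V. \<rho> \<xi> < 0})"

text \<open>The curvature of a regular parametrized curve in a Euclidean space; its numerator is the area
  of the parallelogram spanned by the first two derivatives.\<close>

definition curvature :: "(real \<Rightarrow> 'a::euclidean_space) \<Rightarrow> real \<Rightarrow> real" where
  "curvature \<gamma> t =
     (let u = vector_derivative \<gamma> (at t);
          w = vector_derivative (\<lambda>s. vector_derivative \<gamma> (at s)) (at t)
      in sqrt ((norm u)\<^sup>2 * (norm w)\<^sup>2 - (u \<bullet> w)\<^sup>2) / norm u ^ 3)"

definition curve_of_nonzero_curvature :: "'a::euclidean_space set \<Rightarrow> bool" where
  "curve_of_nonzero_curvature M \<longleftrightarrow> M \<noteq> {} \<and>
     (\<forall>q\<in>M. \<exists>W a b \<gamma> g. open W \<and> q \<in> W \<and> a < b \<and>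
        smooth_on {a<..<b} \<gamma> \<and> homeomorphism {a<..<b} (M \<inter> W) \<gamma> g \<and>
        (\<forall>t\<in>{a<..<b}. vector_derivative \<gamma> (at t) \<noteq> 0 \<and> curvature \<gamma> t \<noteq> 0))"

end

theory Submission
  imports Defs "HOL-Probability.Probability"
begin

text \<open>The proof is Fefferman's argument for the ball multiplier, carried out in one slice of \<open>\<Gamma>\<close>. Write \<open>a\<close>
  for an index with \<open>p a < 2\<close> and \<open>b\<close> for the remaining one. Near a boundary point, dilations turn the domain
  into a half-space, and the form with a half-space as domain is a directional Hilbert transform along the
  \<open>a\<close>-component of the normal (provided that this component is nonzero), twisted by \<open>f j\<close>.
  Curvature yields boundary points in a common slice whose normals point in all directions of a small sector;
  if the boundary is tangent to the given slice along the curve, they are found in a neighbouring slice.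
  At \<open>2 ^ N\<close> such points put wave packets on the \<open>2 ^ N\<close> tubes of a Kakeya set for \<open>f a\<close> and on the
  translates of the tubes along their axes for \<open>f b\<close>, and let \<open>f j\<close> be a single wide packet. In the limit of
  large dilations the different points do not interact, and each contributes an amount comparable with the
  area of its tube, with the same sign. The translates are disjoint, so \<open>f b\<close> has norm \<open>O(1)\<close>, while the tubes
  overlap in a set of measure \<open>O(1 / N)\<close>, so that the norm of \<open>f a\<close> tends to zero because \<open>p a < 2\<close>.\<close>

subsection \<open>A smooth bump function and wave packets\<close>

text \<open>On a half-space with normal \<open>(n, m)\<close> the form is an average over
  \<open>t\<close> with weight \<open>1 / t\<close> in which \<open>f a\<close> travels by
  \<open>t n\<close> and \<open>f j\<close> by \<open>t m\<close> while \<open>f b\<close> stays. So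
  \<open>n \<noteq> 0\<close> is what carries a tube to its translate, and the motion of
  \<open>f j\<close> is harmless once \<open>f j\<close> is bounded below on a large disc. Fefferman
  passes to a vector-valued inequality by random signs (Meyer's lemma). Here modulation does that
  work: at frequencies \<open>k \<alpha> i\<close> with \<open>k\<close> tending to infinity the
  cross terms vanish both in the form and in the L2 norm of \<open>f a\<close>. Hence the order of
  limits: \<open>N\<close> is fixed while \<open>k\<close> grows, and only then does
  \<open>N\<close> grow. Orthogonality controls \<open>f a\<close> in L2 alone, and descending to
  \<open>p a < 2\<close> on a small set is the gain; \<open>f b\<close> is bounded by one, so every
  exponent above one will do for it. That the \<open>1 / p k\<close> sum to one makes the norms
  scale like the form, so that dilations cost nothing. The geometric obstacle is that
  \<open>n\<close> may vanish along the whole given curve, whose curvature then says nothing about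
  normals in that slice; a better slice has to be produced by a minimisation.\<close>

definition flat_exp :: "nat \<Rightarrow> real \<Rightarrow> real" where
  "flat_exp k x = (if x > 0 then exp (- (1 / x)) / x ^ k else 0)"

lemma flat_exp_at_right: "((\<lambda>x::real. exp (- (1 / x)) / x ^ k) \<longlongrightarrow> 0) (at_right 0)"
proof -
  have "((\<lambda>y::real. y ^ k / exp y) \<longlongrightarrow> 0) at_top"
    by (rule tendsto_power_div_exp_0)
  then have "((\<lambda>x::real. inverse x ^ k / exp (inverse x)) \<longlongrightarrow> 0) (at_right 0)"
    using filterlim_inverse_at_top_right by (rule filterlim_compose)
  then show ?thesis
    by (simp add: divide_simps exp_minus power_inverse mult.commute)
qed

lemma flat_exp_continuous_0: "(flat_exp k \<longlongrightarrow> 0) (at 0)"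
proof -
  have l: "(flat_exp k \<longlongrightarrow> 0) (at_left 0)"
    by (rule tendsto_eventually) (auto simp: eventually_at_filter flat_exp_def)
  have "(flat_exp k \<longlongrightarrow> 0) (at_right 0)"
    by (rule Lim_transform_eventually[OF flat_exp_at_right[of k]])
      (auto simp: eventually_at_filter flat_exp_def)
  with l show ?thesis
    by (simp add: filterlim_split_at)
qed

text \<open>The index \<open>k\<close> makes the family closed under differentiation, so that
  smoothness is a single formula. At 0 the difference quotient is the member of index
  \<open>Suc k\<close>, which tends to 0.\<close>

lemma DERIV_flat_exp:
  "(flat_exp k has_real_derivative (flat_exp (k + 2) x - real k * flat_exp (k + 1) x)) (at x)"
proof -
  consider "x < 0" | "x > 0" | "x = 0" by linarith
  then show ?thesis
  proof cases
    case 1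
    have "((\<lambda>_. 0) has_real_derivative 0) (at x)" by simp
    then have "(flat_exp k has_real_derivative 0) (at x)"
      by (rule has_field_derivative_transform_within_open[where S = "{..<0}"])
        (use 1 in \<open>auto simp: flat_exp_def\<close>)
    with 1 show ?thesis by (simp add: flat_exp_def)
  next
    case 2
    have "((\<lambda>x. exp (- (1 / x)) / x ^ k) has_real_derivative
        (exp (- (1 / x)) / x ^ (k + 2) - real k * (exp (- (1 / x)) / x ^ (k + 1)))) (at x)"
      using 2 by (auto intro!: derivative_eq_intros simp: field_simps power2_eq_square)
        (cases k; simp add: field_simps)+
    then have "(flat_exp k has_real_derivative
        (exp (- (1 / x)) / x ^ (k + 2) - real k * (exp (- (1 / x)) / x ^ (k + 1)))) (at x)"
      by (rule has_field_derivative_transform_within_open[where S = "{0<..}"])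
        (use 2 in \<open>auto simp: flat_exp_def\<close>)
    with 2 show ?thesis by (simp add: flat_exp_def)
  next
    case 3
    have "((\<lambda>y. (flat_exp k y - flat_exp k 0) / (y - 0)) \<longlongrightarrow> 0) (at 0)"
    proof (rule Lim_transform_eventually[OF flat_exp_continuous_0[of "Suc k"]])
      show "\<forall>\<^sub>F y in at 0. flat_exp (Suc k) y = (flat_exp k y - flat_exp k 0) / (y - 0)"
        by (auto simp: eventually_at_filter flat_exp_def)
    qed
    with 3 show ?thesis
      by (simp add: has_field_derivative_iff flat_exp_def[where x = 0])
  qed
qed

lemma has_derivative_flat_exp [derivative_intros]:
  assumes "(g has_derivative g') (at x within S)"
  shows "((\<lambda>x. flat_exp k (g x)) has_derivative
    (\<lambda>h. g' h * (flat_exp (k + 2) (g x) - real k * flat_exp (k + 1) (g x)))) (at x within S)"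
  using DERIV_compose_FDERIV[OF DERIV_flat_exp assms] .

lemma flat_exp_nonpos [simp]: "x \<le> 0 \<Longrightarrow> flat_exp k x = 0"
  by (simp add: flat_exp_def)

lemma continuous_on_flat_exp [continuous_intros]:
  "continuous_on S g \<Longrightarrow> continuous_on S (\<lambda>x. flat_exp k (g x))"
proof (rule continuous_on_compose2[of UNIV "flat_exp k" S g])
  show "continuous_on UNIV (flat_exp k)"
    using DERIV_flat_exp[of k] by (meson DERIV_isCont continuous_at_imp_continuous_on)
qed auto

definition bump :: "real \<Rightarrow> real" where
  "bump x = flat_exp 0 x * flat_exp 0 (1 - x)"

lemma bump_nonneg: "0 \<le> bump x"
  by (simp add: bump_def flat_exp_def)

lemma bump_le_1: "bump x \<le> 1"
  by (auto simp: bump_def flat_exp_def intro!: mult_le_one)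

lemma bump_pos: "0 < x \<Longrightarrow> x < 1 \<Longrightarrow> 0 < bump x"
  by (simp add: bump_def flat_exp_def)

lemma bump_eq_0: "x \<le> 0 \<or> 1 \<le> x \<Longrightarrow> bump x = 0"
  by (auto simp: bump_def)

lemma continuous_on_bump [continuous_intros]:
  "continuous_on S g \<Longrightarrow> continuous_on S (\<lambda>x. bump (g x))"
  unfolding bump_def by (intro continuous_intros)

lemma borel_measurable_bump [measurable]: "bump \<in> borel_measurable borel"
  by (intro borel_measurable_continuous_onI continuous_intros)

section \<open>Wave packets with compact support\<close>

definition cross2 :: "real^2 \<Rightarrow> real^2 \<Rightarrow> real" where
  "cross2 p q = p $ 1 * q $ 2 - p $ 2 * q $ 1"

text \<open>Used on the line, in the plane and on pairs of plane vectors, hence the general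
  type.\<close>

definition unit_wave :: "'a::euclidean_space \<Rightarrow> 'a \<Rightarrow> complex" where
  "unit_wave \<alpha> x = exp (2 * of_real pi * \<i> * of_real (\<alpha> \<bullet> x))"

text \<open>The set is closed under directional derivatives; together with the compact
  supports this makes its members Schwartz functions.\<close>

inductive_set packets :: "(real^2 \<Rightarrow> complex) set" where
  packet: "cross2 p q \<noteq> 0 \<Longrightarrow>
     (\<lambda>x. c * of_real (flat_exp i (p \<bullet> x + r) * flat_exp k (1 - (p \<bullet> x + r)) *
       flat_exp l (q \<bullet> x + s) * flat_exp m (1 - (q \<bullet> x + s))) * unit_wave \<alpha> x) \<in> packets"
| sum: "f \<in> packets \<Longrightarrow> g \<in> packets \<Longrightarrow> (\<lambda>x. f x + g x) \<in> packets"

lemma has_derivative_unit_wave [derivative_intros]: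
  "(unit_wave \<alpha> has_derivative (\<lambda>h. 2 * of_real pi * \<i> * of_real (\<alpha> \<bullet> h) * unit_wave \<alpha> x)) (at x)"
proof -
  have 1: "((\<lambda>x. 2 * of_real pi * \<i> * of_real (\<alpha> \<bullet> x) :: complex) has_derivative
      (\<lambda>h. 2 * of_real pi * \<i> * of_real (\<alpha> \<bullet> h))) (at x)"
    by (auto intro!: derivative_eq_intros)
  have "(unit_wave \<alpha> has_derivative (\<lambda>h. exp (2 * of_real pi * \<i> * of_real (\<alpha> \<bullet> x)) *
     (2 * of_real pi * \<i> * of_real (\<alpha> \<bullet> h)))) (at x)"
    unfolding unit_wave_def
    by (rule has_derivative_compose[OF 1, of exp "(*) (exp (2 * of_real pi * \<i> * of_real (\<alpha> \<bullet> x)))"])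
      (rule DERIV_exp[THEN has_field_derivative_imp_has_derivative])
  then show ?thesis
    by (simp add: unit_wave_def mult_ac)
qed

text \<open>Product rule: each of the four factors \<open>flat_exp\<close> contributes the two terms
  of its derivative and the wave one more. All nine are again generators, with changed indices and
  constants.\<close>

lemma packets_deriv: 
  assumes "f \<in> packets"
  shows "\<exists>f'. (\<forall>x. (f has_derivative f' x) (at x)) \<and> (\<forall>v. (\<lambda>x. f' x v) \<in> packets)"
  using assms
proof induction
  case (packet p q c i r k l s m \<alpha>)
  let ?P = "\<lambda>i k l m c x. c * of_real (flat_exp i (p \<bullet> x + r) * flat_exp k (1 - (p \<bullet> x + r)) *
       flat_exp l (q \<bullet> x + s) * flat_exp m (1 - (q \<bullet> x + s))) * unit_wave \<alpha> x :: complex"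
  let ?f' = "\<lambda>x h. ?P (i+2) k l m (c * of_real (p \<bullet> h)) x + ?P (i+1) k l m (c * of_real (- real i * (p \<bullet> h))) x
     + ?P i (k+2) l m (c * of_real (- (p \<bullet> h))) x + ?P i (k+1) l m (c * of_real (real k * (p \<bullet> h))) x
     + ?P i k (l+2) m (c * of_real (q \<bullet> h)) x + ?P i k (l+1) m (c * of_real (- real l * (q \<bullet> h))) x
     + ?P i k l (m+2) (c * of_real (- (q \<bullet> h))) x + ?P i k l (m+1) (c * of_real (real m * (q \<bullet> h))) x
     + ?P i k l m (c * (2 * of_real pi * \<i> * of_real (\<alpha> \<bullet> h))) x"
  have "(?P i k l m c has_derivative ?f' x) (at x)" for x
    by (rule derivative_eq_intros refl)+ (simp add: fun_eq_iff algebra_simps)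
  moreover have "(\<lambda>x. ?f' x v) \<in> packets" for v
    by (intro packets.sum packets.packet[OF packet])
  ultimately show ?case
    by (intro exI[of _ ?f'] conjI allI)
next
  case (sum f g)
  then obtain f' g' where f': "\<And>x. (f has_derivative f' x) (at x)" "\<And>v. (\<lambda>x. f' x v) \<in> packets"
    and g': "\<And>x. (g has_derivative g' x) (at x)" "\<And>v. (\<lambda>x. g' x v) \<in> packets"
    by metis
  show ?case
    by (rule exI[of _ "\<lambda>x h. f' x h + g' x h"])
      (use f' g' in \<open>auto intro: has_derivative_add packets.sum\<close>)
qed

lemma packets_iter_deriv: "f \<in> packets \<Longrightarrow> iter_deriv vs f \<in> packets"
proof (induction vs)
  case (Cons v vs)
  then obtain f' where f': "\<And>x. (iter_deriv vs f has_derivative f' x) (at x)"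
    "\<And>v. (\<lambda>x. f' x v) \<in> packets"
    using packets_deriv by metis
  then have "frechet_derivative (iter_deriv vs f) (at x) = f' x" for x
    by (metis frechet_derivative_at)
  with f' show ?case by simp
qed simp

lemma packets_continuous: "f \<in> packets \<Longrightarrow> continuous_on S f"
  by (meson packets_deriv has_derivative_continuous continuous_at_imp_continuous_on)

lemma packets_support: 
  assumes "f \<in> packets"
  shows "\<exists>R. \<forall>x. f x \<noteq> 0 \<longrightarrow> norm x \<le> R"
  using assms
proof induction
  case (packet p q c i r k l s m \<alpha>)
  let ?S = "{x. (p \<bullet> x + r \<in> {0..1}) \<and> (q \<bullet> x + s \<in> {0..1})}"
  define M where "M = (\<bar>r\<bar> + \<bar>s\<bar> + 1) * (norm p + norm q)"
  have "norm x \<le> 2 * (M / \<bar>cross2 p q\<bar>)" if "x \<in> ?S" for x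
  proof -
    have 1: "\<bar>p \<bullet> x\<bar> \<le> \<bar>r\<bar> + \<bar>s\<bar> + 1" "\<bar>q \<bullet> x\<bar> \<le> \<bar>r\<bar> + \<bar>s\<bar> + 1" using that by auto
    \<comment> \<open>Cramer's rule recovers \<open>x\<close> from \<open>p \<bullet> x\<close> and
      \<open>q \<bullet> x\<close>, so two strips in independent directions meet in a bounded
      set.\<close>
    have e: "cross2 p q * x $ 1 = (p \<bullet> x) * q $ 2 - (q \<bullet> x) * p $ 2"
      "cross2 p q * x $ 2 = (q \<bullet> x) * p $ 1 - (p \<bullet> x) * q $ 1"
      by (simp_all add: cross2_def inner_vec_def sum_2 algebra_simps)
    have "\<bar>(p \<bullet> x) * q $ i - (q \<bullet> x) * p $ i\<bar> \<le> M" for i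
    proof -
      have "\<bar>(p \<bullet> x) * q $ i - (q \<bullet> x) * p $ i\<bar> \<le> \<bar>p \<bullet> x\<bar> * \<bar>q $ i\<bar> + \<bar>q \<bullet> x\<bar> * \<bar>p $ i\<bar>"
        by (metis abs_mult abs_triangle_ineq4)
      also have "\<dots> \<le> (\<bar>r\<bar> + \<bar>s\<bar> + 1) * norm q + (\<bar>r\<bar> + \<bar>s\<bar> + 1) * norm p"
        by (intro add_mono mult_mono 1 component_le_norm_cart) auto
      finally show ?thesis by (simp add: M_def algebra_simps)
    qed
    from this[of 2] this[of 1] have "\<bar>cross2 p q\<bar> * \<bar>x $ 1\<bar> \<le> M" "\<bar>cross2 p q\<bar> * \<bar>x $ 2\<bar> \<le> M"
      by (simp_all add: abs_mult[symmetric] e abs_minus_commute)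
    then have "\<bar>x $ 1\<bar> \<le> M / \<bar>cross2 p q\<bar>" "\<bar>x $ 2\<bar> \<le> M / \<bar>cross2 p q\<bar>"
      using packet by (simp_all add: field_simps)
    moreover have "norm x \<le> \<bar>x $ 1\<bar> + \<bar>x $ 2\<bar>"
      using norm_le_l1_cart[of x] by (simp add: sum_2)
    ultimately show ?thesis by linarith
  qed
  moreover have "x \<in> ?S" if "c * of_real (flat_exp i (p \<bullet> x + r) * flat_exp k (1 - (p \<bullet> x + r)) *
       flat_exp l (q \<bullet> x + s) * flat_exp m (1 - (q \<bullet> x + s))) * unit_wave \<alpha> x \<noteq> 0" for x
    using that by (auto simp: flat_exp_def split: if_splits)
  ultimately show ?case by blast
next
  case (sum f g)
  then obtain R R' where "\<forall>x. f x \<noteq> 0 \<longrightarrow> norm x \<le> R" "\<forall>x. g x \<noteq> 0 \<longrightarrow> norm x \<le> R'" by blast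
  then have "\<forall>x. f x + g x \<noteq> 0 \<longrightarrow> norm x \<le> max R R'"
    by (metis add.right_neutral max.coboundedI1 max.coboundedI2)
  then show ?case by blast
qed

lemma packets_schwartz:
  assumes "f \<in> packets" shows "schwartz f"
  unfolding schwartz_def smooth_on_def
proof (intro conjI ballI allI)
  fix vs :: "(real^2) list" and x
  show "iter_deriv vs f differentiable at x"
    by (meson assms packets_deriv packets_iter_deriv differentiable_def)
next
  fix vs :: "(real^2) list" and N :: nat
  let ?g = "iter_deriv vs f"
  have g: "?g \<in> packets" using assms by (rule packets_iter_deriv)
  then obtain R where R: "\<And>x. ?g x \<noteq> 0 \<Longrightarrow> norm x \<le> R" using packets_support by blast
  have "compact ((\<lambda>x. norm x ^ N *\<^sub>R ?g x) ` cball 0 R)"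
    by (intro compact_continuous_image continuous_intros packets_continuous g compact_cball)
  then have "bounded (insert 0 ((\<lambda>x. norm x ^ N *\<^sub>R ?g x) ` cball 0 R))"
    by (simp add: compact_imp_bounded)
  moreover have "range (\<lambda>x. norm x ^ N *\<^sub>R ?g x) \<subseteq> insert 0 ((\<lambda>x. norm x ^ N *\<^sub>R ?g x) ` cball 0 R)"
    using R by (auto simp: image_iff) 
  ultimately show "bounded (range (\<lambda>x. norm x ^ N *\<^sub>R ?g x))"
    by (rule bounded_subset)
qed

subsection \<open>Change of variables\<close>

lemma integrable_scaleR_iff:
  fixes f :: "'a \<Rightarrow> 'b::{banach, second_countable_topology}"
  assumes "c \<noteq> 0"
  shows "integrable M (\<lambda>x. c *\<^sub>R f x) \<longleftrightarrow> integrable M f"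
  using assms integrable_scaleR_right[of "1 / c" M "\<lambda>x. c *\<^sub>R f x"] by auto

text \<open>A box pulls back to the image of a box under the inverse matrix, whose determinant is
  \<open>1 / cross2 p q\<close>, and Lebesgue measure is determined by boxes. With this, integrals
  over tiles become products of integrals on the line.\<close>

lemma linear_fst_snd_cross2:
  fixes p q :: "real^2"
  assumes "cross2 p q \<noteq> 0"
  shows "(lborel :: (real \<times> real) measure) =
    density (distr lborel borel (\<lambda>x. (p \<bullet> x, q \<bullet> x))) (\<lambda>_. ennreal \<bar>cross2 p q\<bar>)"
proof (rule lborel_eqI)
  let ?L = "\<lambda>x. (p \<bullet> x, q \<bullet> x)"
  let ?\<Delta> = "cross2 p q"
  have L[measurable]: "?L \<in> borel_measurable borel"
    by (intro borel_measurable_continuous_onI continuous_intros)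
  fix l u :: "real \<times> real"
  assume "\<And>b. b \<in> Basis \<Longrightarrow> l \<bullet> b \<le> u \<bullet> b"
  from this[of "(1, 0)"] this[of "(0, 1)"]
  have lu: "fst l \<le> fst u" "snd l \<le> snd u" by (auto simp: inner_prod_def Basis_prod_def)
  \<comment> \<open>The inverse of the map, by Cramer's rule; the preimage of a box thus becomes a
    linear image, to which the determinant formula applies.\<close>
  define f :: "real^2 \<Rightarrow> real^2" where
    "f y = (1 / ?\<Delta>) *\<^sub>R vector [q $ 2 * y $ 1 - p $ 2 * y $ 2, p $ 1 * y $ 2 - q $ 1 * y $ 1]" for y
  let ?B = "box (vector [fst l, snd l]) (vector [fst u, snd u]) :: (real^2) set"
  have f: "linear f"
    by (auto intro!: linearI simp: f_def vec_eq_iff forall_2 algebra_simps diff_divide_distrib add_divide_distrib)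
  have "f y = x \<longleftrightarrow> y = vector [p \<bullet> x, q \<bullet> x]" for x y
    using assms
    by (simp add: f_def vec_eq_iff forall_2 inner_vec_def sum_2 field_simps)
      (auto simp: cross2_def algebra_simps; algebra)
  then have inv: "f (vector [p \<bullet> x, q \<bullet> x]) = x" "vector [p \<bullet> f y, q \<bullet> f y] = y" for x y
    by metis+
  have "f ` ?B = {x. vector [p \<bullet> x, q \<bullet> x] \<in> ?B}"
  proof (intro equalityI subsetI)
    fix x assume "x \<in> {x. vector [p \<bullet> x, q \<bullet> x] \<in> ?B}"
    then show "x \<in> f ` ?B" by (intro image_eqI[where x = "vector [p \<bullet> x, q \<bullet> x]"]) (simp_all add: inv)
  qed (auto simp: inv)
  also have "\<dots> = ?L -` (box (fst l) (fst u) \<times> box (snd l) (snd u))"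
    by (auto simp: mem_box_cart forall_2)
  also have "box (fst l) (fst u) \<times> box (snd l) (snd u) = box l u"
    by (auto simp: box_def Basis_prod_def inner_prod_def ball_Un)
  finally have im: "f ` ?B = ?L -` box l u" .
  have "det (matrix f) = 1 / ?\<Delta>"
    using assms by (simp add: det_2 matrix_def f_def axis_def field_simps power2_eq_square)
      (simp add: cross2_def algebra_simps)
  moreover have "measure lebesgue ?B = (fst u - fst l) * (snd u - snd l)"
  proof -
    have "measure lebesgue ?B = measure lborel (cbox (vector [fst l, snd l]) (vector [fst u, snd u]) :: (real^2) set)"
      by (simp add: measure_lborel_box_eq measure_lborel_cbox_eq)
    also have "\<dots> = (fst u - fst l) * (snd u - snd l)"
      using lu by (subst content_cbox_cart) (auto simp: interval_ne_empty_cart forall_2 UNIV_2)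
    finally show ?thesis .
  qed
  ultimately have "measure lebesgue (?L -` box l u) = 1 / \<bar>?\<Delta>\<bar> * ((fst u - fst l) * (snd u - snd l))"
    using measure_linear_image[OF f, of ?B] by (simp add: im)
  moreover have "?L -` box l u \<in> lmeasurable"
    using measurable_linear_image[OF f, of ?B] by (simp add: im)
  moreover have mb: "?L -` box l u \<in> sets borel"
    using measurable_sets[OF L, of "box l u"] by simp
  moreover have "emeasure lborel (?L -` box l u) = emeasure lebesgue (?L -` box l u)"
    using mb by (subst emeasure_completion) auto
  ultimately have "emeasure lborel (?L -` box l u) = ennreal (1 / \<bar>?\<Delta>\<bar> * ((fst u - fst l) * (snd u - snd l)))"
    using emeasure_eq_measure2[of "?L -` box l u" lebesgue] by simp
  then have "emeasure (density (distr lborel borel ?L) (\<lambda>_. ennreal \<bar>?\<Delta>\<bar>)) (box l u) =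
      ennreal \<bar>?\<Delta>\<bar> * ennreal (1 / \<bar>?\<Delta>\<bar> * ((fst u - fst l) * (snd u - snd l)))"
    by (simp add: emeasure_density_const emeasure_distr del: ennreal_mult'')
  also have "\<dots> = ennreal (\<bar>?\<Delta>\<bar> * (1 / \<bar>?\<Delta>\<bar> * ((fst u - fst l) * (snd u - snd l))))"
    by (rule ennreal_mult'[symmetric]) simp
  also have "\<bar>?\<Delta>\<bar> * (1 / \<bar>?\<Delta>\<bar> * ((fst u - fst l) * (snd u - snd l))) = (fst u - fst l) * (snd u - snd l)"
    using assms by simp
  also have "\<dots> = (\<Prod>b\<in>Basis. (u - l) \<bullet> b)"
  proof -
    have "(Basis :: (real \<times> real) set) = {(1, 0), (0, 1)}"
      by (auto simp: Basis_prod_def)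
    then have "(\<Prod>b\<in>Basis. (u - l) \<bullet> b) = (\<Prod>b\<in>{(1, 0), (0, 1)}. (u - l) \<bullet> b)"
      by (intro prod.cong) simp_all
    then show ?thesis by (simp add: inner_prod_def)
  qed
  finally show "emeasure (density (distr lborel borel ?L) (\<lambda>_. ennreal \<bar>?\<Delta>\<bar>)) (box l u) = (\<Prod>b\<in>Basis. (u - l) \<bullet> b)" .
qed simp

lemma
  fixes f :: "real \<times> real \<Rightarrow> 'b::{banach, second_countable_topology}"
  assumes "cross2 p q \<noteq> 0" and [measurable]: "f \<in> borel_measurable borel"
  shows integral_cross2: "(LINT x|lborel. f (p \<bullet> x, q \<bullet> x)) = (1 / \<bar>cross2 p q\<bar>) *\<^sub>R (LINT y|lborel. f y)"
    and integrable_cross2: "integrable lborel (\<lambda>x. f (p \<bullet> x, q \<bullet> x)) \<longleftrightarrow> integrable lborel f"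
proof -
  have L[measurable]: "(\<lambda>x. (p \<bullet> x, q \<bullet> x)) \<in> borel_measurable borel"
    by (intro borel_measurable_continuous_onI continuous_intros)
  have "(LINT y|lborel. f y) = \<bar>cross2 p q\<bar> *\<^sub>R (LINT x|lborel. f (p \<bullet> x, q \<bullet> x))"
    by (subst linear_fst_snd_cross2[OF assms(1)]) (simp add: integral_density integral_distr)
  with assms show "(LINT x|lborel. f (p \<bullet> x, q \<bullet> x)) = (1 / \<bar>cross2 p q\<bar>) *\<^sub>R (LINT y|lborel. f y)"
    by simp
  have "integrable lborel f \<longleftrightarrow> integrable lborel (\<lambda>x. \<bar>cross2 p q\<bar> *\<^sub>R f (p \<bullet> x, q \<bullet> x))"
    by (subst linear_fst_snd_cross2[OF assms(1)]) (simp add: integrable_density integrable_distr_eq)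
  also have "\<dots> \<longleftrightarrow> integrable lborel (\<lambda>x. f (p \<bullet> x, q \<bullet> x))"
    using assms by (intro integrable_scaleR_iff) auto
  finally show "integrable lborel (\<lambda>x. f (p \<bullet> x, q \<bullet> x)) \<longleftrightarrow> integrable lborel f" ..
qed

lemma emeasure_cross2:
  assumes "cross2 p q \<noteq> 0" "a \<le> b" "c \<le> d"
  shows "emeasure lborel {x. p \<bullet> x \<in> {a..b} \<and> q \<bullet> x \<in> {c..d}} = ennreal ((b - a) * (d - c) / \<bar>cross2 p q\<bar>)"
proof -
  let ?L = "\<lambda>x. (p \<bullet> x, q \<bullet> x)" and ?\<Delta> = "cross2 p q"
  let ?S = "{x. p \<bullet> x \<in> {a..b} \<and> q \<bullet> x \<in> {c..d}}"
  have L[measurable]: "?L \<in> borel_measurable borel"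
    by (intro borel_measurable_continuous_onI continuous_intros)
  have "ennreal ((b - a) * (d - c)) = emeasure lborel ({a..b} \<times> {c..d})"
    using assms by (simp add: lborel_prod[symmetric] lborel.emeasure_pair_measure_Times ennreal_mult)
  also have "\<dots> = ennreal \<bar>?\<Delta>\<bar> * emeasure lborel (?L -` ({a..b} \<times> {c..d}))"
    by (subst linear_fst_snd_cross2[OF assms(1)])
      (simp add: emeasure_density_const emeasure_distr borel_Times)
  also have "?L -` ({a..b} \<times> {c..d}) = ?S" by auto
  finally have "ennreal (1 / \<bar>?\<Delta>\<bar>) * ennreal ((b - a) * (d - c)) =
      ennreal (1 / \<bar>?\<Delta>\<bar>) * (ennreal \<bar>?\<Delta>\<bar> * emeasure lborel ?S)" by simp
  then show ?thesis
    using assms by (simp add: mult.assoc[symmetric] ennreal_mult[symmetric])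
qed

lemma
  fixes f :: "'a::euclidean_space \<Rightarrow> 'b::{banach, second_countable_topology}"
  assumes c: "c \<noteq> 0"
  shows integrable_lborel_affine: "integrable lborel (\<lambda>x. f (t + c *\<^sub>R x)) \<longleftrightarrow> integrable lborel f"
    and integral_lborel_affine: "(LINT x|lborel. f (t + c *\<^sub>R x)) = (1 / \<bar>c\<bar> ^ DIM('a)) *\<^sub>R (LINT x|lborel. f x)"
proof -
  have *: "integrable lborel (\<lambda>x. f (t + c *\<^sub>R x))" if "integrable lborel f" "c \<noteq> 0"
    for f :: "'a \<Rightarrow> 'b" and t :: 'a and c :: real
  proof -
    have [measurable]: "f \<in> borel_measurable borel" using that by auto
    have "integrable (density (distr lborel borel (\<lambda>x. t + c *\<^sub>R x)) (\<lambda>_. ennreal (\<bar>c\<bar>^DIM('a)))) f"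
      using that lborel_affine[of c t] by (simp add: ennreal_power)
    then have "integrable lborel (\<lambda>x. \<bar>c\<bar> ^ DIM('a) *\<^sub>R f (t + c *\<^sub>R x))"
      using that by (simp add: integrable_density integrable_distr_eq)
    then show ?thesis using that by (subst (asm) integrable_scaleR_iff) auto
  qed
  from *[of f c t] *[of "\<lambda>x. f (t + c *\<^sub>R x)" "1 / c" "- (1 / c) *\<^sub>R t"] c
  show i: "integrable lborel (\<lambda>x. f (t + c *\<^sub>R x)) \<longleftrightarrow> integrable lborel f"
    by (auto simp: scaleR_add_right scaleR_diff_right)
  show "(LINT x|lborel. f (t + c *\<^sub>R x)) = (1 / \<bar>c\<bar> ^ DIM('a)) *\<^sub>R (LINT x|lborel. f x)"
  proof (cases "integrable lborel f")
    case True
    then have [measurable]: "f \<in> borel_measurable borel" by auto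
    have "(LINT x|lborel. f x) = \<bar>c\<bar> ^ DIM('a) *\<^sub>R (LINT x|lborel. f (t + c *\<^sub>R x))"
      by (subst lborel_affine[OF c, of t]) (simp add: integral_density integral_distr ennreal_power)
    with c show ?thesis by simp
  next
    case False
    with i show ?thesis by (simp add: not_integrable_integral_eq)
  qed
qed

lemma
  fixes f :: "'a::euclidean_space \<Rightarrow> 'c::{real_normed_field, banach, second_countable_topology}"
    and g :: "'b::euclidean_space \<Rightarrow> 'c"
  assumes "integrable lborel f" "integrable lborel g"
  shows integrable_lborel_times: "integrable (lborel \<Otimes>\<^sub>M lborel) (\<lambda>(x, y). f x * g y)"
    and integral_lborel_times: "(LINT z|(lborel \<Otimes>\<^sub>M lborel). (case z of (x, y) \<Rightarrow> f x * g y)) =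
      (LINT x|lborel. f x) * (LINT y|lborel. g y)"
proof -
  have [measurable]: "f \<in> borel_measurable borel" "g \<in> borel_measurable borel" using assms by auto
  show i: "integrable (lborel \<Otimes>\<^sub>M lborel) (\<lambda>(x, y). f x * g y)"
    by (rule lborel_pair.Fubini_integrable) (use assms in \<open>auto simp: norm_mult\<close>)
  show "(LINT z|(lborel \<Otimes>\<^sub>M lborel). (case z of (x, y) \<Rightarrow> f x * g y)) =
      (LINT x|lborel. f x) * (LINT y|lborel. g y)"
    using lborel_pair.integral_fst'[OF i] assms by simp
qed

subsection \<open>The Fourier transform of the bump function\<close>

lemma unit_wave_add: "unit_wave (\<alpha> + \<beta>) x = unit_wave \<alpha> x * unit_wave \<beta> x"
  by (simp add: unit_wave_def inner_add_left algebra_simps exp_add[symmetric])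

lemma unit_wave_0 [simp]: "unit_wave 0 x = 1" "unit_wave \<alpha> 0 = 1"
  by (simp_all add: unit_wave_def)

lemma norm_unit_wave [simp]: "norm (unit_wave \<alpha> x) = 1"
  by (simp add: unit_wave_def)

lemma unit_wave_commute: "unit_wave \<alpha> x = unit_wave x \<alpha>"
  by (simp add: unit_wave_def inner_commute)

lemma unit_wave_minus: "unit_wave (- \<alpha>) x = unit_wave \<alpha> (- x)"
  by (simp add: unit_wave_def)

lemma unit_wave_scaleR: "unit_wave (c *\<^sub>R \<alpha>) x = unit_wave \<alpha> (c *\<^sub>R x)"
  by (simp add: unit_wave_def)

lemma continuous_on_unit_wave [continuous_intros]:
  "continuous_on S f \<Longrightarrow> continuous_on S g \<Longrightarrow> continuous_on S (\<lambda>x. unit_wave (f x) (g x))"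
  unfolding unit_wave_def by (intro continuous_intros)

lemma borel_measurable_unit_wave [measurable (raw)]:
  "f \<in> borel_measurable M \<Longrightarrow> g \<in> borel_measurable M \<Longrightarrow> (\<lambda>x. unit_wave (f x) (g x)) \<in> borel_measurable M"
  unfolding unit_wave_def by measurable

lemma fourier_eq: "fourier f \<xi> = (LINT x|lborel. f x * unit_wave (- \<xi>) x)"
  unfolding fourier_def unit_wave_def by (simp add: inner_commute mult.assoc)

lemma integrable_mult_unit_wave:
  assumes "integrable lborel f" "g \<in> borel_measurable borel" "h \<in> borel_measurable borel"
  shows "integrable lborel (\<lambda>x. f x * unit_wave (g x) (h x) :: complex)"
  using assms by (intro Bochner_Integration.integrable_bound[OF assms(1)]) (auto simp: norm_mult)

lemma borel_measurable_fourier [measurable]: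
  assumes [measurable]: "f \<in> borel_measurable borel"
  shows "fourier f \<in> borel_measurable borel"
  unfolding fourier_eq[abs_def] by (intro lborel.borel_measurable_lebesgue_integral) measurable

lemma norm_fourier_le:
  assumes "integrable lborel f"
  shows "norm (fourier f \<xi>) \<le> (LINT x|lborel. norm (f x))"
proof -
  have "norm (fourier f \<xi>) \<le> (LINT x|lborel. norm (f x * unit_wave (- \<xi>) x))"
    unfolding fourier_eq by (rule integral_norm_bound)
  then show ?thesis by (simp add: norm_mult)
qed

lemma fourier_mult_unit_wave: "fourier (\<lambda>x. f x * unit_wave \<alpha> x) \<xi> = fourier f (\<xi> - \<alpha>)"
  unfolding fourier_eq by (simp add: mult.assoc unit_wave_add[symmetric])

definition bump_hat :: "real \<Rightarrow> complex" where
  "bump_hat = fourier (\<lambda>u. of_real (bump u))"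

lemma integrable_continuous_supp:
  fixes f :: "real \<Rightarrow> 'b::{banach, second_countable_topology}"
  assumes "continuous_on UNIV f" "\<And>x. x \<notin> {a..b} \<Longrightarrow> f x = 0"
  shows "integrable lborel f"
proof -
  have "integrable lborel (\<lambda>x. indicator {a..b} x *\<^sub>R f x)"
    using borel_integrable_compact[of "{a..b}" f] assms(1)
    by (auto intro: continuous_on_subset)
  moreover have "(\<lambda>x. indicator {a..b} x *\<^sub>R f x) = f"
    using assms(2) by (auto simp: indicator_def fun_eq_iff)
  ultimately show ?thesis by simp
qed

lemma integrable_bump: "integrable lborel bump"
  by (rule integrable_continuous_supp[where a = 0 and b = 1])
    (auto intro!: continuous_intros bump_eq_0)

lemma bump_hat_measurable [measurable]: "bump_hat \<in> borel_measurable borel"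
  unfolding bump_hat_def by measurable

lemma bump_hat_bound: "norm (bump_hat s) \<le> 1"
proof -
  have "norm (bump_hat s) \<le> (LINT x|lborel. bump x)"
    unfolding bump_hat_def
    using norm_fourier_le[of "\<lambda>u. of_real (bump u)" s] integrable_bump by (simp add: bump_nonneg)
  also have "\<dots> \<le> (LINT x|lborel. indicator {0..1::real} x)"
    by (rule Bochner_Integration.integral_mono[OF integrable_bump integrable_real_indicator])
      (auto simp: bump_eq_0 bump_le_1 split: split_indicator)
  finally show ?thesis by simp
qed

text \<open>Two integrations by parts. Quadratic decay makes \<open>bump_hat\<close> integrable on
  the line, which inversion requires.\<close>

lemma bump_hat_decay: "\<exists>C. \<forall>s. norm (bump_hat s) \<le> C / (1 + s\<^sup>2)"
proof -
  define b1 where "b1 x = flat_exp 2 x * flat_exp 0 (1 - x) - flat_exp 0 x * flat_exp 2 (1 - x)" for x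
  define b2 where "b2 x = (flat_exp 4 x - 2 * flat_exp 3 x) * flat_exp 0 (1 - x)
     - 2 * flat_exp 2 x * flat_exp 2 (1 - x) + flat_exp 0 x * (flat_exp 4 (1 - x) - 2 * flat_exp 3 (1 - x))" for x
  have d0: "(flat_exp 0 has_real_derivative flat_exp 2 x) (at x)"
    and d2: "(flat_exp 2 has_real_derivative flat_exp 4 x - 2 * flat_exp 3 x) (at x)" for x
    using DERIV_flat_exp[of 0 x] DERIV_flat_exp[of 2 x] by (simp_all add: eval_nat_numeral)
  note dd[derivative_intros] = d0[THEN DERIV_chain2] d2[THEN DERIV_chain2]
  have b1: "(bump has_real_derivative b1 x) (at x)" for x
    unfolding bump_def[abs_def] b1_def by (auto intro!: derivative_eq_intros)
  have b2: "(b1 has_real_derivative b2 x) (at x)" for x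
    unfolding b1_def[abs_def] b2_def by (auto intro!: derivative_eq_intros simp: algebra_simps)
  have cb2: "continuous_on S b2" for S
    unfolding b2_def[abs_def] by (intro continuous_intros)
  have ib2: "integrable lborel b2"
    by (rule integrable_continuous_supp[where a = 0 and b = 1, OF cb2]) (auto simp: b2_def flat_exp_def)
  have key: "of_real (4 * pi\<^sup>2 * s\<^sup>2) * bump_hat s = - fourier (\<lambda>u. of_real (b2 u)) s" for s
  proof -
    define w where "w = 2 * of_real pi * \<i> * of_real s"
    have uw: "unit_wave (- s) x = exp (- (w * of_real x))" for x
      by (simp add: unit_wave_def w_def mult.assoc)
    have w2: "w\<^sup>2 = - of_real (4 * pi\<^sup>2 * s\<^sup>2)"
      by (simp add: w_def power_mult_distrib)
    \<comment> \<open>Both integrations by parts at once: \<open>\<Phi>\<close> is a primitive of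
      \<open>\<phi>\<close> and vanishes at both ends of the support.\<close>
    define \<Phi> where "\<Phi> x = (of_real (b1 x) + w * of_real (bump x)) * exp (- (w * of_real x))" for x
    define \<phi> where "\<phi> x = (of_real (b2 x) - w\<^sup>2 * of_real (bump x)) * exp (- (w * of_real x))" for x
    have "(\<Phi> has_vector_derivative \<phi> x) (at x within S)" for x S
      unfolding \<Phi>_def \<phi>_def
      apply (rule has_vector_derivative_at_within)
      apply (rule derivative_eq_intros b1 b2 
         has_vector_derivative_of_real
         field_vector_diff_chain_at[of _ _ _ exp, unfolded o_def] refl DERIV_exp | simp)+
      apply (simp add: algebra_simps power2_eq_square)
      done
    then have "(LINT x|lborel. indicator {0..1} x *\<^sub>R \<phi> x) = \<Phi> 1 - \<Phi> 0"
      by (intro integral_FTC_Icc) (auto simp: \<phi>_def intro!: continuous_intros cb2)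
    also have "\<dots> = 0" by (simp add: \<Phi>_def b1_def bump_def)
    also have "(\<lambda>x. indicator {0..1} x *\<^sub>R \<phi> x) = \<phi>"
      by (auto simp: fun_eq_iff indicator_def \<phi>_def b2_def bump_def)
    finally have "(LINT x|lborel. \<phi> x) = 0" .
    moreover have "(LINT x|lborel. \<phi> x) = fourier (\<lambda>u. of_real (b2 u)) s - w\<^sup>2 * bump_hat s"
    proof -
      have "(LINT x|lborel. \<phi> x) = (LINT x|lborel. of_real (b2 x) * unit_wave (- s) x -
          w\<^sup>2 * (of_real (bump x) * unit_wave (- s) x))"
        by (simp add: \<phi>_def uw algebra_simps)
      also have "\<dots> = fourier (\<lambda>u. of_real (b2 u)) s - w\<^sup>2 * bump_hat s"
        unfolding bump_hat_def fourier_eq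
        by (subst Bochner_Integration.integral_diff)
          (auto intro!: integrable_mult_unit_wave ib2 integrable_bump)
      finally show ?thesis .
    qed
    ultimately show ?thesis by (simp add: w2 add_eq_0_iff)
  qed
  define K where "K = (LINT x|lborel. \<bar>b2 x\<bar>)"
  have "norm (bump_hat s) \<le> (1 + K) / (1 + s\<^sup>2)" for s
  proof -
    have "4 * pi\<^sup>2 * s\<^sup>2 * norm (bump_hat s) = norm (fourier (\<lambda>u. of_real (b2 u)) s)"
      using arg_cong[OF key[of s], of norm] by (simp add: norm_mult norm_power)
    also have "\<dots> \<le> K"
      using norm_fourier_le[of "\<lambda>u. of_real (b2 u)" s] ib2 by (simp add: K_def)
    finally have "4 * pi\<^sup>2 * s\<^sup>2 * norm (bump_hat s) \<le> K" .
    moreover have "s\<^sup>2 * norm (bump_hat s) \<le> 4 * pi\<^sup>2 * (s\<^sup>2 * norm (bump_hat s))"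
    proof -
      have "1 \<le> 4 * pi\<^sup>2" using pi_gt3 one_le_power[of pi 2] by linarith
      from mult_right_mono[OF this, of "s\<^sup>2 * norm (bump_hat s)"] show ?thesis by simp
    qed
    ultimately have "(1 + s\<^sup>2) * norm (bump_hat s) \<le> 1 + K"
      using bump_hat_bound[of s] by (simp add: algebra_simps)
    moreover have "0 < 1 + s\<^sup>2" by (simp add: add_pos_nonneg)
    ultimately show ?thesis by (simp add: field_simps)
  qed
  then show ?thesis by blast
qed

lemma integrable_bump_hat: "integrable lborel bump_hat"
proof -
  obtain C where C: "\<And>s. norm (bump_hat s) \<le> C / (1 + s\<^sup>2)" using bump_hat_decay by blast
  have "integrable lborel (\<lambda>x::real. inverse (1 + x\<^sup>2))"
    using integrable_inverse_1_plus_square by (simp add: set_integrable_def einterval_def)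
  then have "integrable lborel (\<lambda>x::real. C * inverse (1 + x\<^sup>2))" by simp
  then show ?thesis
    by (rule Bochner_Integration.integrable_bound)
      (use C in \<open>auto simp: divide_inverse intro!: AE_I2 order_trans[OF C]\<close>)
qed

lemma bump_hat_tendsto_0:
  assumes "v \<noteq> 0"
  shows "(\<lambda>k. bump_hat (w + real k * v)) \<longlonglongrightarrow> 0"
proof -
  obtain C where C: "\<And>s. norm (bump_hat s) \<le> C / (1 + s\<^sup>2)" using bump_hat_decay by blast
  have "(\<lambda>k. C / (1 + (w + real k * v)\<^sup>2)) \<longlonglongrightarrow> 0"
  proof (rule tendsto_divide_0[OF tendsto_const])
    have "filterlim (\<lambda>k. v * real k) at_infinity sequentially"
      using \<open>v \<noteq> 0\<close> filterlim_at_top_imp_at_infinity[OF filterlim_real_sequentially]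
      by (rule tendsto_mult_filterlim_at_infinity[OF tendsto_const])
    then have "filterlim (\<lambda>k. w + v * real k) at_infinity sequentially"
      by (rule tendsto_add_filterlim_at_infinity[OF tendsto_const])
    then have "filterlim (\<lambda>k. w + real k * v) at_infinity sequentially"
      by (simp only: mult.commute[of v])
    from filterlim_at_infinity_times[OF this this]
    have "filterlim (\<lambda>k. (w + real k * v)\<^sup>2) at_infinity sequentially"
      unfolding power2_eq_square .
    then show "filterlim (\<lambda>k. 1 + (w + real k * v)\<^sup>2) at_infinity sequentially"
      by (rule tendsto_add_filterlim_at_infinity[OF tendsto_const])
  qed
  then show ?thesis by (rule Lim_null_comparison[rotated]) (use C in auto)
qed

section \<open>Fourier inversion for the bump function\<close>

lemma fourier_gaussian:
  assumes "\<epsilon> > 0"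
  shows "(LINT s|lborel. of_real (std_normal_density (\<epsilon> * s)) * unit_wave \<tau> s) =
    of_real (sqrt (2 * pi) / \<epsilon> * std_normal_density (2 * pi * \<tau> / \<epsilon>))"
proof -
  define F where "F x = std_normal_density x *\<^sub>R iexp (2 * pi * \<tau> / \<epsilon> * x)" for x
  have "(LINT s|lborel. of_real (std_normal_density (\<epsilon> * s)) * unit_wave \<tau> s) =
      (LINT s|lborel. F (0 + \<epsilon> *\<^sub>R s))"
    using assms by (intro Bochner_Integration.integral_cong) (auto simp: F_def unit_wave_def scaleR_conv_of_real mult_ac)
  also have "\<dots> = (1 / \<bar>\<epsilon>\<bar> ^ DIM(real)) *\<^sub>R (LINT x|lborel. F x)"
    using assms by (intro integral_lborel_affine) auto
  also have "(LINT x|lborel. F x) = char std_normal_distribution (2 * pi * \<tau> / \<epsilon>)"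
    unfolding char_def F_def by (subst integral_density) auto
  also have "\<dots> = of_real (exp (- ((2 * pi * \<tau> / \<epsilon>)\<^sup>2) / 2))"
    by (simp only: char_std_normal_distribution)
  also have "(1 / \<bar>\<epsilon>\<bar> ^ DIM(real)) *\<^sub>R (of_real (exp (- ((2 * pi * \<tau> / \<epsilon>)\<^sup>2) / 2)) :: complex) =
      of_real (sqrt (2 * pi) / \<epsilon> * std_normal_density (2 * pi * \<tau> / \<epsilon>))"
    using assms by (simp add: std_normal_density_def scaleR_conv_of_real)
  finally show ?thesis .
qed

lemma std_normal_density_le_1: "std_normal_density x \<le> 1"
proof -
  have "1 \<le> 2 * pi" using pi_gt3 by simp
  then have "1 \<le> sqrt (2 * pi)" by simp
  moreover have "exp (- x\<^sup>2 / 2) \<le> 1" by simp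
  ultimately have "exp (- x\<^sup>2 / 2) \<le> sqrt (2 * pi)" by linarith
  then show ?thesis
    unfolding std_normal_density_def by (simp add: divide_le_eq)
qed

lemma continuous_on_std_normal_density [continuous_intros]:
  "continuous_on S f \<Longrightarrow> continuous_on S (\<lambda>x. std_normal_density (f x))"
  unfolding std_normal_density_def by (intro continuous_intros) auto

text \<open>Inversion by Gaussian regularisation.\<close>

lemma bump_hat_inversion: "(LINT s|lborel. bump_hat s * unit_wave u s) = of_real (bump u)"
proof -
  define \<phi> where "\<phi> = std_normal_density"
  have \<phi>[measurable]: "\<phi> \<in> borel_measurable borel" by (simp add: \<phi>_def)
  have \<phi>i: "integrable lborel \<phi>" and \<phi>1: "(LINT x|lborel. \<phi> x) = 1" and \<phi>0: "\<And>x. \<phi> x \<ge> 0" and \<phi>le: "\<And>x. \<phi> x \<le> 1"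
    by (auto simp: \<phi>_def std_normal_density_le_1)
  have \<phi>c: "isCont \<phi> x" for x
    using continuous_on_std_normal_density[OF continuous_on_id, of UNIV]
    by (simp add: \<phi>_def continuous_on_eq_continuous_at)
  define \<epsilon> where "\<epsilon> k = 1 / real (Suc k)" for k
  have \<epsilon>: "\<epsilon> k > 0" for k by (simp add: \<epsilon>_def)
  have \<epsilon>0: "\<epsilon> \<longlonglongrightarrow> 0" unfolding \<epsilon>_def by (rule lim_1_over_n[THEN LIMSEQ_Suc])
  let ?A = "\<lambda>k. LINT s|lborel. of_real (\<phi> (\<epsilon> k * s)) * (bump_hat s * unit_wave u s)"
  let ?B = "\<lambda>k. LINT z|lborel. bump (u + \<epsilon> k / (2 * pi) * z) * \<phi> z"
  \<comment> \<open>As the Gaussian flattens, the regularised inversion integral tends to the true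
    one times \<open>\<phi> 0\<close>, dominated by \<open>norm (bump_hat s)\<close>.\<close>
  have A0: "?A \<longlonglongrightarrow> (LINT s|lborel. of_real (\<phi> 0) * (bump_hat s * unit_wave u s))"
  proof (rule integral_dominated_convergence[where w = "\<lambda>s. norm (bump_hat s)"])
    show "AE x in lborel. (\<lambda>k. of_real (\<phi> (\<epsilon> k * x)) * (bump_hat x * unit_wave u x)) \<longlonglongrightarrow> of_real (\<phi> 0) * (bump_hat x * unit_wave u x)"
    proof (rule AE_I2)
      fix x
      have "(\<lambda>k. \<epsilon> k * x) \<longlonglongrightarrow> 0" using tendsto_mult_left_zero[OF \<epsilon>0] .
      then have "(\<lambda>k. \<phi> (\<epsilon> k * x)) \<longlonglongrightarrow> \<phi> 0" by (rule isCont_tendsto_compose[OF \<phi>c])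
      then show "(\<lambda>k. of_real (\<phi> (\<epsilon> k * x)) * (bump_hat x * unit_wave u x)) \<longlonglongrightarrow> of_real (\<phi> 0) * (bump_hat x * unit_wave u x)"
        by (intro tendsto_intros)
    qed
    show "AE x in lborel. norm (of_real (\<phi> (\<epsilon> k * x)) * (bump_hat x * unit_wave u x)) \<le> norm (bump_hat x)" for k
      using \<phi>0 \<phi>le by (auto simp: norm_mult intro!: mult_left_le_one_le)
  qed (auto intro: integrable_norm integrable_bump_hat)
  have A1: "(LINT s|lborel. of_real (\<phi> 0) * (bump_hat s * unit_wave u s)) = of_real (\<phi> 0) * (LINT s|lborel. bump_hat s * unit_wave u s)"
    by simp
  have B0: "?B \<longlonglongrightarrow> (LINT z|lborel. bump u * \<phi> z)"
  proof (rule integral_dominated_convergence[where w = \<phi>])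
    show "AE x in lborel. (\<lambda>k. bump (u + \<epsilon> k / (2 * pi) * x) * \<phi> x) \<longlonglongrightarrow> bump u * \<phi> x"
    proof (rule AE_I2)
      fix x
      have "(\<lambda>k. u + \<epsilon> k / (2 * pi) * x) \<longlonglongrightarrow> u + 0 / (2 * pi) * x"
        by (intro tendsto_intros \<epsilon>0) auto
      moreover have "isCont bump (u + 0 / (2 * pi) * x)"
        using continuous_on_bump[OF continuous_on_id, of UNIV] by (simp add: continuous_on_eq_continuous_at)
      ultimately have "(\<lambda>k. bump (u + \<epsilon> k / (2 * pi) * x)) \<longlonglongrightarrow> bump (u + 0 / (2 * pi) * x)"
        by (metis isCont_tendsto_compose)
      then have "(\<lambda>k. bump (u + \<epsilon> k / (2 * pi) * x)) \<longlonglongrightarrow> bump u" by simp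
      then show "(\<lambda>k. bump (u + \<epsilon> k / (2 * pi) * x) * \<phi> x) \<longlonglongrightarrow> bump u * \<phi> x" by (intro tendsto_intros)
    qed
  qed (auto simp: \<phi>i \<phi>0 bump_nonneg bump_le_1 mult_left_le_one_le abs_mult)
  have B1: "(LINT z|lborel. bump u * \<phi> z) = bump u" by (simp add: \<phi>1)
  \<comment> \<open>Fubini trades the Gaussian in \<open>s\<close> for one concentrated at
    \<open>y = u\<close>. After rescaling, the constants combine to
    \<open>1 / sqrt (2 * pi)\<close>, which is \<open>\<phi> 0\<close> and cancels at the
    end.\<close>
  have AB: "?A k = of_real (\<phi> 0) * of_real (?B k)" for k
  proof -
    let ?e = "\<epsilon> k"
    let ?F = "\<lambda>s y. of_real (\<phi> (?e * s)) * of_real (bump y) * unit_wave (u - y) s :: complex"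
    have int: "integrable (lborel \<Otimes>\<^sub>M lborel) (\<lambda>(s, y). ?F s y)"
    proof (rule Bochner_Integration.integrable_bound)
      have "integrable lborel (\<lambda>s. \<phi> (0 + ?e *\<^sub>R s))"
        using \<epsilon>[of k] \<phi>i by (subst integrable_lborel_affine) auto
      then have "integrable lborel (\<lambda>s. \<phi> (?e * s))" by simp
      from integrable_lborel_times[OF this integrable_bump]
      show "integrable (lborel \<Otimes>\<^sub>M lborel) (\<lambda>(s, y). \<phi> (?e * s) * bump y)" .
    qed (auto simp: norm_mult)
    have "?A k = (LINT s|lborel. LINT y|lborel. ?F s y)"
    proof (rule Bochner_Integration.integral_cong[OF refl])
      fix s
      have "of_real (\<phi> (?e * s)) * (bump_hat s * unit_wave u s) =
         (LINT y|lborel. (of_real (\<phi> (?e * s)) * unit_wave u s) * (of_real (bump y) * unit_wave (- s) y))"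
        unfolding bump_hat_def fourier_eq by simp
      also have "\<dots> = (LINT y|lborel. ?F s y)"
        by (intro Bochner_Integration.integral_cong)
          (simp_all add: diff_conv_add_uminus unit_wave_add unit_wave_minus unit_wave_commute[of s] del: add_uminus_conv_diff)
      finally show "of_real (\<phi> (?e * s)) * (bump_hat s * unit_wave u s) = (LINT y|lborel. ?F s y)" .
    qed
    also have "\<dots> = (LINT y|lborel. LINT s|lborel. ?F s y)"
      by (rule lborel_pair.Fubini_integral[OF int, symmetric])
    also have "\<dots> = (LINT y|lborel. of_real (bump y * (sqrt (2 * pi) / ?e * \<phi> (2 * pi * (u - y) / ?e))))"
    proof (rule Bochner_Integration.integral_cong[OF refl])
      fix y
      have "(LINT s|lborel. ?F s y) = (LINT s|lborel. of_real (bump y) * (of_real (\<phi> (?e * s)) * unit_wave (u - y) s))"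
        by (simp add: mult_ac)
      also have "\<dots> = of_real (bump y) * (LINT s|lborel. of_real (\<phi> (?e * s)) * unit_wave (u - y) s)"
        by simp
      also have "\<dots> = of_real (bump y * (sqrt (2 * pi) / ?e * \<phi> (2 * pi * (u - y) / ?e)))"
        using fourier_gaussian[OF \<epsilon>[of k], of "u - y"] by (simp add: \<phi>_def)
      finally show "(LINT s|lborel. ?F s y) = of_real (bump y * (sqrt (2 * pi) / ?e * \<phi> (2 * pi * (u - y) / ?e)))" .
    qed
    also have "\<dots> = of_real (LINT y|lborel. bump y * (sqrt (2 * pi) / ?e * \<phi> (2 * pi * (u - y) / ?e)))"
      by (rule integral_complex_of_real)
    also have "(LINT y|lborel. bump y * (sqrt (2 * pi) / ?e * \<phi> (2 * pi * (u - y) / ?e))) =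
       ?e / (2 * pi) * (LINT z|lborel. bump (u + ?e / (2 * pi) * z) * (sqrt (2 * pi) / ?e * \<phi> (2 * pi * (u - (u + ?e / (2 * pi) * z)) / ?e)))"
      using lborel_integral_real_affine[of "?e / (2 * pi)" "\<lambda>y. bump y * (sqrt (2 * pi) / ?e * \<phi> (2 * pi * (u - y) / ?e))" u] \<epsilon>[of k]
      by simp
    also have "(LINT z|lborel. bump (u + ?e / (2 * pi) * z) * (sqrt (2 * pi) / ?e * \<phi> (2 * pi * (u - (u + ?e / (2 * pi) * z)) / ?e))) =
       (LINT z|lborel. sqrt (2 * pi) / ?e * (bump (u + ?e / (2 * pi) * z) * \<phi> z))"
      using \<epsilon>[of k] by (intro Bochner_Integration.integral_cong) (auto simp: \<phi>_def std_normal_density_def)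
    also have "\<dots> = sqrt (2 * pi) / ?e * ?B k" by simp
    also have "?e / (2 * pi) * (sqrt (2 * pi) / ?e * ?B k) = \<phi> 0 * ?B k"
      using \<epsilon>[of k] by (simp add: \<phi>_def std_normal_density_def field_simps)
    finally show ?thesis by simp
  qed
  have "?A \<longlonglongrightarrow> of_real (\<phi> 0) * of_real (bump u)"
    unfolding AB by (intro tendsto_mult_left tendsto_of_real B0[unfolded B1])
  from LIMSEQ_unique[OF A0[unfolded A1] this] show ?thesis
    by (simp add: \<phi>_def std_normal_density_def)
qed

subsection \<open>Tiles\<close>

text \<open>A smooth bump on the parallelogram where \<open>p \<bullet> x + r\<close> and
  \<open>q \<bullet> x + s\<close> lie in the unit interval. Thin tubes arise by making one of the
  two functionals large.\<close>

definition tile :: "real^2 \<Rightarrow> real \<Rightarrow> real^2 \<Rightarrow> real \<Rightarrow> real^2 \<Rightarrow> real" where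
  "tile p r q s x = bump (p \<bullet> x + r) * bump (q \<bullet> x + s)"

lemma tile_in_packets:
  "cross2 p q \<noteq> 0 \<Longrightarrow> (\<lambda>x. c * of_real (tile p r q s x) * unit_wave \<alpha> x) \<in> packets"
  using packets.packet[of p q c 0 r 0 0 s 0 \<alpha>] by (simp add: tile_def bump_def mult_ac)

lemma tile_nonneg: "0 \<le> tile p r q s x"
  by (simp add: tile_def bump_nonneg)

lemma tile_le_1: "tile p r q s x \<le> 1"
  by (simp add: tile_def bump_nonneg bump_le_1 mult_le_one)

lemma continuous_on_tile [continuous_intros]:
  "continuous_on S f \<Longrightarrow> continuous_on S (\<lambda>x. tile p r q s (f x))"
  unfolding tile_def by (intro continuous_intros)

lemma borel_measurable_tile [measurable]: "tile p r q s \<in> borel_measurable borel"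
  by (intro borel_measurable_continuous_onI continuous_intros)

lemma tile_scaleR: "tile (c *\<^sub>R p) r (c *\<^sub>R q) s x = tile p r q s (c *\<^sub>R x)"
  by (simp add: tile_def)

text \<open>With \<open>dual2\<close> this is the basis dual to \<open>p\<close>, \<open>q\<close>.
  It gives the frequency coordinates of a tile, and later the coordinates adapted to the
  normals.\<close>

definition dual1 :: "real^2 \<Rightarrow> real^2 \<Rightarrow> real^2" where
  "dual1 p q = (1 / cross2 p q) *\<^sub>R vector [q $ 2, - (q $ 1)]"

definition dual2 :: "real^2 \<Rightarrow> real^2 \<Rightarrow> real^2" where
  "dual2 p q = (1 / cross2 p q) *\<^sub>R vector [- (p $ 2), p $ 1]"

lemma inner_eq_dual:
  assumes "cross2 p q \<noteq> 0"
  shows "x \<bullet> \<xi> = (p \<bullet> x) * (dual1 p q \<bullet> \<xi>) + (q \<bullet> x) * (dual2 p q \<bullet> \<xi>)"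
proof -
  have "cross2 p q * (x \<bullet> \<xi>) = (p \<bullet> x) * (q $ 2 * \<xi> $ 1 - q $ 1 * \<xi> $ 2) + (q \<bullet> x) * (p $ 1 * \<xi> $ 2 - p $ 2 * \<xi> $ 1)"
    by (simp add: cross2_def inner_vec_def sum_2 algebra_simps)
  moreover have "cross2 p q * (dual1 p q \<bullet> \<xi>) = q $ 2 * \<xi> $ 1 - q $ 1 * \<xi> $ 2"
    "cross2 p q * (dual2 p q \<bullet> \<xi>) = p $ 1 * \<xi> $ 2 - p $ 2 * \<xi> $ 1"
    using assms by (simp_all add: dual1_def dual2_def inner_vec_def sum_2 right_diff_distrib)
  ultimately have "cross2 p q * (x \<bullet> \<xi>) =
      cross2 p q * ((p \<bullet> x) * (dual1 p q \<bullet> \<xi>) + (q \<bullet> x) * (dual2 p q \<bullet> \<xi>))"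
    by (simp only: distrib_left mult.left_commute[of "cross2 p q"])
  then show ?thesis
    using assms by simp
qed

lemma cross2_scaleR: "cross2 (a *\<^sub>R v) (b *\<^sub>R w) = a * b * cross2 v w"
  by (simp add: cross2_def algebra_simps)

lemma cross2_dual: "cross2 p q \<noteq> 0 \<Longrightarrow> cross2 (dual1 p q) (dual2 p q) = 1 / cross2 p q"
proof -
  assume "cross2 p q \<noteq> 0"
  moreover have "cross2 (vector [q $ 2, - (q $ 1)]) (vector [- (p $ 2), p $ 1]) = cross2 p q"
    by (simp add: cross2_def mult.commute)
  ultimately show ?thesis
    unfolding dual1_def dual2_def cross2_scaleR by simp
qed

lemma integrable_tile: 
  assumes "cross2 p q \<noteq> 0"
  shows "integrable lborel (tile p r q s)"
proof -
  have "integrable lborel (\<lambda>u. bump (r + 1 *\<^sub>R u))" "integrable lborel (\<lambda>u. bump (s + 1 *\<^sub>R u))"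
    using integrable_bump integrable_lborel_affine[of 1 bump r] integrable_lborel_affine[of 1 bump s] by simp_all
  from integrable_lborel_times[OF this]
  have "integrable lborel (\<lambda>y. case y of (u, w) \<Rightarrow> bump (u + r) * bump (w + s))"
    by (simp add: lborel_prod add.commute)
  from integrable_cross2[OF assms, of "\<lambda>(u, w). bump (u + r) * bump (w + s)"] this
  show ?thesis
    by (auto simp: tile_def[abs_def])
qed

text \<open>In the coordinates \<open>p \<bullet> x\<close>, \<open>q \<bullet> x\<close> a tile is
  a tensor product, so its transform is one in the dual coordinates; the offsets only produce
  phases.\<close>

lemma fourier_tile:
  assumes "cross2 p q \<noteq> 0"
  shows "fourier (\<lambda>x. of_real (tile p r q s x)) \<xi> = of_real (1 / \<bar>cross2 p q\<bar>) *
    (bump_hat (dual1 p q \<bullet> \<xi>) * unit_wave (dual1 p q \<bullet> \<xi>) r * (bump_hat (dual2 p q \<bullet> \<xi>) * unit_wave (dual2 p q \<bullet> \<xi>) s))"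
proof -
  have *: "integrable lborel (\<lambda>u. of_real (bump (u + r)) * unit_wave (- \<sigma>) u :: complex)"
    "(LINT u|lborel. of_real (bump (u + r)) * unit_wave (- \<sigma>) u) = bump_hat \<sigma> * unit_wave \<sigma> r" for r \<sigma>
  proof -
    have e: "of_real (bump (u + r)) * unit_wave (- \<sigma>) u =
      (of_real (bump (r + 1 *\<^sub>R u)) * unit_wave (- \<sigma>) (r + 1 *\<^sub>R u)) * unit_wave \<sigma> r" for u
    proof -
      have "unit_wave (- \<sigma>) (r + u) * unit_wave \<sigma> r = unit_wave (- \<sigma>) u"
        by (simp add: unit_wave_def exp_add[symmetric] algebra_simps)
      then show ?thesis by (simp add: add.commute mult.assoc)
    qed
    have i: "integrable lborel (\<lambda>u. of_real (bump u) * unit_wave (- \<sigma>) u :: complex)"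
      by (intro integrable_mult_unit_wave) (auto simp: integrable_bump)
    show "integrable lborel (\<lambda>u. of_real (bump (u + r)) * unit_wave (- \<sigma>) u :: complex)"
      unfolding e using i
      by (intro integrable_mult_left) (subst integrable_lborel_affine[where f = "\<lambda>u. of_real (bump u) * unit_wave (- \<sigma>) u"], auto)
    show "(LINT u|lborel. of_real (bump (u + r)) * unit_wave (- \<sigma>) u) = bump_hat \<sigma> * unit_wave \<sigma> r"
      unfolding e bump_hat_def fourier_eq integral_mult_left_zero
      by (subst integral_lborel_affine[where f = "\<lambda>u. of_real (bump u) * unit_wave (- \<sigma>) u"]) auto
  qed
  let ?a = "dual1 p q \<bullet> \<xi>" and ?b = "dual2 p q \<bullet> \<xi>"
  let ?G = "\<lambda>(u, w). (of_real (bump (u + r)) * unit_wave (- ?a) u) * (of_real (bump (w + s)) * unit_wave (- ?b) w) :: complex"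
  have "fourier (\<lambda>x. of_real (tile p r q s x)) \<xi> = (LINT x|lborel. ?G (p \<bullet> x, q \<bullet> x))"
    unfolding fourier_eq
  proof (rule Bochner_Integration.integral_cong[OF refl])
    fix x
    have "unit_wave (- \<xi>) x = unit_wave (- ?a) (p \<bullet> x) * unit_wave (- ?b) (q \<bullet> x)"
      using inner_eq_dual[OF assms, of x \<xi>]
      by (simp add: unit_wave_def exp_add[symmetric] inner_commute algebra_simps)
    then show "of_real (tile p r q s x) * unit_wave (- \<xi>) x = ?G (p \<bullet> x, q \<bullet> x)"
      by (simp add: tile_def)
  qed
  also have "\<dots> = (1 / \<bar>cross2 p q\<bar>) *\<^sub>R (LINT y|lborel. ?G y)"
    by (rule integral_cross2[OF assms]) (unfold borel_prod[symmetric], measurable)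
  also have "(LINT y|lborel. ?G y) = bump_hat ?a * unit_wave ?a r * (bump_hat ?b * unit_wave ?b s)"
    using integral_lborel_times[OF *(1)[of r ?a] *(1)[of s ?b]] by (simp add: lborel_prod *(2))
  finally show ?thesis by (simp add: scaleR_conv_of_real)
qed

lemma
  assumes "cross2 p q \<noteq> 0"
  shows integrable_fourier_tile: "integrable lborel (fourier (\<lambda>x. of_real (tile p r q s x)))"
    and fourier_tile_inversion: "(LINT \<xi>|lborel. fourier (\<lambda>x. of_real (tile p r q s x)) \<xi> * unit_wave x \<xi>) = of_real (tile p r q s x)"
proof -
  let ?P = "dual1 p q" and ?Q = "dual2 p q" and ?\<Delta> = "cross2 p q"
  have d: "cross2 ?P ?Q \<noteq> 0" using assms by (simp add: cross2_dual)
  let ?h = "\<lambda>r \<sigma>. bump_hat \<sigma> * unit_wave \<sigma> r"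
  have h: "integrable lborel (?h r)" for r
    by (intro integrable_mult_unit_wave integrable_bump_hat) auto
  let ?G = "\<lambda>r s (\<sigma>, \<tau>). ?h r \<sigma> * ?h s \<tau>"
  have G: "integrable lborel (?G r s)" for r s
    using integrable_lborel_times[OF h h] by (simp add: lborel_prod)
  have Gm: "?G r s \<in> borel_measurable borel" for r s
    unfolding borel_prod[symmetric] by measurable
  have "integrable lborel (\<lambda>\<xi>. ?G r s (?P \<bullet> \<xi>, ?Q \<bullet> \<xi>))"
    using integrable_cross2[OF d Gm] G by blast
  then show "integrable lborel (fourier (\<lambda>x. of_real (tile p r q s x)))"
    using assms by (subst fourier_tile[OF assms, abs_def]) auto
  \<comment> \<open>The phase at \<open>x\<close> joins the offsets, which leaves inversion
    integrals of \<open>bump\<close> at \<open>p \<bullet> x + r\<close> and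
    \<open>q \<bullet> x + s\<close>.\<close>
  have "fourier (\<lambda>x. of_real (tile p r q s x)) \<xi> * unit_wave x \<xi> =
     of_real (1 / \<bar>?\<Delta>\<bar>) * ?G (p \<bullet> x + r) (q \<bullet> x + s) (?P \<bullet> \<xi>, ?Q \<bullet> \<xi>)" for \<xi>
  proof -
    have "unit_wave x \<xi> = unit_wave (?P \<bullet> \<xi>) (p \<bullet> x) * unit_wave (?Q \<bullet> \<xi>) (q \<bullet> x)"
      using inner_eq_dual[OF assms, of x \<xi>] by (simp add: unit_wave_def exp_add[symmetric] algebra_simps)
    moreover have "unit_wave \<sigma> (a + b) = unit_wave \<sigma> a * unit_wave \<sigma> b" for \<sigma> a b :: real
      by (simp add: unit_wave_commute[of \<sigma>] unit_wave_add)
    ultimately show ?thesis by (simp add: fourier_tile[OF assms])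
  qed
  then have "(LINT \<xi>|lborel. fourier (\<lambda>x. of_real (tile p r q s x)) \<xi> * unit_wave x \<xi>) =
    of_real (1 / \<bar>?\<Delta>\<bar>) * (LINT \<xi>|lborel. ?G (p \<bullet> x + r) (q \<bullet> x + s) (?P \<bullet> \<xi>, ?Q \<bullet> \<xi>))"
    by simp
  also have "(LINT \<xi>|lborel. ?G (p \<bullet> x + r) (q \<bullet> x + s) (?P \<bullet> \<xi>, ?Q \<bullet> \<xi>)) =
      \<bar>?\<Delta>\<bar> *\<^sub>R (LINT y|lborel. ?G (p \<bullet> x + r) (q \<bullet> x + s) y)"
    using integral_cross2[OF d Gm] assms by (simp add: cross2_dual)
  also have "(LINT y|lborel. ?G (p \<bullet> x + r) (q \<bullet> x + s) y) = of_real (tile p r q s x)"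
    using integral_lborel_times[OF h h, of "p \<bullet> x + r" "q \<bullet> x + s"]
    by (simp add: lborel_prod tile_def unit_wave_commute[where 'a = real, of _ "_ + _"] bump_hat_inversion)
  finally show "(LINT \<xi>|lborel. fourier (\<lambda>x. of_real (tile p r q s x)) \<xi> * unit_wave x \<xi>) = of_real (tile p r q s x)"
    using assms by (simp add: scaleR_conv_of_real)
qed

text \<open>Some dual coordinate of \<open>v\<close> is nonzero; the transform decays in that
  coordinate and the other factor is bounded. This is what separates pieces with different
  frequencies.\<close>

lemma fourier_tile_tendsto_0:
  assumes "cross2 p q \<noteq> 0" "v \<noteq> 0"
  shows "(\<lambda>k. fourier (\<lambda>x. of_real (tile p r q s x)) (w + real k *\<^sub>R v)) \<longlonglongrightarrow> 0"
proof -
  let ?P = "dual1 p q" and ?Q = "dual2 p q"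
  have "?P \<bullet> v \<noteq> 0 \<or> ?Q \<bullet> v \<noteq> 0"
    using inner_eq_dual[OF assms(1), of v v] assms(2) by (metis add.right_neutral inner_eq_zero_iff mult_zero_right)
  moreover have "norm (fourier (\<lambda>x. of_real (tile p r q s x)) \<xi>) \<le> 1 / \<bar>cross2 p q\<bar> * norm (bump_hat (?P \<bullet> \<xi>))"
    "norm (fourier (\<lambda>x. of_real (tile p r q s x)) \<xi>) \<le> 1 / \<bar>cross2 p q\<bar> * norm (bump_hat (?Q \<bullet> \<xi>))" for \<xi>
    using bump_hat_bound assms(1) 
    by (simp_all add: fourier_tile norm_mult norm_divide divide_right_mono mult_left_le mult_left_le_one_le)
  moreover have "(\<lambda>k. 1 / \<bar>cross2 p q\<bar> * norm (bump_hat (d \<bullet> (w + real k *\<^sub>R v)))) \<longlonglongrightarrow> 0" if "d \<bullet> v \<noteq> 0" for d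
    using tendsto_mult_right_zero[OF tendsto_norm_zero[OF bump_hat_tendsto_0[OF that, of "d \<bullet> w"]], of "1 / \<bar>cross2 p q\<bar>"]
    by (simp add: inner_add_right)
  ultimately show ?thesis
    by (elim disjE) (rule Lim_null_comparison[OF always_eventually, rotated], assumption, blast)+
qed

subsection \<open>The trilinear form in other coordinates of \<open>\<Gamma>\<close>\<close>

text \<open>For \<open>a \<noteq> j\<close> this parametrises \<open>\<Gamma>\<close> by its
  components \<open>a\<close> and \<open>j\<close>, the third being forced. One argument then covers
  all choices of the indices, although \<open>trilinear_form\<close> is written in the components 1
  and 2.\<close>

definition emb :: "3 \<Rightarrow> 3 \<Rightarrow> real^2 \<Rightarrow> real^2 \<Rightarrow> (real^2)^3" where
  "emb a j z e = (\<chi> k. if k = a then z else if k = j then e else - z - e)"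

lemma emb_in_Gamma: "a \<noteq> j \<Longrightarrow> emb a j z e \<in> \<Gamma>"
  using exhaust_3[of a] exhaust_3[of j] by (auto simp: emb_def \<Gamma>_def)

lemma emb_swap: "a \<noteq> j \<Longrightarrow> emb a j z e = emb j a e z"
  by (auto simp: emb_def vec_eq_iff)

lemma emb_shear:
  assumes "a \<noteq> j" "b \<noteq> a" "b \<noteq> j"
  shows "emb a j z (- z - e) = emb a b z e"
  using assms exhaust_3[of a] exhaust_3[of j] exhaust_3[of b] by (auto simp: emb_def vec_eq_iff forall_3)

lemma emb_scaleR: "emb a j (c *\<^sub>R z) (c *\<^sub>R e) = c *\<^sub>R emb a j z e"
  by (simp add: emb_def vec_eq_iff algebra_simps)

lemma emb_add: "emb a j (z + z') (e + e') = emb a j z e + emb a j z' e'"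
  by (simp add: emb_def vec_eq_iff algebra_simps)

lemma emb_components:
  "emb a j z e $ a = z" "a \<noteq> j \<Longrightarrow> emb a j z e $ j = e" "b \<noteq> a \<Longrightarrow> b \<noteq> j \<Longrightarrow> emb a j z e $ b = - z - e"
  by (auto simp: emb_def)

lemma UNIV_3_eq:
  assumes "(a::3) \<noteq> j" "b \<noteq> a" "b \<noteq> j"
  shows "UNIV = {a, j, b}"
proof -
  have "x = a \<or> x = j \<or> x = b" for x
    using exhaust_3[of x] exhaust_3[of a] exhaust_3[of j] exhaust_3[of b] assms
    by (elim disjE) simp_all
  then show ?thesis by blast
qed

lemma Gamma_eq_emb:
  assumes "\<xi> \<in> \<Gamma>" "a \<noteq> j"
  shows "\<xi> = emb a j (\<xi> $ a) (\<xi> $ j)"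
proof -
  have "\<xi> $ k = - \<xi> $ a - \<xi> $ j" if "k \<noteq> a" "k \<noteq> j" for k
  proof -
    have "(\<Sum>k\<in>UNIV. \<xi> $ k) = 0" using assms(1) by (simp add: \<Gamma>_def sum_3)
    then have "\<xi> $ a + (\<xi> $ j + \<xi> $ k) = 0"
      using assms(2) that by (simp add: UNIV_3_eq[OF assms(2) that])
    then show ?thesis by (subst eq_iff_diff_eq_0) (simp add: algebra_simps)
  qed
  then show ?thesis by (auto simp: emb_def vec_eq_iff)
qed

lemma continuous_on_emb [continuous_intros]:
  assumes "continuous_on S f" "continuous_on S g"
  shows "continuous_on S (\<lambda>x. emb a j (f x) (g x))"
  unfolding emb_def
proof (rule continuous_on_vec_lambda)
  fix k show "continuous_on S (\<lambda>x. if k = a then f x else if k = j then g x else - f x - g x)"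
    using assms by (cases "k = a"; cases "k = j") (auto intro!: continuous_intros)
qed

lemma
  fixes f :: "real^2 \<Rightarrow> real^2 \<Rightarrow> complex"
  assumes f: "integrable lborel (\<lambda>(x, y). f x y)"
  shows integrable_swap: "integrable lborel (\<lambda>(x, y). f y x)"
    and integral_swap: "(LINT w|lborel. (case w of (x, y) \<Rightarrow> f y x)) = (LINT w|lborel. (case w of (x, y) \<Rightarrow> f x y))"
    and integral_iterated: "(LINT w|lborel. (case w of (x, y) \<Rightarrow> f x y)) = (LINT x|lborel. LINT y|lborel. f x y)"
proof -
  have f': "integrable (lborel \<Otimes>\<^sub>M lborel) (\<lambda>(x, y). f x y)" using f by (simp add: lborel_prod)
  show "integrable lborel (\<lambda>(x, y). f y x)"
    using lborel_pair.integrable_product_swap[OF f'] by (simp add: lborel_prod)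
  show "(LINT w|lborel. (case w of (x, y) \<Rightarrow> f y x)) = (LINT w|lborel. (case w of (x, y) \<Rightarrow> f x y))"
    using lborel_pair.integral_product_swap[of "\<lambda>(x, y). f x y"] f' by (simp add: lborel_prod)
  show "(LINT w|lborel. (case w of (x, y) \<Rightarrow> f x y)) = (LINT x|lborel. LINT y|lborel. f x y)"
    using lborel_pair.integral_fst'[OF f'] by (simp add: lborel_prod)
qed

lemma
  fixes f :: "real^2 \<Rightarrow> real^2 \<Rightarrow> complex"
  assumes f: "integrable lborel (\<lambda>(x, y). f x y)"
  shows integrable_shear: "integrable lborel (\<lambda>(x, y). f x (- x - y))"
    and integral_shear: "(LINT w|lborel. (case w of (x, y) \<Rightarrow> f x (- x - y))) = (LINT w|lborel. (case w of (x, y) \<Rightarrow> f x y))"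
proof -
  have f': "integrable (lborel \<Otimes>\<^sub>M lborel) (\<lambda>(x, y). f x y)" using f by (simp add: lborel_prod)
  then have [measurable]: "(\<lambda>(x, y). f x y) \<in> borel_measurable (borel \<Otimes>\<^sub>M borel)" by simp
  have 1: "(LINT y|lborel. g (- x - y)) = (LINT y|lborel. g y)"
    for g :: "real^2 \<Rightarrow> 'b::{banach, second_countable_topology}" and x
    using integral_lborel_affine[of "-1" g "- x"] by simp
  have 2: "integrable lborel (\<lambda>y. g (- x - y)) \<longleftrightarrow> integrable lborel g"
    for g :: "real^2 \<Rightarrow> complex" and x
    using integrable_lborel_affine[of "-1" g "- x"] by simp
  have i: "integrable (lborel \<Otimes>\<^sub>M lborel) (\<lambda>(x, y). f x (- x - y))"
  proof (rule lborel_pair.Fubini_integrable)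
    have "(\<lambda>(x, y). (x, - x - y)) \<in> borel \<Otimes>\<^sub>M borel \<rightarrow>\<^sub>M (borel :: (real^2) measure) \<Otimes>\<^sub>M (borel :: (real^2) measure)"
      by measurable
    from measurable_compose[OF this \<open>(\<lambda>(x, y). f x y) \<in> borel_measurable (borel \<Otimes>\<^sub>M borel)\<close>]
    show "(\<lambda>(x, y). f x (- x - y)) \<in> borel_measurable (lborel \<Otimes>\<^sub>M lborel)"
      by (simp add: case_prod_beta')
    show "integrable lborel (\<lambda>x. LINT y|lborel. norm (case (x, y) of (x, y) \<Rightarrow> f x (- x - y)))"
      using lborel_pair.integrable_fst'[OF integrable_norm[OF f']] by (simp add: 1[of "\<lambda>y. norm (f _ y)"])
    show "AE x in lborel. integrable lborel (\<lambda>y. case (x, y) of (x, y) \<Rightarrow> f x (- x - y))"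
      using lborel_pair.AE_integrable_fst'[OF f'] by (simp add: 2)
  qed
  then show i': "integrable lborel (\<lambda>(x, y). f x (- x - y))" by (simp add: lborel_prod)
  show "(LINT w|lborel. (case w of (x, y) \<Rightarrow> f x (- x - y))) = (LINT w|lborel. (case w of (x, y) \<Rightarrow> f x y))"
    by (simp add: integral_iterated[OF i'] integral_iterated[OF f] 1)
qed

text \<open>Swapping the two components, and replacing one of them by the third, generate all six
  parametrisations, and both operations preserve Lebesgue measure.\<close>

lemma integral_emb:
  fixes \<Phi> :: "(real^2)^3 \<Rightarrow> complex"
  assumes "a \<noteq> j" and int: "integrable lborel (\<lambda>(z, e). \<Phi> (emb a j z e))"
  shows "(LINT z|lborel. LINT e|lborel. \<Phi> (emb 1 2 z e)) = (LINT w|lborel. (case w of (z, e) \<Rightarrow> \<Phi> (emb a j z e)))"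
proof -
  define S where "S a j I \<longleftrightarrow> integrable lborel (\<lambda>(z, e). \<Phi> (emb a j z e)) \<and>
     (LINT w|lborel. (case w of (z, e) \<Rightarrow> \<Phi> (emb a j z e))) = I" for a j I
  have swap: "S a j I \<Longrightarrow> S j a I" if "a \<noteq> j" for a j I
    using integrable_swap[of "\<lambda>z e. \<Phi> (emb a j z e)"] integral_swap[of "\<lambda>z e. \<Phi> (emb a j z e)"] that
    by (simp add: S_def emb_swap[of a j])
  have shear: "S a j I \<Longrightarrow> S a b I" if "a \<noteq> j" "b \<noteq> a" "b \<noteq> j" for a j b I
    using integrable_shear[of "\<lambda>z e. \<Phi> (emb a j z e)"] integral_shear[of "\<lambda>z e. \<Phi> (emb a j z e)"] that
    by (simp add: S_def emb_shear[of a j b])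
  define I where "I = (LINT w|lborel. (case w of (z, e) \<Rightarrow> \<Phi> (emb a j z e)))"
  have aj: "S a j I" using int by (simp add: S_def I_def)
  have cases: "a = 1 \<and> j = 2 \<or> a = 2 \<and> j = 1 \<or> a = 1 \<and> j = 3 \<or> a = 3 \<and> j = 1 \<or> a = 2 \<and> j = 3 \<or> a = 3 \<and> j = 2"
    using exhaust_3[of a] exhaust_3[of j] assms(1) by auto
  have s21: "S 1 2 I" if "S 2 1 I" using swap[OF _ that] by simp
  have s13: "S 1 2 I" if "S 1 3 I" using shear[OF _ _ _ that] by simp
  have s31: "S 1 2 I" if "S 3 1 I" using s13 swap[OF _ that] by simp
  have s23: "S 1 2 I" if "S 2 3 I" using s21 shear[OF _ _ _ that, of 1] by simp
  have s32: "S 1 2 I" if "S 3 2 I" using s23 swap[OF _ that] by simp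
  from cases have "S 1 2 I"
    by (elim disjE conjE) (use aj s21 s13 s31 s23 s32 in blast)+
  then show ?thesis
    using integral_iterated[of "\<lambda>z e. \<Phi> (emb 1 2 z e)"] by (simp add: S_def I_def)
qed

lemma trilinear_form_emb:
  assumes ne: "a \<noteq> j" "b \<noteq> a" "b \<noteq> j"
    and int: "integrable lborel (\<lambda>(z, e). indicator D (emb a j z e) * fourier (f a) z * fourier (f j) e * fourier (f b) (- z - e))"
  shows "trilinear_form D f = (LINT w|lborel. (case w of (z, e) \<Rightarrow>
    indicator D (emb a j z e) * fourier (f a) z * fourier (f j) e * fourier (f b) (- z - e)))"
proof -
  define \<Phi> where "\<Phi> \<xi> = indicator D \<xi> * (\<Prod>k\<in>UNIV. fourier (f k) (\<xi> $ k))" for \<xi>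
  have \<Phi>: "\<Phi> (emb a j z e) = indicator D (emb a j z e) * fourier (f a) z * fourier (f j) e * fourier (f b) (- z - e)" for z e
    unfolding \<Phi>_def UNIV_3_eq[OF ne] using ne by (simp add: emb_components mult_ac)
  have \<Phi>12: "\<Phi> (emb 1 2 z e) = indicator D (vector [z, e, - z - e]) * fourier (f 1) z * fourier (f 2) e * fourier (f 3) (- z - e)" for z e
  proof -
    have "emb 1 2 z e = vector [z, e, - z - e]"
      by (simp add: emb_def vec_eq_iff forall_3)
    then show ?thesis unfolding \<Phi>_def UNIV_3 by (simp add: mult.assoc)
  qed
  show ?thesis
    using integral_emb[OF ne(1), of \<Phi>] int by (simp add: \<Phi> \<Phi>12 trilinear_form_def)
qed

section \<open>Behaviour under dilations\<close>

lemma fourier_scaleR: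
  fixes f :: "real^2 \<Rightarrow> complex"
  assumes "c \<noteq> 0"
  shows "fourier (\<lambda>x. f (c *\<^sub>R x)) \<xi> = of_real (1 / c\<^sup>2) * fourier f ((1 / c) *\<^sub>R \<xi>)"
proof -
  let ?g = "\<lambda>x. f x * unit_wave (- ((1 / c) *\<^sub>R \<xi>)) x"
  have "fourier (\<lambda>x. f (c *\<^sub>R x)) \<xi> = (LINT x|lborel. ?g (0 + c *\<^sub>R x))"
    unfolding fourier_eq using assms by (simp add: unit_wave_def)
  also have "\<dots> = (1 / \<bar>c\<bar> ^ DIM(real^2)) *\<^sub>R (LINT x|lborel. ?g x)"
    by (rule integral_lborel_affine[OF assms])
  finally show ?thesis by (simp add: fourier_eq scaleR_conv_of_real)
qed

text \<open>Three transforms contribute \<open>1 / c ^ 6\<close> and two plane integrals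
  \<open>c ^ 4\<close>. The remaining \<open>1 / c ^ 2\<close> is what the three norms contribute
  when the \<open>1 / p k\<close> sum to one.\<close>

lemma trilinear_form_scaleR:
  assumes "c \<noteq> 0"
  shows "trilinear_form D (\<lambda>k x. f k (c *\<^sub>R x)) = of_real (1 / c\<^sup>2) * trilinear_form {\<xi>. c *\<^sub>R \<xi> \<in> D} f"
proof -
  let ?c = "1 / c"
  define G where "G \<xi>\<^sub>1 \<xi>\<^sub>2 = indicator {\<xi>. c *\<^sub>R \<xi> \<in> D} (vector [\<xi>\<^sub>1, \<xi>\<^sub>2, - \<xi>\<^sub>1 - \<xi>\<^sub>2]) *
     fourier (f 1) \<xi>\<^sub>1 * fourier (f 2) \<xi>\<^sub>2 * fourier (f 3) (- \<xi>\<^sub>1 - \<xi>\<^sub>2)" for \<xi>\<^sub>1 \<xi>\<^sub>2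
  have v: "c *\<^sub>R (vector [?c *\<^sub>R x, ?c *\<^sub>R y, - ?c *\<^sub>R x - ?c *\<^sub>R y] :: (real^2)^3) = vector [x, y, - x - y]" for x y :: "real^2"
    using assms by (simp add: vec_eq_iff forall_3 algebra_simps)
  have "trilinear_form D (\<lambda>k x. f k (c *\<^sub>R x)) =
     (LINT x|lborel. LINT y|lborel. of_real (1 / c ^ 6) * G (0 + ?c *\<^sub>R x) (0 + ?c *\<^sub>R y))"
    unfolding trilinear_form_def fourier_scaleR[OF assms] G_def
    by (intro Bochner_Integration.integral_cong refl)
      (use v in \<open>simp add: indicator_def scaleR_diff_right power_divide field_simps\<close>)
  also have "\<dots> = of_real (1 / c ^ 6) * (LINT x|lborel. LINT y|lborel. G (0 + ?c *\<^sub>R x) (0 + ?c *\<^sub>R y))"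
    by simp
  also have "(LINT x|lborel. LINT y|lborel. G (0 + ?c *\<^sub>R x) (0 + ?c *\<^sub>R y)) =
      (LINT x|lborel. c\<^sup>2 *\<^sub>R (LINT y|lborel. G (0 + ?c *\<^sub>R x) y))"
    using assms by (subst integral_lborel_affine) (auto simp: power_divide)
  also have "\<dots> = c\<^sup>2 *\<^sub>R (LINT x|lborel. (LINT y|lborel. G (0 + ?c *\<^sub>R x) y))"
    by simp
  also have "\<dots> = c\<^sup>2 *\<^sub>R c\<^sup>2 *\<^sub>R (LINT x|lborel. (LINT y|lborel. G x y))"
    using assms by (subst integral_lborel_affine[where f = "\<lambda>x. LINT y|lborel. G x y"]) (auto simp: power_divide)
  also have "(LINT x|lborel. (LINT y|lborel. G x y)) = trilinear_form {\<xi>. c *\<^sub>R \<xi> \<in> D} f"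
    by (simp add: G_def trilinear_form_def)
  finally show ?thesis
    using assms by (simp add: scaleR_conv_of_real field_simps power2_eq_square eval_nat_numeral)
qed

subsection \<open>Blow-up at several boundary points\<close>

lemma AE_hyperplane:
  fixes v :: "'a::euclidean_space"
  assumes "v \<noteq> 0"
  shows "AE w in lborel. v \<bullet> w \<noteq> 0"
proof -
  have "negligible {w. v \<bullet> w = 0}" using assms by (intro negligible_hyperplane) auto
  moreover have "{w. v \<bullet> w = 0} \<in> sets borel" by (intro borel_closed closed_hyperplane)
  ultimately have "{w. v \<bullet> w = 0} \<in> null_sets lborel"
    by (simp add: negligible_iff_null_sets null_sets_def)
  then show ?thesis by (rule AE_I') auto
qed

text \<open>The pieces \<open>i \<noteq> l\<close> disappear because their frequencies do not sum up to zero.\<close>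

lemma trilinear_form_blow_up:
  fixes A C :: "'i \<Rightarrow> real^2 \<Rightarrow> complex" and B :: "real^2 \<Rightarrow> complex" and f :: "nat \<Rightarrow> 3 \<Rightarrow> real^2 \<Rightarrow> complex"
  assumes ne: "a \<noteq> j" "b \<noteq> a" "b \<noteq> j"
    and D[measurable]: "D \<in> sets borel" and fin: "finite I" and inj: "inj_on \<alpha> I"
    and A: "\<And>i. i \<in> I \<Longrightarrow> integrable lborel (A i)" and B: "integrable lborel B"
    and C: "\<And>i. i \<in> I \<Longrightarrow> C i \<in> borel_measurable borel" "\<And>i \<xi>. i \<in> I \<Longrightarrow> norm (C i \<xi>) \<le> K"
    and C0: "\<And>i v w. i \<in> I \<Longrightarrow> v \<noteq> 0 \<Longrightarrow> (\<lambda>k. C i (w + real k *\<^sub>R v)) \<longlonglongrightarrow> 0"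
    and n0: "\<And>i. i \<in> I \<Longrightarrow> n i \<noteq> 0"
    and tangent: "\<And>i z e. i \<in> I \<Longrightarrow> n i \<bullet> z + m i \<bullet> e \<noteq> 0 \<Longrightarrow>
      \<forall>\<^sub>F k in sequentially. emb a j (\<alpha> i + (1 / real k) *\<^sub>R z) (\<eta> + (1 / real k) *\<^sub>R e) \<in> D \<longleftrightarrow> n i \<bullet> z + m i \<bullet> e < 0"
    and fa: "\<And>k z. fourier (f k a) z = (\<Sum>i\<in>I. A i (z - real k *\<^sub>R \<alpha> i))"
    and fj: "\<And>k e. fourier (f k j) e = B (e - real k *\<^sub>R \<eta>)"
    and fb: "\<And>k x. fourier (f k b) x = (\<Sum>i\<in>I. C i (x + real k *\<^sub>R (\<alpha> i + \<eta>)))"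
  shows "(\<lambda>k. trilinear_form {\<xi>. (1 / real k) *\<^sub>R \<xi> \<in> D} (f k)) \<longlonglongrightarrow>
    (\<Sum>i\<in>I. LINT w|lborel. (case w of (z, e) \<Rightarrow> (if n i \<bullet> z + m i \<bullet> e < 0 then A i z * B e * C i (- z - e) else 0)))"
proof -
  note [measurable] = C(1) borel_measurable_integrable[OF A, simplified] borel_measurable_integrable[OF B, simplified]
  let ?E = "\<lambda>k i z e. indicator D (emb a j (\<alpha> i + (1 / real k) *\<^sub>R z) (\<eta> + (1 / real k) *\<^sub>R e)) :: complex"
  \<comment> \<open>The contribution of \<open>A i\<close> and \<open>C l\<close> after moving the
    frequency \<open>k (\<alpha> i, \<eta>)\<close> to the origin: the domain is magnified at
    \<open>(\<alpha> i, \<eta>)\<close>, and the mismatch \<open>k (\<alpha> l - \<alpha> i)\<close>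
    stays in \<open>C l\<close>.\<close>
  define T where "T k i l w = (case w of (z, e) \<Rightarrow> ?E k i z e * A i z * B e * C l (- z - e + real k *\<^sub>R (\<alpha> l - \<alpha> i)))" for k i l w
  define W where "W i w = (case w of (z, e) \<Rightarrow> norm (A i z) * norm (B e))" for i w
  have W: "integrable lborel (\<lambda>w. K * W i w)" if "i \<in> I" for i
    unfolding W_def using integrable_lborel_times[OF integrable_norm[OF A[OF that]] integrable_norm[OF B]]
    by (simp add: lborel_prod case_prod_beta')
  have Em: "(\<lambda>w. indicator D (emb a j (x + c *\<^sub>R fst w) (y + c *\<^sub>R snd w)) :: complex) \<in> borel_measurable borel" for x y c
  proof -
    have "(\<lambda>w. emb a j (x + c *\<^sub>R fst w) (y + c *\<^sub>R snd w)) \<in> borel_measurable borel"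
      by (intro borel_measurable_continuous_onI continuous_intros)
    then show ?thesis by measurable
  qed
  have Tm: "T k i l \<in> borel_measurable lborel" if "i \<in> I" "l \<in> I" for k i l
  proof -
    have [measurable]: "A i \<in> borel_measurable borel" "C l \<in> borel_measurable borel" "B \<in> borel_measurable borel"
      using that A B C by auto
    have [measurable]: "fst \<in> borel_measurable (borel :: ((real^2) \<times> (real^2)) measure)"
       "snd \<in> borel_measurable (borel :: ((real^2) \<times> (real^2)) measure)"
      by (intro borel_measurable_continuous_onI continuous_intros)+
    note Em[of "\<alpha> i" "1 / real k" \<eta>, measurable]
    show ?thesis unfolding T_def case_prod_beta' by measurable
  qed
  have Tle: "norm (T k i l w) \<le> K * W i w" if "i \<in> I" "l \<in> I" for k i l w
  proof -
    have "norm (?E k i z e * A i z * B e * C l x) \<le> K * (norm (A i z) * norm (B e))" for z e x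
    proof -
      have "norm (?E k i z e) * (norm (A i z) * norm (B e)) * norm (C l x) \<le> 1 * (norm (A i z) * norm (B e)) * K"
        using C(2)[OF that(2)] by (intro mult_mono) (auto simp: indicator_def)
      then show ?thesis by (simp add: norm_mult mult_ac)
    qed
    then show ?thesis by (simp add: T_def W_def case_prod_beta')
  qed
  have Ti: "integrable lborel (T k i l)" if "i \<in> I" "l \<in> I" for k i l
    by (rule Bochner_Integration.integrable_bound[OF W[OF that(1)] Tm[OF that]])
      (use Tle[OF that] in \<open>auto intro!: AE_I2 order_trans[OF Tle[OF that]]\<close>)
  have step: "trilinear_form {\<xi>. (1 / real k) *\<^sub>R \<xi> \<in> D} (f k) = (\<Sum>i\<in>I. \<Sum>l\<in>I. LINT w|lborel. T k i l w)"
    if "k > 0" for k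
  proof -
    let ?D = "{\<xi>. (1 / real k) *\<^sub>R \<xi> \<in> D}"
    have s: "indicator ?D (emb a j z e) * fourier (f k a) z * fourier (f k j) e * fourier (f k b) (- z - e) =
       (\<Sum>i\<in>I. \<Sum>l\<in>I. T k i l (- (real k *\<^sub>R (\<alpha> i, \<eta>)) + 1 *\<^sub>R (z, e)))" for z e
    proof -
      have "T k i l (- (real k *\<^sub>R (\<alpha> i, \<eta>)) + 1 *\<^sub>R (z, e)) =
        indicator ?D (emb a j z e) * A i (z - real k *\<^sub>R \<alpha> i) * B (e - real k *\<^sub>R \<eta>) * C l (- z - e + real k *\<^sub>R (\<alpha> l + \<eta>))" for i l
        using that by (simp add: T_def indicator_def emb_scaleR[symmetric] algebra_simps)
      then show ?thesis
        by (simp add: fa fj fb sum_distrib_left sum_distrib_right)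
          (subst sum.swap, simp add: mult_ac)
    qed
    have i: "integrable lborel (\<lambda>w. T k i l (- (real k *\<^sub>R (\<alpha> i, \<eta>)) + 1 *\<^sub>R w))" if "i \<in> I" "l \<in> I" for i l
      by (subst integrable_lborel_affine) (auto simp: Ti[OF that])
    have "trilinear_form ?D (f k) = (LINT w|lborel. (case w of (z, e) \<Rightarrow>
      indicator ?D (emb a j z e) * fourier (f k a) z * fourier (f k j) e * fourier (f k b) (- z - e)))"
    proof (rule trilinear_form_emb[OF ne])
      have "integrable lborel (\<lambda>w. (\<Sum>i\<in>I. \<Sum>l\<in>I. T k i l (- (real k *\<^sub>R (\<alpha> i, \<eta>)) + 1 *\<^sub>R w)))"
        by (intro Bochner_Integration.integrable_sum i)
      then show "integrable lborel (\<lambda>(z, e). indicator ?D (emb a j z e) * fourier (f k a) z * fourier (f k j) e * fourier (f k b) (- z - e))"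
        unfolding s by (simp only: case_prod_beta' prod.collapse)
    qed
    also have "\<dots> = (LINT w|lborel. (\<Sum>i\<in>I. \<Sum>l\<in>I. T k i l (- (real k *\<^sub>R (\<alpha> i, \<eta>)) + 1 *\<^sub>R w)))"
      unfolding s by (simp only: case_prod_beta' prod.collapse)
    also have "\<dots> = (\<Sum>i\<in>I. \<Sum>l\<in>I. LINT w|lborel. T k i l (- (real k *\<^sub>R (\<alpha> i, \<eta>)) + 1 *\<^sub>R w))"
      by (subst Bochner_Integration.integral_sum, (intro Bochner_Integration.integrable_sum i; assumption))
        (intro sum.cong refl Bochner_Integration.integral_sum i)
    also have "\<dots> = (\<Sum>i\<in>I. \<Sum>l\<in>I. LINT w|lborel. T k i l w)"
      by (subst integral_lborel_affine) auto
    finally show ?thesis .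
  qed
  have lim: "(\<lambda>k. LINT w|lborel. T k i l w) \<longlonglongrightarrow>
     (if i = l then LINT w|lborel. (case w of (z, e) \<Rightarrow> (if n i \<bullet> z + m i \<bullet> e < 0 then A i z * B e * C i (- z - e) else 0)) else 0)"
    if il: "i \<in> I" "l \<in> I" for i l
  proof (cases "i = l")
    case False
    have "(\<lambda>k. LINT w|lborel. T k i l w) \<longlonglongrightarrow> (LINT w|(lborel :: ((real^2) \<times> (real^2)) measure). (0::complex))"
    proof (rule integral_dominated_convergence[where w = "\<lambda>w. K * W i w"])
      show "AE w in lborel. (\<lambda>k. T k i l w) \<longlonglongrightarrow> 0"
      proof (rule AE_I2)
        fix w :: "(real^2) \<times> (real^2)"
        obtain z e where w: "w = (z, e)" by fastforce
        have "\<alpha> l - \<alpha> i \<noteq> 0" using False inj il by (auto simp: inj_on_def)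
        from tendsto_mult_right_zero[OF tendsto_norm_zero[OF C0[OF il(2) this, of "- z - e"]], of "norm (A i z) * norm (B e)"]
        have lim0: "(\<lambda>k. norm (A i z) * norm (B e) * norm (C l (- z - e + real k *\<^sub>R (\<alpha> l - \<alpha> i)))) \<longlonglongrightarrow> 0" .
        show "(\<lambda>k. T k i l w) \<longlonglongrightarrow> 0"
        proof (rule Lim_null_comparison[OF _ lim0], rule always_eventually, rule allI)
          fix k
          have "norm (?E k i z e) * (norm (A i z) * norm (B e) * norm (C l x)) \<le> 1 * (norm (A i z) * norm (B e) * norm (C l x))" for x
            by (intro mult_right_mono) (auto simp: indicator_def)
          then show "norm (T k i l w) \<le> norm (A i z) * norm (B e) * norm (C l (- z - e + real k *\<^sub>R (\<alpha> l - \<alpha> i)))"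
            by (simp add: T_def w norm_mult mult_ac)
        qed
      qed
    qed (use Tm[OF il] Tle[OF il] W[OF il(1)] in auto)
    with False show ?thesis by simp
  next
    case True
    have [measurable]: "A i \<in> borel_measurable borel" "C i \<in> borel_measurable borel" "B \<in> borel_measurable borel"
      using il A B C by auto
    have "(\<lambda>k. LINT w|lborel. T k i i w) \<longlonglongrightarrow> (LINT w|lborel. (case w of (z, e) \<Rightarrow> (if n i \<bullet> z + m i \<bullet> e < 0 then A i z * B e * C i (- z - e) else 0)))"
    proof (rule integral_dominated_convergence[where w = "\<lambda>w. K * W i w"])
      \<comment> \<open>Magnification decides membership in \<open>D\<close> everywhere except on
        the tangent hyperplane itself, which is a null set.\<close>
      have "AE w in lborel. (n i, m i) \<bullet> w \<noteq> 0"
        using n0[OF il(1)] by (intro AE_hyperplane) (auto simp: zero_prod_def)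
      then show "AE w in lborel. (\<lambda>k. T k i i w) \<longlonglongrightarrow> (case w of (z, e) \<Rightarrow> (if n i \<bullet> z + m i \<bullet> e < 0 then A i z * B e * C i (- z - e) else 0))"
      proof eventually_elim
        case (elim w)
        obtain z e where w: "w = (z, e)" by fastforce
        have "n i \<bullet> z + m i \<bullet> e \<noteq> 0" using elim w by (simp add: inner_prod_def)
        from tangent[OF il(1) this]
        have "\<forall>\<^sub>F k in sequentially. T k i i w = (case w of (z, e) \<Rightarrow> (if n i \<bullet> z + m i \<bullet> e < 0 then A i z * B e * C i (- z - e) else 0))"
          by eventually_elim (auto simp: T_def w indicator_def)
        then show ?case by (rule tendsto_eventually)
      qed
      have [measurable]: "fst \<in> borel_measurable (borel :: ((real^2) \<times> (real^2)) measure)"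
       "snd \<in> borel_measurable (borel :: ((real^2) \<times> (real^2)) measure)"
        by (intro borel_measurable_continuous_onI continuous_intros)+
      show "(\<lambda>w. case w of (z, e) \<Rightarrow> (if n i \<bullet> z + m i \<bullet> e < 0 then A i z * B e * C i (- z - e) else 0)) \<in> borel_measurable lborel"
        unfolding case_prod_beta' by measurable
    qed (use Tm[OF il(1) il(1)] Tle[OF il(1) il(1)] W[OF il(1)] in auto)
    with True show ?thesis by simp
  qed
  have "(\<lambda>k. \<Sum>i\<in>I. \<Sum>l\<in>I. LINT w|lborel. T k i l w) \<longlonglongrightarrow> (\<Sum>i\<in>I. \<Sum>l\<in>I. (if i = l then LINT w|lborel. (case w of (z, e) \<Rightarrow> (if n i \<bullet> z + m i \<bullet> e < 0 then A i z * B e * C i (- z - e) else 0)) else 0))"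
    by (intro tendsto_sum lim)
  also have "(\<Sum>i\<in>I. \<Sum>l\<in>I. (if i = l then LINT w|lborel. (case w of (z, e) \<Rightarrow> (if n i \<bullet> z + m i \<bullet> e < 0 then A i z * B e * C i (- z - e) else 0)) else 0)) =
    (\<Sum>i\<in>I. LINT w|lborel. (case w of (z, e) \<Rightarrow> (if n i \<bullet> z + m i \<bullet> e < 0 then A i z * B e * C i (- z - e) else 0)))"
    using fin by (simp add: sum.delta)
  finally show ?thesis
    by (rule Lim_transform_eventually) (use step in \<open>auto intro!: eventually_mono[OF eventually_gt_at_top[of 0]]\<close>)
qed

subsection \<open>Half-space multipliers\<close>

text \<open>The cut near 0 bounds the integrand by \<open>1 / r\<close> uniformly in
  \<open>\<theta>\<close>. Fubini's theorem needs this when \<open>\<theta>\<close> later ranges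
  over an unbounded set.\<close>

lemma truncated_Dirichlet:
  assumes "0 < r" "r \<le> T"
  shows "(LINT t|lborel. indicator {r..T} t * (sin (t * \<theta>) / t)) =
    sgn \<theta> * (Si (T * \<bar>\<theta>\<bar>) - Si (r * \<bar>\<theta>\<bar>))"
proof -
  let ?f = "\<lambda>t. sin (t * \<theta>) / t"
  have 1: "(LINT t|lborel. indicator {r..T} t * ?f t) = (LBINT t=r..T. ?f t)"
    using assms by (simp add: interval_integral_Icc set_lebesgue_integral_def)
  have "(LBINT t=0..r. ?f t) + (LBINT t=r..T. ?f t) = (LBINT t=0..T. ?f t)"
  proof (rule interval_integral_sum)
    have "min 0 (min (ereal r) (ereal T)) = ereal 0" "max 0 (max (ereal r) (ereal T)) = ereal T"
      using assms by (simp_all add: min_def max_def zero_ereal_def)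
    then show "interval_lebesgue_integrable lborel (min 0 (min (ereal r) (ereal T))) (max 0 (max (ereal r) (ereal T))) ?f"
      using integrable_sinc'[of T \<theta>] assms by (simp add: zero_ereal_def)
  qed
  then show ?thesis
    using LBINT_I0c_sin_scale_divide[of r \<theta>] LBINT_I0c_sin_scale_divide[of T \<theta>] assms 1
    by (simp add: algebra_simps)
qed

lemma truncated_Dirichlet_limit:
  "(\<lambda>k. sgn \<theta> * (Si (real (Suc k) * \<bar>\<theta>\<bar>) - Si (1 / real (Suc k) * \<bar>\<theta>\<bar>))) \<longlonglongrightarrow> sgn \<theta> * (pi / 2)"
proof (cases "\<theta> = 0")
  case False
  have "filterlim (\<lambda>k. real (Suc k)) at_top sequentially"
    using filterlim_real_sequentially by (rule filterlim_sequentially_Suc[THEN iffD2, of real at_top, unfolded o_def] )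
  then have "filterlim (\<lambda>k. real (Suc k) * \<bar>\<theta>\<bar>) at_top sequentially"
    using False by (intro filterlim_at_top_mult_tendsto_pos[OF tendsto_const]) auto
  then have 1: "(\<lambda>k. Si (real (Suc k) * \<bar>\<theta>\<bar>)) \<longlonglongrightarrow> pi / 2"
    by (rule filterlim_compose[OF Si_at_top])
  have "(\<lambda>k. 1 / real (Suc k) * \<bar>\<theta>\<bar>) \<longlonglongrightarrow> 0"
    by (rule tendsto_mult_left_zero[OF lim_1_over_n[THEN LIMSEQ_Suc]])
  then have "(\<lambda>k. Si (1 / real (Suc k) * \<bar>\<theta>\<bar>)) \<longlonglongrightarrow> Si 0"
    by (rule isCont_tendsto_compose[OF isCont_Si])
  moreover have "Si 0 = 0" by (simp add: Si_def zero_ereal_def)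
  ultimately have 2: "(\<lambda>k. Si (1 / real (Suc k) * \<bar>\<theta>\<bar>)) \<longlonglongrightarrow> 0" by simp
  show ?thesis using tendsto_mult_left[OF tendsto_diff[OF 1 2], of "sgn \<theta>"] by simp
qed simp

text \<open>Off a null set the indicator of the half-space is \<open>(1 - sgn) / 2\<close>, and
  Dirichlet's integral makes \<open>sgn\<close> a superposition of sines, so that only the transform
  of \<open>\<Theta>\<close> along the line through \<open>v\<close> matters. The support condition
  removes the negative half of that line, and at \<open>t = 0\<close> it says that the total
  integral of \<open>\<Theta>\<close> is 0.\<close>

lemma half_space_integral:
  fixes \<Theta> :: "'a::euclidean_space \<Rightarrow> complex"
  assumes \<Theta>: "integrable lborel \<Theta>" and "v \<noteq> 0" "0 < t0"
    and supp: "\<And>t. t \<notin> {t0<..<t1} \<Longrightarrow> fourier \<Theta> (t *\<^sub>R v) = 0"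
  shows "(LINT w|lborel. (if v \<bullet> w < 0 then \<Theta> w else 0)) =
    - \<i> / (2 * pi) * (LINT t|lborel. indicator {t0..t1} t *\<^sub>R (fourier \<Theta> (t *\<^sub>R v) / t))"
proof -
  note [measurable] = borel_measurable_integrable[OF \<Theta>, simplified]
  define X where "X = (LINT t|lborel. indicator {t0..t1} t *\<^sub>R (fourier \<Theta> (t *\<^sub>R v) / t))"
  define d where "d k \<theta> = (LINT t|lborel. indicator {1 / real (Suc k)..real (Suc k)} t * (sin (t * \<theta>) / t))" for k \<theta>
  have k1: "1 / real (Suc k) \<le> real (Suc k)" for k by (rule order_trans[of _ 1]) auto
  have d: "d k \<theta> = sgn \<theta> * (Si (real (Suc k) * \<bar>\<theta>\<bar>) - Si (1 / real (Suc k) * \<bar>\<theta>\<bar>))" for k \<theta>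
    unfolding d_def by (rule truncated_Dirichlet) (use k1 in auto)
  obtain K where K: "\<And>T. \<bar>Si T\<bar> \<le> K" using bounded_Si by blast
  have dle: "\<bar>d k \<theta>\<bar> \<le> 2 * K" for k \<theta>
  proof -
    have "\<bar>d k \<theta>\<bar> \<le> 1 * \<bar>Si (real (Suc k) * \<bar>\<theta>\<bar>) - Si (1 / real (Suc k) * \<bar>\<theta>\<bar>)\<bar>"
      unfolding d abs_mult by (intro mult_right_mono) (auto simp: abs_sgn_eq)
    also have "\<dots> \<le> 2 * K"
      using abs_triangle_ineq4[of "Si (real (Suc k) * \<bar>\<theta>\<bar>)" "Si (1 / real (Suc k) * \<bar>\<theta>\<bar>)"]
        K[of "real (Suc k) * \<bar>\<theta>\<bar>"] K[of "1 / real (Suc k) * \<bar>\<theta>\<bar>"] by (simp only: mult_1)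
    finally show ?thesis .
  qed
  have lim: "(\<lambda>k. LINT w|lborel. of_real (d k (2 * pi * (v \<bullet> w))) * \<Theta> w) \<longlonglongrightarrow>
     (LINT w|lborel. of_real (sgn (2 * pi * (v \<bullet> w)) * (pi / 2)) * \<Theta> w)"
  proof (rule integral_dominated_convergence[where w = "\<lambda>w. 2 * K * norm (\<Theta> w)"])
    show "integrable lborel (\<lambda>w. 2 * K * norm (\<Theta> w))"
      by (intro integrable_mult_right integrable_norm \<Theta>)
    show "AE w in lborel. (\<lambda>k. of_real (d k (2 * pi * (v \<bullet> w))) * \<Theta> w) \<longlonglongrightarrow> of_real (sgn (2 * pi * (v \<bullet> w)) * (pi / 2)) * \<Theta> w"
      unfolding d by (intro AE_I2 tendsto_mult_right tendsto_of_real truncated_Dirichlet_limit)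
    show "AE w in lborel. norm (of_real (d k (2 * pi * (v \<bullet> w))) * \<Theta> w) \<le> 2 * K * norm (\<Theta> w)" for k
      by (auto simp: norm_mult intro!: mult_right_mono dle)
    show "(\<lambda>w. of_real (d k (2 * pi * (v \<bullet> w))) * \<Theta> w) \<in> borel_measurable lborel" for k
      unfolding d by measurable
  qed measurable
  have dX: "(LINT w|lborel. of_real (d k (2 * pi * (v \<bullet> w))) * \<Theta> w) =
     (\<i> / 2) * (LINT t|lborel. indicator {1 / real (Suc k)..real (Suc k)} t *\<^sub>R (fourier \<Theta> (t *\<^sub>R v) / t))" for k
  proof -
    let ?I = "indicator {1 / real (Suc k)..real (Suc k)} :: real \<Rightarrow> real"
    let ?F = "\<lambda>t w. of_real (?I t * (sin (t * (2 * pi * (v \<bullet> w))) / t)) * \<Theta> w"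
    have int: "integrable (lborel \<Otimes>\<^sub>M lborel) (\<lambda>(t, w). ?F t w)"
    proof (rule Bochner_Integration.integrable_bound)
      have "integrable lborel (\<lambda>t. real (Suc k) * ?I t)"
        by (intro integrable_mult_right integrable_real_indicator)
          (use k1 in \<open>auto simp: emeasure_lborel_Icc_eq simp del: of_nat_Suc\<close>)
      from integrable_lborel_times[OF this integrable_norm[OF \<Theta>]]
      show "integrable (lborel \<Otimes>\<^sub>M lborel) (\<lambda>(t, w). real (Suc k) * ?I t * norm (\<Theta> w))" .
      have "norm (?F t w) \<le> real (Suc k) * ?I t * norm (\<Theta> w)" for t w
      proof -
        have "\<bar>sin (t * (2 * pi * (v \<bullet> w))) / t\<bar> \<le> real (Suc k)" if "t \<in> {1 / real (Suc k)..real (Suc k)}"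
        proof -
          have t0: "t > 0"
            using that by (auto intro: less_le_trans[of 0 "1 / real (Suc k)" t])
          then have t: "t > 0" "1 / t \<le> real (Suc k)"
            using that by (simp_all add: field_simps)
          have "\<bar>sin (t * (2 * pi * (v \<bullet> w))) / t\<bar> \<le> 1 / t"
            using t by (simp add: abs_divide divide_right_mono)
          with t show ?thesis by linarith
        qed
        then have "\<bar>?I t * (sin (t * (2 * pi * (v \<bullet> w))) / t)\<bar> \<le> real (Suc k) * ?I t"
          by (simp add: indicator_def del: of_nat_Suc)
        then show ?thesis
          unfolding norm_mult norm_of_real by (rule mult_right_mono) simp
      qed
      then show "AE x in lborel \<Otimes>\<^sub>M lborel. norm (case x of (t, w) \<Rightarrow> ?F t w) \<le> norm (case x of (t, w) \<Rightarrow> real (Suc k) * ?I t * norm (\<Theta> w))"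
        by (intro AE_I2) (auto simp: abs_mult simp del: of_nat_Suc)
    qed measurable
    have "(LINT w|lborel. of_real (d k (2 * pi * (v \<bullet> w))) * \<Theta> w) = (LINT w|lborel. LINT t|lborel. ?F t w)"
      unfolding d_def by (simp flip: integral_complex_of_real integral_mult_left_zero)
    also have "\<dots> = (LINT t|lborel. LINT w|lborel. ?F t w)"
      by (rule lborel_pair.Fubini_integral[OF int])
    also have "\<dots> = (LINT t|lborel. (\<i> / 2) * (?I t *\<^sub>R (fourier \<Theta> (t *\<^sub>R v) / t)))"
    proof (rule Bochner_Integration.integral_cong[OF refl])
      fix t
      have int': "integrable lborel (\<lambda>w. \<Theta> w * unit_wave (t *\<^sub>R v) w)" "integrable lborel (\<lambda>w. \<Theta> w * unit_wave (- (t *\<^sub>R v)) w)"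
        by (intro integrable_mult_unit_wave \<Theta>; simp)+
      have sin: "of_real (sin (t * (2 * pi * (v \<bullet> w)))) * \<Theta> w =
         - (\<i> / 2) * (\<Theta> w * unit_wave (t *\<^sub>R v) w - \<Theta> w * unit_wave (- (t *\<^sub>R v)) w)" for w
        by (simp add: unit_wave_def sin_of_real[symmetric] sin_exp_eq field_simps)
      have "(LINT w|lborel. ?F t w) = of_real (?I t / t) * (LINT w|lborel. of_real (sin (t * (2 * pi * (v \<bullet> w)))) * \<Theta> w)"
        by (simp flip: integral_mult_right_zero add: mult_ac)
      also have "(LINT w|lborel. of_real (sin (t * (2 * pi * (v \<bullet> w)))) * \<Theta> w) =
         - (\<i> / 2) * (fourier \<Theta> ((- t) *\<^sub>R v) - fourier \<Theta> (t *\<^sub>R v))"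
        unfolding sin using int' by (simp add: fourier_eq)
      also have "of_real (?I t / t) * \<dots> = (\<i> / 2) * (?I t *\<^sub>R (fourier \<Theta> (t *\<^sub>R v) / t))"
      proof (cases "t \<in> {1 / real (Suc k)..real (Suc k)}")
        case True
        then have "t > 0" by (auto intro: less_le_trans[of 0 "1 / real (Suc k)" t])
        then have "fourier \<Theta> ((- t) *\<^sub>R v) = 0" using \<open>0 < t0\<close> by (intro supp) auto
        then show ?thesis by (simp add: scaleR_conv_of_real mult_ac)
      qed simp
      finally show "(LINT w|lborel. ?F t w) = (\<i> / 2) * (?I t *\<^sub>R (fourier \<Theta> (t *\<^sub>R v) / t))" .
    qed
    also have "\<dots> = (\<i> / 2) * (LINT t|lborel. ?I t *\<^sub>R (fourier \<Theta> (t *\<^sub>R v) / t))" by (rule integral_mult_right_zero)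
    finally show ?thesis .
  qed
  have "\<forall>\<^sub>F k in sequentially. (\<i> / 2) * (LINT t|lborel. indicator {1 / real (Suc k)..real (Suc k)} t *\<^sub>R (fourier \<Theta> (t *\<^sub>R v) / t)) = (\<i> / 2) * X"
  proof -
    \<comment> \<open>Once the truncation contains the interval from \<open>t0\<close> to
      \<open>t1\<close>, the integral no longer changes with \<open>k\<close>.\<close>
    obtain N1 :: nat where N1: "t1 < real N1" using reals_Archimedean2 by blast
    obtain N2 :: nat where N2: "1 / t0 < real N2" using reals_Archimedean2 by blast
    show ?thesis
      unfolding X_def
    proof (rule eventually_sequentiallyI[of "max N1 N2"], rule arg_cong[where f = "\<lambda>x. (\<i> / 2) * x"],
        rule Bochner_Integration.integral_cong[OF refl])
      fix k t assume k: "max N1 N2 \<le> k"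
      have "1 / real (Suc k) \<le> t0"
        using k N2 \<open>0 < t0\<close> by (simp add: field_simps) (smt (verit) mult_left_mono of_nat_mono max.bounded_iff)
      moreover have "t1 \<le> real (Suc k)" using k N1 by simp
      ultimately show "indicator {1 / real (Suc k)..real (Suc k)} t *\<^sub>R (fourier \<Theta> (t *\<^sub>R v) / t) = indicator {t0..t1} t *\<^sub>R (fourier \<Theta> (t *\<^sub>R v) / t)"
        using supp[of t] by (cases "t \<in> {t0<..<t1}") (auto simp: indicator_def)
    qed
  qed
  then have "(\<lambda>k. LINT w|lborel. of_real (d k (2 * pi * (v \<bullet> w))) * \<Theta> w) \<longlonglongrightarrow> (\<i> / 2) * X"
    unfolding dX by (rule tendsto_eventually)
  from LIMSEQ_unique[OF lim this]
  have "(LINT w|lborel. of_real (sgn (2 * pi * (v \<bullet> w)) * (pi / 2)) * \<Theta> w) = (\<i> / 2) * X" .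
  then have "of_real (pi / 2) * (LINT w|lborel. of_real (sgn (v \<bullet> w)) * \<Theta> w) = (\<i> / 2) * X"
    by (simp add: sgn_mult mult_ac flip: integral_mult_right_zero)
  then have sgn: "(LINT w|lborel. of_real (sgn (v \<bullet> w)) * \<Theta> w) = \<i> / pi * X"
    by (simp add: field_simps)
  have "integrable lborel (\<lambda>w. of_real (sgn (v \<bullet> w)) * \<Theta> w)"
    by (rule Bochner_Integration.integrable_bound[OF \<Theta>]) (auto simp: norm_mult sgn_real_def)
  then have "(LINT w|lborel. (1 / 2) * (\<Theta> w - of_real (sgn (v \<bullet> w)) * \<Theta> w)) = (1 / 2) * ((LINT w|lborel. \<Theta> w) - \<i> / pi * X)"
    using \<Theta> sgn by simp
  moreover have "(LINT w|lborel. \<Theta> w) = 0"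
    using supp[of 0] \<open>0 < t0\<close> by (simp add: fourier_eq)
  moreover have "(LINT w|lborel. (if v \<bullet> w < 0 then \<Theta> w else 0)) = (LINT w|lborel. (1 / 2) * (\<Theta> w - of_real (sgn (v \<bullet> w)) * \<Theta> w))"
    by (rule integral_cong_AE, measurable, use AE_hyperplane[OF \<open>v \<noteq> 0\<close>] in eventually_elim) (auto simp: sgn_real_def)
  ultimately show ?thesis by (simp add: X_def)
qed

text \<open>Expand the transform of \<open>h\<close> as an integral over \<open>x\<close> and
  integrate in \<open>z\<close> and \<open>e\<close> first: inversion returns \<open>f\<close> and
  \<open>g\<close> at points moved by \<open>t n\<close> and \<open>t m\<close>. This exhibits the
  half-space form as a Hilbert transform along \<open>n\<close> that drags \<open>g\<close> with
  it.\<close>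

lemma fourier_triple:
  fixes f g h :: "real^2 \<Rightarrow> complex"
  assumes f: "integrable lborel (fourier f)" "\<And>x. (LINT \<xi>|lborel. fourier f \<xi> * unit_wave x \<xi>) = f x"
    and g: "integrable lborel (fourier g)" "\<And>x. (LINT \<xi>|lborel. fourier g \<xi> * unit_wave x \<xi>) = g x"
    and h: "integrable lborel h"
  defines "\<Theta> \<equiv> (\<lambda>(z, e). fourier f z * fourier g e * fourier h (- z - e))"
  shows "integrable lborel \<Theta>"
    and "fourier \<Theta> (t *\<^sub>R (n, m)) = (LINT x|lborel. f (x - t *\<^sub>R n) * g (x - t *\<^sub>R m) * h x)"
proof -
  note [measurable] = borel_measurable_integrable[OF f(1), simplified] borel_measurable_integrable[OF g(1), simplified]
    borel_measurable_integrable[OF h, simplified]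
  have fg: "integrable lborel (\<lambda>(z, e). fourier f z * fourier g e)"
    using integrable_lborel_times[OF f(1) g(1)] by (simp add: lborel_prod)
  have [measurable]: "fst \<in> borel_measurable (borel :: ((real^2) \<times> (real^2)) measure)"
     "snd \<in> borel_measurable (borel :: ((real^2) \<times> (real^2)) measure)"
    by (intro borel_measurable_continuous_onI continuous_intros)+
  show \<Theta>: "integrable lborel \<Theta>"
  proof (rule Bochner_Integration.integrable_bound)
    show "integrable lborel (\<lambda>w. (LINT x|lborel. norm (h x)) * norm (case w of (z, e) \<Rightarrow> fourier f z * fourier g e))"
      by (intro integrable_mult_right integrable_norm fg)
    show "AE w in lborel. norm (\<Theta> w) \<le> norm ((LINT x|lborel. norm (h x)) * norm (case w of (z, e) \<Rightarrow> fourier f z * fourier g e))"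
    proof (rule AE_I2)
      fix w :: "(real^2) \<times> (real^2)"
      have "norm (fourier h \<xi>) \<le> (LINT x|lborel. norm (h x))" for \<xi> by (rule norm_fourier_le[OF h])
      then show "norm (\<Theta> w) \<le> norm ((LINT x|lborel. norm (h x)) * norm (case w of (z, e) \<Rightarrow> fourier f z * fourier g e))"
        by (cases w) (auto simp: \<Theta>_def norm_mult mult.commute intro!: mult_right_mono)
    qed
    show "\<Theta> \<in> borel_measurable lborel" unfolding \<Theta>_def case_prod_beta' by measurable
  qed
  let ?F = "\<lambda>x w. h x * (case w of (z, e) \<Rightarrow> (fourier f z * unit_wave (x - t *\<^sub>R n) z) * (fourier g e * unit_wave (x - t *\<^sub>R m) e))"
  have int: "integrable (lborel \<Otimes>\<^sub>M lborel) (\<lambda>(x, w). ?F x w)"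
  proof (rule Bochner_Integration.integrable_bound)
    show "integrable (lborel \<Otimes>\<^sub>M lborel) (\<lambda>(x, w). h x * (case w of (z, e) \<Rightarrow> fourier f z * fourier g e))"
      by (rule integrable_lborel_times[OF h fg])
    show "(\<lambda>(x, w). ?F x w) \<in> borel_measurable (lborel \<Otimes>\<^sub>M lborel)"
      unfolding case_prod_beta' by measurable
  qed (auto simp: norm_mult case_prod_beta')
  have "fourier \<Theta> (t *\<^sub>R (n, m)) = (LINT w|lborel. LINT x|lborel. ?F x w)"
    unfolding fourier_eq[of \<Theta>]
  proof (rule Bochner_Integration.integral_cong[OF refl])
    fix w :: "(real^2) \<times> (real^2)"
    obtain z e where w: "w = (z, e)" by fastforce
    have u: "unit_wave (- (t *\<^sub>R (n, m))) w * unit_wave (z + e) x = unit_wave (x - t *\<^sub>R n) z * unit_wave (x - t *\<^sub>R m) e" for x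
      by (simp add: w unit_wave_def inner_prod_def exp_add[symmetric] inner_commute inner_diff_left inner_add_right algebra_simps)
    have "\<Theta> w * unit_wave (- (t *\<^sub>R (n, m))) w = (LINT x|lborel. (fourier f z * fourier g e * unit_wave (- (t *\<^sub>R (n, m))) w) * (h x * unit_wave (z + e) x))"
    proof -
      have "fourier h (- z - e) = (LINT x|lborel. h x * unit_wave (z + e) x)"
        by (simp add: fourier_eq add.commute)
      then show ?thesis
        unfolding integral_mult_right_zero by (simp add: \<Theta>_def w mult_ac)
    qed
    also have "\<dots> = (LINT x|lborel. ?F x w)"
    proof (intro Bochner_Integration.integral_cong refl)
      fix x
      have "unit_wave (z + e) x * unit_wave (- (t *\<^sub>R n), - (t *\<^sub>R m)) (z, e) = unit_wave (x - t *\<^sub>R m) e * unit_wave (x - t *\<^sub>R n) z"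
        using u[of x] by (simp add: w mult.commute)
      then show "(fourier f z * fourier g e * unit_wave (- (t *\<^sub>R (n, m))) w) * (h x * unit_wave (z + e) x) = ?F x w"
        by (simp add: w mult_ac)
    qed
    finally show "\<Theta> w * unit_wave (- (t *\<^sub>R (n, m))) w = (LINT x|lborel. ?F x w)" .
  qed
  also have "\<dots> = (LINT x|lborel. LINT w|lborel. ?F x w)"
    by (rule lborel_pair.Fubini_integral[OF int])
  also have "\<dots> = (LINT x|lborel. f (x - t *\<^sub>R n) * g (x - t *\<^sub>R m) * h x)"
  proof (rule Bochner_Integration.integral_cong[OF refl])
    fix x
    have "integrable lborel (\<lambda>z. fourier f z * unit_wave (x - t *\<^sub>R n) z)" "integrable lborel (\<lambda>z. fourier g z * unit_wave (x - t *\<^sub>R m) z)"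
      by (intro integrable_mult_unit_wave f g; simp)+
    from integral_lborel_times[OF this]
    show "(LINT w|lborel. ?F x w) = f (x - t *\<^sub>R n) * g (x - t *\<^sub>R m) * h x"
      by (simp add: lborel_prod f(2) g(2) mult.commute)
  qed
  finally show "fourier \<Theta> (t *\<^sub>R (n, m)) = (LINT x|lborel. f (x - t *\<^sub>R n) * g (x - t *\<^sub>R m) * h x)" .
qed

subsection \<open>A Kakeya set\<close>

text \<open>Keich's construction: the digits of the slope decide the intercept in such a way that over
  \<open>u \<approx> k / n\<close> the lines cluster into \<open>2 ^ k\<close> groups.\<close>

definition slope :: "nat set \<Rightarrow> real" where
  "slope A = (\<Sum>k\<in>A. (1 / 2) ^ k)"

definition intercept :: "nat \<Rightarrow> nat set \<Rightarrow> real" where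
  "intercept n A = - (\<Sum>k\<in>A. (1 / 2) ^ k * (real k / real n))"

text \<open>Digit \<open>k\<close> contributes a line through height 0 at \<open>u = k / n\<close>,
  so every digit has little influence near its own pivot.\<close>

lemma line_eq: "slope A * u + intercept n A = (\<Sum>k\<in>A. (1 / 2) ^ k * (u - real k / real n))"
  by (simp add: slope_def intercept_def sum_distrib_right sum_subtractf[symmetric] right_diff_distrib)

lemma sum_half_powers: "k \<le> n \<Longrightarrow> (\<Sum>l\<in>{k<..n}. (1 / 2 :: real) ^ l) = (1 / 2) ^ k - (1 / 2) ^ n"
proof (induction n rule: dec_induct)
  case (step m)
  then have "{k<..Suc m} = insert (Suc m) {k<..m}" by auto
  with step show ?case by simp
qed simp

lemma slope_bounds:
  assumes "A \<subseteq> {1..n}"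
  shows "0 \<le> slope A" "slope A \<le> 1"
proof -
  show "0 \<le> slope A" unfolding slope_def by (intro sum_nonneg) auto
  have "slope A \<le> (\<Sum>l\<in>{0<..n}. (1 / 2 :: real) ^ l)"
    unfolding slope_def using assms by (intro sum_mono2) auto
  also have "\<dots> \<le> 1" by (simp add: sum_half_powers)
  finally show "slope A \<le> 1" .
qed

text \<open>At the first differing digit \<open>k\<close>, the set \<open>B\<close> can only make up
  with later digits, whose geometric sum falls short of \<open>(1 / 2) ^ k\<close> by
  \<open>(1 / 2) ^ n\<close>. Decreasing weights favour the earlier digit further.\<close>

lemma digit_separation_aux:
  fixes w :: "nat \<Rightarrow> real"
  assumes A: "A \<subseteq> {1..n}" and B: "B \<subseteq> {1..n}" and k: "k \<in> A" "k \<notin> B"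
    and eq: "A \<inter> {..<k} = B \<inter> {..<k}"
    and w1: "\<And>k. k \<in> {1..n} \<Longrightarrow> 1 \<le> w k" and w: "\<And>k l. 1 \<le> k \<Longrightarrow> k \<le> l \<Longrightarrow> l \<le> n \<Longrightarrow> w l \<le> w k"
  shows "(1 / 2) ^ n \<le> (\<Sum>k\<in>A. (1 / 2) ^ k * w k) - (\<Sum>k\<in>B. (1 / 2) ^ k * w k)"
proof -
  let ?f = "\<lambda>k. (1 / 2) ^ k * w k"
  let ?P = "A \<inter> {..<k}"
  have kn: "1 \<le> k" "k \<le> n" using k A by auto
  have f0: "0 \<le> ?f l" if "l \<in> {1..n}" for l using w1[OF that] by simp
  have fin: "finite A" "finite B" using A B by (auto intro: finite_subset)
  have "sum ?f ?P + ?f k = sum ?f (insert k ?P)" using fin by simp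
  also have "\<dots> \<le> sum ?f A" using fin A k by (intro sum_mono2 f0) auto
  finally have 1: "sum ?f ?P + ?f k \<le> sum ?f A" .
  have "sum ?f B \<le> sum ?f (?P \<union> {k<..n})"
  proof (rule sum_mono2)
    show "B \<subseteq> ?P \<union> {k<..n}"
    proof
      fix x assume "x \<in> B"
      then show "x \<in> ?P \<union> {k<..n}"
        using B k unfolding eq by (cases x k rule: linorder_cases) auto
    qed
    show "0 \<le> ?f b" if "b \<in> ?P \<union> {k<..n} - B" for b using that A kn by (intro f0) auto
  qed (use fin in auto)
  also have "\<dots> = sum ?f ?P + sum ?f {k<..n}" using fin by (intro sum.union_disjoint) auto
  also have "sum ?f {k<..n} \<le> (\<Sum>l\<in>{k<..n}. (1 / 2) ^ l * w k)"
    using w[of k] kn by (intro sum_mono mult_left_mono) auto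
  also have "\<dots> = ((1 / 2) ^ k - (1 / 2) ^ n) * w k"
    using kn by (simp add: sum_distrib_right[symmetric] sum_half_powers)
  finally have 2: "sum ?f B \<le> sum ?f ?P + ((1 / 2) ^ k - (1 / 2) ^ n) * w k" by simp
  have "(1 / 2) ^ n * 1 \<le> (1 / 2) ^ n * w k" using w1[of k] kn by (intro mult_left_mono) auto
  with 1 2 show ?thesis unfolding left_diff_distrib by linarith
qed

lemma digit_separation:
  fixes w :: "nat \<Rightarrow> real"
  assumes A: "A \<subseteq> {1..n}" and B: "B \<subseteq> {1..n}" and "A \<noteq> B"
    and w1: "\<And>k. k \<in> {1..n} \<Longrightarrow> 1 \<le> w k" and w: "\<And>k l. 1 \<le> k \<Longrightarrow> k \<le> l \<Longrightarrow> l \<le> n \<Longrightarrow> w l \<le> w k"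
  shows "(1 / 2) ^ n \<le> \<bar>(\<Sum>k\<in>A. (1 / 2) ^ k * w k) - (\<Sum>k\<in>B. (1 / 2) ^ k * w k)\<bar>"
proof -
  let ?S = "(A - B) \<union> (B - A)"
  define k where "k = Min ?S"
  have S: "finite ?S" "?S \<noteq> {}" using assms by (auto intro: finite_subset)
  have "k \<in> ?S" unfolding k_def using S by (rule Min_in)
  moreover have "A \<inter> {..<k} = B \<inter> {..<k}"
    using Min_le[OF S(1)] unfolding k_def[symmetric] by (auto dest: leD)
  ultimately show ?thesis
    using digit_separation_aux[OF A B _ _ _ w1 w, of k] digit_separation_aux[OF B A _ _ _ w1 w, of k] by fastforce
qed

lemma inj_on_slope: "inj_on slope (Pow {1..n})"
proof (rule inj_onI, rule ccontr)
  fix A B assume "A \<in> Pow {1..n}" "B \<in> Pow {1..n}" "slope A = slope B" "A \<noteq> B"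
  then have "(1 / 2) ^ n \<le> \<bar>slope A - slope B\<bar>"
    using digit_separation[of A n B "\<lambda>_. 1"] by (simp add: slope_def)
  with \<open>slope A = slope B\<close> show False using zero_less_power[of "1 / 2 :: real" n] by linarith
qed

text \<open>For \<open>u \<ge> 2\<close> the weights \<open>u - k / n\<close> are at least 1 and
  decrease in \<open>k\<close>, so the digits still separate the lines. Tubes of thickness
  \<open>(1 / 2) ^ n\<close> are therefore disjoint there.\<close>

lemma lines_separated:
  assumes "A \<subseteq> {1..n}" "B \<subseteq> {1..n}" "A \<noteq> B" "2 \<le> u"
  shows "(1 / 2) ^ n \<le> \<bar>(slope A * u + intercept n A) - (slope B * u + intercept n B)\<bar>"
  unfolding line_eq
proof (rule digit_separation[OF assms(1-3)])
  fix k assume "k \<in> {1..n}"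
  then have "real k / real n \<le> 1" by simp
  with assms(4) show "1 \<le> u - real k / real n" by linarith
qed (auto intro!: divide_right_mono)

text \<open>The subtracted tail makes the induction close. The target is the factor 3, which is the
  sum of \<open>(i + 1) / 2 ^ i\<close> over \<open>i \<ge> 1\<close>.\<close>

lemma sum_Suc_half_powers: "k \<le> n \<Longrightarrow> (\<Sum>l\<in>{k<..n}. (1 / 2 :: real) ^ l * real (l + 1 - k)) \<le> 3 * (1 / 2) ^ k - (1 / 2) ^ n * (real (n - k) + 3)"
proof (induction n rule: dec_induct)
  case (step m)
  then have "{k<..Suc m} = insert (Suc m) {k<..m}" by auto
  then have e: "(\<Sum>l\<in>{k<..Suc m}. (1 / 2 :: real) ^ l * real (l + 1 - k)) =
      (1 / 2) ^ Suc m * real (Suc m + 1 - k) + (\<Sum>l\<in>{k<..m}. (1 / 2) ^ l * real (l + 1 - k))" by simp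
  have d: "real (Suc m + 1 - k) = real (m - k) + 2" "real (Suc m - k) = real (m - k) + 1"
    using step by auto
  have "1 / 2 * x * (d + 2) + S \<le> h - 1 / 2 * x * (d + 1 + 3)" if "S \<le> h - x * (d + 3)" for x d S h :: real
    using that by (simp add: field_simps)
  from this[OF step(3)] show ?case
    unfolding e d power_Suc .
qed simp

text \<open>Over the \<open>k\<close>-th subinterval every digit \<open>l > k\<close> pulls
  downwards, and by at most \<open>(1 / 2) ^ l * (l + 1 - k) / n\<close>. The first \<open>k\<close>
  digits thus fix the line up to a small error.\<close>

lemma lines_cluster:
  assumes A: "A \<subseteq> {1..n}" and k: "k \<in> {1..n}" and u: "u \<in> {(real k - 1) / n..real k / n}"
  shows "(slope A * u + intercept n A) - (slope (A \<inter> {..k}) * u + intercept n (A \<inter> {..k})) \<in> {- (3 * (1 / 2) ^ k / n)..0}"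
proof -
  let ?f = "\<lambda>l. (1 / 2) ^ l * (u - real l / real n)"
  have n: "0 < real n" using k by auto
  have fin: "finite A" using A by (auto intro: finite_subset)
  have "sum ?f A = sum ?f (A \<inter> {..k}) + sum ?f (A \<inter> {k<..n})"
    using fin A by (subst sum.union_disjoint[symmetric]) (auto intro!: sum.cong)
  then have e: "(slope A * u + intercept n A) - (slope (A \<inter> {..k}) * u + intercept n (A \<inter> {..k})) = sum ?f (A \<inter> {k<..n})"
    by (simp add: line_eq)
  have le0: "?f l \<le> 0" if "l \<in> {k<..n}" for l
  proof -
    have "real k / n \<le> real l / n" using that by (intro divide_right_mono) auto
    then show ?thesis using u by (intro mult_nonneg_nonpos) auto
  qed
  have "sum ?f (A \<inter> {k<..n}) \<le> 0" by (intro sum_nonpos le0) auto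
  moreover have "- (3 * (1 / 2) ^ k / n) \<le> sum ?f (A \<inter> {k<..n})"
  proof -
    have "- sum ?f (A \<inter> {k<..n}) = (\<Sum>l\<in>A \<inter> {k<..n}. - ?f l)" by (simp add: sum_negf)
    also have "\<dots> \<le> (\<Sum>l\<in>{k<..n}. - ?f l)" using le0 by (intro sum_mono2) auto
    also have "\<dots> \<le> (\<Sum>l\<in>{k<..n}. (1 / 2) ^ l * real (l + 1 - k) / n)"
    proof (rule sum_mono)
      fix l assume l: "l \<in> {k<..n}"
      have "(real k - 1) / n \<le> u" using u by simp
      then have "real l / n - u \<le> real l / n - (real k - 1) / n" by simp
      also have "\<dots> = real (l + 1 - k) / n" using l by (simp add: of_nat_diff diff_divide_distrib add_divide_distrib)
      finally have "(1 / 2) ^ l * (real l / n - u) \<le> (1 / 2) ^ l * (real (l + 1 - k) / n)" by (intro mult_left_mono) auto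
      then show "- ?f l \<le> (1 / 2) ^ l * real (l + 1 - k) / n" by (simp add: algebra_simps)
    qed
    also have "\<dots> = (\<Sum>l\<in>{k<..n}. (1 / 2) ^ l * real (l + 1 - k)) / n" by (simp add: sum_divide_distrib)
    also have "\<dots> \<le> 3 * (1 / 2) ^ k / n"
    proof (rule divide_right_mono)
      have "0 \<le> (1 / 2 :: real) ^ n * (real (n - k) + 3)" by simp
      then show "(\<Sum>l\<in>{k<..n}. (1 / 2) ^ l * real (l + 1 - k)) \<le> 3 * (1 / 2) ^ k"
        using sum_Suc_half_powers[of k n] k unfolding atLeastAtMost_iff by linarith
    qed simp
    finally show ?thesis by simp
  qed
  ultimately show ?thesis by (simp add: e)
qed

lemma cross2_shear: "cross2 p (c *\<^sub>R (q - s *\<^sub>R p)) = c * cross2 p q"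
  by (simp add: cross2_def algebra_simps)

text \<open>Over each subinterval, of length \<open>1 / n\<close>, the \<open>2 ^ k\<close> groups
  are covered by one parallelogram each. Multiplied by \<open>2 ^ k\<close> and summed over
  \<open>k\<close>, the spreads of the groups give 3 and the tube thicknesses at most 2, hence the
  constant 5.\<close>

lemma kakeya_set:
  assumes n: "1 \<le> n" and pq: "cross2 p q \<noteq> 0"
  obtains E where "E \<in> sets borel" "emeasure lborel E \<le> ennreal (5 / (n * \<bar>cross2 p q\<bar>))"
    "\<And>A x. A \<subseteq> {1..n} \<Longrightarrow> p \<bullet> x \<in> {0..1} \<Longrightarrow>
      q \<bullet> x - (slope A * (p \<bullet> x) + intercept n A) \<in> {0..(1 / 2) ^ n} \<Longrightarrow> x \<in> E"
proof -
  let ?\<Delta> = "\<bar>cross2 p q\<bar>"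
  define R where "R k B = {x. p \<bullet> x \<in> {(real k - 1) / n..real k / n} \<and>
      (1 *\<^sub>R (q - slope B *\<^sub>R p)) \<bullet> x \<in> {intercept n B - 3 * (1 / 2) ^ k / n..intercept n B + (1 / 2) ^ n}}" for k B
  define E where "E = (\<Union>k\<in>{1..n}. \<Union>B\<in>Pow {1..k}. R k B)"
  have R: "emeasure lborel (R k B) = ennreal (1 / n * (3 * (1 / 2) ^ k / n + (1 / 2) ^ n) / ?\<Delta>)" for k B
    unfolding R_def using pq n
    by (subst emeasure_cross2) (auto simp: cross2_shear[of _ 1, simplified] divide_right_mono diff_divide_distrib[symmetric] intro: order_trans[of _ 0])
  have Rm[measurable]: "R k B \<in> sets borel" for k B
  proof -
    have "closed (R k B)" unfolding R_def by (auto intro!: closed_Collect_conj closed_Collect_le continuous_intros)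
    then show ?thesis by simp
  qed
  have Um: "(\<Union>B\<in>Pow {1..k}. R k B) \<in> sets borel" for k
    by (intro sets.finite_UN Rm) auto
  show ?thesis
  proof
    show "E \<in> sets borel" unfolding E_def by (intro sets.finite_UN Um) auto
    have "emeasure lborel E \<le> (\<Sum>k\<in>{1..n}. emeasure lborel (\<Union>B\<in>Pow {1..k}. R k B))"
      unfolding E_def using Um by (intro emeasure_subadditive_finite) (simp_all only: image_subset_iff sets_lborel finite_atLeastAtMost, simp)
    also have "\<dots> \<le> (\<Sum>k\<in>{1..n}. \<Sum>B\<in>Pow {1..k}. emeasure lborel (R k B))"
      using Rm by (intro sum_mono emeasure_subadditive_finite) auto
    also have "\<dots> = (\<Sum>k\<in>{1..n}. ennreal (2 ^ k * (1 / n * (3 * (1 / 2) ^ k / n + (1 / 2) ^ n) / ?\<Delta>)))"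
      unfolding R by (intro sum.cong refl, subst sum_ennreal) (simp_all add: card_Pow)
    also have "\<dots> = ennreal (\<Sum>k\<in>{1..n}. 2 ^ k * (1 / n * (3 * (1 / 2) ^ k / n + (1 / 2) ^ n) / ?\<Delta>))"
      by (rule sum_ennreal) auto
    also have "\<dots> \<le> ennreal (5 / (n * ?\<Delta>))"
    proof (rule ennreal_leI)
      have "(\<Sum>k\<in>{1..n}. 2 ^ k * (1 / n * (3 * (1 / 2) ^ k / n + (1 / 2) ^ n) / ?\<Delta>)) =
         (\<Sum>k\<in>{1..n}. (3 / n + 2 ^ k * (1 / 2) ^ n) / (n * ?\<Delta>))"
      proof (intro sum.cong refl)
        fix k
        have g: "c * (1 / m * (3 * y / m + h) / d) = (3 * (c * y) / m + c * h) / (m * d)" for c m y h d :: real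
          by (simp add: distrib_left add_divide_distrib mult_ac)
        have "2 ^ k * (1 / 2) ^ k = (1 :: real)" by (simp add: power_one_over)
        then show "2 ^ k * (1 / n * (3 * (1 / 2) ^ k / n + (1 / 2) ^ n) / ?\<Delta>) = (3 / n + 2 ^ k * (1 / 2) ^ n) / (n * ?\<Delta>)"
          unfolding g by simp
      qed
      also have "\<dots> = (3 + (\<Sum>k\<in>{1..n}. 2 ^ k) * (1 / 2) ^ n) / (n * ?\<Delta>)"
        using n by (simp add: sum_divide_distrib[symmetric] sum.distrib sum_distrib_right)
      also have "\<dots> \<le> 5 / (n * ?\<Delta>)"
      proof (rule divide_right_mono)
        have "(\<Sum>k\<in>{1..m}. 2 ^ k) \<le> (2 :: real) * 2 ^ m" for m by (induction m) auto
        from mult_right_mono[OF this[of n], of "(1 / 2) ^ n"]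
        show "3 + (\<Sum>k\<in>{1..n}. 2 ^ k) * (1 / 2) ^ n \<le> (5 :: real)" by (simp add: power_one_over)
      qed simp
      finally show "(\<Sum>k\<in>{1..n}. 2 ^ k * (1 / n * (3 * (1 / 2) ^ k / n + (1 / 2) ^ n) / ?\<Delta>)) \<le> 5 / (n * ?\<Delta>)" .
    qed
    finally show "emeasure lborel E \<le> ennreal (5 / (n * ?\<Delta>))" .
  next
    fix A x assume A: "A \<subseteq> {1..n}" and u: "p \<bullet> x \<in> {0..1}"
      and v: "q \<bullet> x - (slope A * (p \<bullet> x) + intercept n A) \<in> {0..(1 / 2) ^ n}"
    \<comment> \<open>Subintervals are numbered from 1, but the ceiling is 0 at
      \<open>p \<bullet> x = 0\<close>.\<close>
    define k where "k = max 1 (nat \<lceil>n * (p \<bullet> x)\<rceil>)"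
    have n0: "real n > 0" using n by simp
    have "n * (p \<bullet> x) \<le> n" using u n0 by (simp add: mult_left_le)
    then have "\<lceil>n * (p \<bullet> x)\<rceil> \<le> int n" by (simp add: ceiling_le_iff)
    then have "nat \<lceil>n * (p \<bullet> x)\<rceil> \<le> n" by linarith
    then have k: "k \<in> {1..n}" unfolding k_def atLeastAtMost_iff using n by linarith
    have "real k - 1 \<le> n * (p \<bullet> x)" "n * (p \<bullet> x) \<le> real k"
      using u n0 by (auto simp: k_def max_def) (linarith+)?
    then have uk: "p \<bullet> x \<in> {(real k - 1) / n..real k / n}"
      using n0 by (auto simp: field_simps)
    from lines_cluster[OF A k uk] v
    have "q \<bullet> x - (slope (A \<inter> {..k}) * (p \<bullet> x) + intercept n (A \<inter> {..k})) \<in> {- (3 * (1 / 2) ^ k / n)..(1 / 2) ^ n}"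
      by auto
    then have "x \<in> R k (A \<inter> {..k})"
      using uk by (auto simp: R_def inner_diff_left)
    moreover have "A \<inter> {..k} \<in> Pow {1..k}" using A by auto
    ultimately show "x \<in> E" unfolding E_def using k by blast
  qed
qed

subsection \<open>A scalar implicit function theorem\<close>

text \<open>The unknown is a real number, so \<open>B > 0\<close> makes \<open>F x\<close>
  increasing on the box: solutions exist by the intermediate value theorem and are unique by
  monotonicity. Uniqueness in the whole box is what later identifies level sets.\<close>

lemma scalar_implicit_function:
  fixes F :: "'a::euclidean_space \<Rightarrow> real \<Rightarrow> real" and A :: "'a \<Rightarrow> real \<Rightarrow> 'a" and B :: "'a \<Rightarrow> real \<Rightarrow> real"
  assumes U: "open U" "(x0, s0) \<in> U"
    and F: "\<And>x s. (x, s) \<in> U \<Longrightarrow> ((\<lambda>(x, s). F x s) has_derivative (\<lambda>(h, k). A x s \<bullet> h + B x s * k)) (at (x, s))"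
    and B: "continuous_on U (\<lambda>(x, s). B x s)" and F0: "F x0 s0 = 0" and B0: "0 < B x0 s0"
  obtains \<epsilon> \<delta> \<sigma> where "0 < \<epsilon>" "0 < \<delta>" "\<sigma> x0 = s0"
    "\<And>x s. x \<in> cball x0 \<epsilon> \<Longrightarrow> s \<in> {s0 - \<delta>..s0 + \<delta>} \<Longrightarrow> (x, s) \<in> U \<and> 0 < B x s"
    "\<And>x. x \<in> cball x0 \<epsilon> \<Longrightarrow> \<sigma> x \<in> {s0 - \<delta><..<s0 + \<delta>} \<and> F x (\<sigma> x) = 0"
    "\<And>x s. x \<in> cball x0 \<epsilon> \<Longrightarrow> s \<in> {s0 - \<delta>..s0 + \<delta>} \<Longrightarrow> F x s = 0 \<Longrightarrow> s = \<sigma> x"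
    "\<And>x. x \<in> ball x0 \<epsilon> \<Longrightarrow> (\<sigma> has_derivative (\<lambda>h. - (A x (\<sigma> x) \<bullet> h) / B x (\<sigma> x))) (at x)"
proof -
  have "open (U \<inter> (\<lambda>(x, s). B x s) -` {0<..})"
    by (rule continuous_open_preimage[OF B U(1)]) simp
  moreover have "(x0, s0) \<in> U \<inter> (\<lambda>(x, s). B x s) -` {0<..}" using U B0 by simp
  ultimately obtain V W where VW: "open V" "open W" "(x0, s0) \<in> V \<times> W" "V \<times> W \<subseteq> U \<inter> (\<lambda>(x, s). B x s) -` {0<..}"
    by (rule open_prod_elim)
  obtain r where r: "0 < r" "cball x0 r \<subseteq> V" using VW open_contains_cball by (metis mem_Sigma_iff)
  obtain \<delta> where \<delta>: "0 < \<delta>" "cball s0 \<delta> \<subseteq> W" using VW open_contains_cball by (metis mem_Sigma_iff)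
  have UB: "(x, s) \<in> U \<and> 0 < B x s" if "x \<in> cball x0 r" "s \<in> {s0 - \<delta>..s0 + \<delta>}" for x s
  proof -
    have "s \<in> cball s0 \<delta>" using that by (auto simp: dist_real_def)
    then have "(x, s) \<in> V \<times> W" using that r \<delta> by auto
    then show ?thesis using VW by auto
  qed
  have DF: "((\<lambda>s. F x s) has_real_derivative B x s) (at s)" if "(x, s) \<in> U" for x s
  proof -
    have "((\<lambda>s. (x, s)) has_derivative (\<lambda>k. (0, k))) (at s)" by (auto intro!: derivative_eq_intros)
    from has_derivative_compose[OF this F[OF that]]
    show ?thesis by (simp add: has_field_derivative_def mult_commute_abs)
  qed
  have mono: "F x s < F x s'" if "x \<in> cball x0 r" "s \<in> {s0 - \<delta>..s0 + \<delta>}" "s' \<in> {s0 - \<delta>..s0 + \<delta>}" "s < s'" for x s s'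
    by (rule DERIV_pos_imp_increasing[OF that(4)]) (use that DF UB in \<open>meson atLeastAtMost_iff order_trans\<close>)
  have cF: "isCont (\<lambda>x. F x s) x" if "(x, s) \<in> U" for x s
  proof -
    have "((\<lambda>x. (x, s)) has_derivative (\<lambda>h. (h, 0))) (at x)" by (auto intro!: derivative_eq_intros)
    from has_derivative_continuous[OF has_derivative_compose[OF this F[OF that]]]
    show ?thesis by simp
  qed
  have e: "x0 \<in> cball x0 r" "s0 - \<delta> \<in> {s0 - \<delta>..s0 + \<delta>}" "s0 + \<delta> \<in> {s0 - \<delta>..s0 + \<delta>}" "s0 \<in> {s0 - \<delta>..s0 + \<delta>}"
    using r \<delta> by auto
  have "F x0 (s0 - \<delta>) < 0" "0 < F x0 (s0 + \<delta>)"
    using mono[OF e(1,2,4)] mono[OF e(1,4,3)] \<delta> F0 by auto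
  moreover have "((\<lambda>x. F x (s0 - \<delta>)) \<longlongrightarrow> F x0 (s0 - \<delta>)) (at x0)" "((\<lambda>x. F x (s0 + \<delta>)) \<longlongrightarrow> F x0 (s0 + \<delta>)) (at x0)"
    using cF UB e by (auto simp: isCont_def)
  ultimately have "\<forall>\<^sub>F x in at x0. F x (s0 - \<delta>) < 0 \<and> 0 < F x (s0 + \<delta>)"
    by (intro eventually_conj) (auto dest: order_tendstoD)
  then obtain d where d: "0 < d" "\<And>x. x \<noteq> x0 \<Longrightarrow> dist x x0 < d \<Longrightarrow> F x (s0 - \<delta>) < 0 \<and> 0 < F x (s0 + \<delta>)"
    unfolding eventually_at by auto
  define \<epsilon> where "\<epsilon> = min r (d / 2)"
  have \<epsilon>: "0 < \<epsilon>" "\<epsilon> \<le> r" "\<epsilon> < d" using r d by (auto simp: \<epsilon>_def)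
  have ends: "F x (s0 - \<delta>) < 0 \<and> 0 < F x (s0 + \<delta>)" if "x \<in> cball x0 \<epsilon>" for x
    using d(2)[of x] that \<epsilon> \<open>F x0 (s0 - \<delta>) < 0\<close> \<open>0 < F x0 (s0 + \<delta>)\<close> by (cases "x = x0") (auto simp: dist_commute)
  have \<epsilon>r: "x \<in> cball x0 r" if "x \<in> cball x0 \<epsilon>" for x using that \<epsilon> by auto
  have "\<exists>s. s \<in> {s0 - \<delta><..<s0 + \<delta>} \<and> F x s = 0" if x: "x \<in> cball x0 \<epsilon>" for x
  proof -
    have "\<exists>s\<ge>s0 - \<delta>. s \<le> s0 + \<delta> \<and> F x s = 0"
    proof (rule IVT)
      show "\<forall>s. s0 - \<delta> \<le> s \<and> s \<le> s0 + \<delta> \<longrightarrow> isCont (F x) s"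
      proof (intro allI impI)
        fix s assume "s0 - \<delta> \<le> s \<and> s \<le> s0 + \<delta>"
        then have "(x, s) \<in> U" using UB[OF \<epsilon>r[OF x]] by auto
        from DF[OF this] show "isCont (F x) s" by (rule DERIV_isCont)
      qed
    qed (use ends[OF x] \<delta> in auto)
    then obtain s where "s0 - \<delta> \<le> s" "s \<le> s0 + \<delta>" "F x s = 0" by blast
    with ends[OF x] show ?thesis by (intro exI[of _ s]) (auto simp: less_le)
  qed
  then obtain \<sigma> where \<sigma>: "\<And>x. x \<in> cball x0 \<epsilon> \<Longrightarrow> \<sigma> x \<in> {s0 - \<delta><..<s0 + \<delta>} \<and> F x (\<sigma> x) = 0" by metis
  have uniq: "s = \<sigma> x" if "x \<in> cball x0 \<epsilon>" "s \<in> {s0 - \<delta>..s0 + \<delta>}" "F x s = 0" for x s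
  proof (rule ccontr)
    assume "s \<noteq> \<sigma> x"
    have "\<sigma> x \<in> {s0 - \<delta>..s0 + \<delta>}" using \<sigma>[OF that(1)] by auto
    with mono[OF \<epsilon>r[OF that(1)] that(2) this] mono[OF \<epsilon>r[OF that(1)] this that(2)] \<sigma>[OF that(1)] that(3) \<open>s \<noteq> \<sigma> x\<close>
    show False by (cases s "\<sigma> x" rule: linorder_cases) auto
  qed
  have der: "(\<sigma> has_derivative (\<lambda>h. - (A x (\<sigma> x) \<bullet> h) / B x (\<sigma> x))) (at x)" if x: "x \<in> ball x0 \<epsilon>" for x
  proof -
    define s a b where "s = \<sigma> x" and "a = A x s" and "b = B x s"
    have xc: "x \<in> cball x0 \<epsilon>" using x by auto
    have s: "s \<in> {s0 - \<delta><..<s0 + \<delta>}" "F x s = 0" using \<sigma>[OF xc] by (auto simp: s_def)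
    then have "(x, s) \<in> U" "0 < b" using UB[OF \<epsilon>r[OF xc], of s] by (auto simp: b_def)
    have bl: "bounded_linear (\<lambda>h. - (a \<bullet> h) / b)"
      by (intro bounded_linear_intros bounded_linear_divide bounded_linear_compose[OF bounded_linear_divide] bounded_linear_minus bounded_linear_inner_right)
    \<comment> \<open>\<open>\<sigma> y\<close> is trapped by testing \<open>F y\<close> at the
      linear prediction shifted up and down by \<open>\<theta> * norm h\<close>: the shift changes
      the linear part by \<open>b * \<theta> * norm h\<close>, which beats the error and fixes the
      sign.\<close>
    have "\<exists>d>0. \<forall>y. norm (y - x) < d \<longrightarrow> norm (\<sigma> y - \<sigma> x - (- (a \<bullet> (y - x)) / b)) \<le> \<theta> * norm (y - x)" if "0 < \<theta>" for \<theta>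
    proof -
      \<comment> \<open>\<open>L\<close> bounds the increment \<open>(h, k)\<close> in terms of
        \<open>norm h\<close>; \<open>\<eta>\<close> then keeps the linearisation error within half
        of \<open>b * \<theta> * norm h\<close>.\<close>
      define L where "L = 1 + norm a / b + \<theta>"
      have L: "0 < L" using \<open>0 < b\<close> \<open>0 < \<theta>\<close> by (simp add: L_def add_pos_nonneg add_nonneg_pos)
      define \<eta> where "\<eta> = b * \<theta> / (2 * L)"
      have "0 < \<eta>" using L \<open>0 < b\<close> \<open>0 < \<theta>\<close> by (simp add: \<eta>_def)
      from F[OF \<open>(x, s) \<in> U\<close>] this obtain d1 where d1: "0 < d1"
        "\<And>y s'. norm ((y, s') - (x, s)) < d1 \<Longrightarrow> \<bar>F y s' - F x s - (a \<bullet> (y - x) + b * (s' - s))\<bar> \<le> \<eta> * norm ((y, s') - (x, s))"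
        unfolding has_derivative_at_alt by (fastforce simp: a_def b_def)
      have dx: "0 < \<epsilon> - dist x0 x" using x by simp
      define q where "q = min (s - (s0 - \<delta>)) (s0 + \<delta> - s)"
      have "0 < q" using s by (simp add: q_def)
      define d where "d = min (\<epsilon> - dist x0 x) (min (d1 / L) (q / L))"
      have "0 < d" using dx d1 L \<open>0 < q\<close> by (simp add: d_def)
      moreover have "norm (\<sigma> y - \<sigma> x - (- (a \<bullet> (y - x)) / b)) \<le> \<theta> * norm (y - x)" if y: "norm (y - x) < d" for y
      proof (cases "y = x")
        case False
        define h where "h = y - x"
        have h: "0 < norm h" "norm h < \<epsilon> - dist x0 x" "norm h * L < d1" "norm h * L < q"
          using y False L by (auto simp: h_def d_def field_simps)
        have yc: "y \<in> cball x0 \<epsilon>"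
          using h(2) dist_triangle[of x0 y x] by (simp add: h_def dist_norm norm_minus_commute)
        have sgn: "(0 < \<tau> \<longrightarrow> 0 < F y (s + k)) \<and> (\<tau> < 0 \<longrightarrow> F y (s + k) < 0) \<and> s + k \<in> {s0 - \<delta>..s0 + \<delta>}"
          if k: "k = - (a \<bullet> h) / b + \<tau> * norm h" and \<tau>: "\<bar>\<tau>\<bar> = \<theta>" for k \<tau>
        proof -
          have "\<bar>a \<bullet> h / b\<bar> \<le> norm a / b * norm h"
            using Cauchy_Schwarz_ineq2[of a h] \<open>0 < b\<close> by (simp add: abs_divide divide_right_mono)
          moreover have "\<bar>\<tau> * norm h\<bar> = \<theta> * norm h" using \<tau> by (simp add: abs_mult)
          ultimately have kk: "\<bar>k\<bar> \<le> (norm a / b + \<theta>) * norm h"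
            unfolding k distrib_right by linarith
          then have "norm h + \<bar>k\<bar> \<le> norm h * L" by (simp add: L_def algebra_simps)
          moreover have "norm (h, k) \<le> norm h + \<bar>k\<bar>" using norm_Pair_le[of h k] by simp
          ultimately have hk: "norm (h, k) \<le> norm h * L" by linarith
          have "\<bar>k\<bar> < q" using kk h \<open>norm h + \<bar>k\<bar> \<le> norm h * L\<close> by linarith
          then have sk: "s + k \<in> {s0 - \<delta>..s0 + \<delta>}" by (auto simp: q_def)
          have "\<bar>F (x + h) (s + k) - (a \<bullet> h + b * k)\<bar> \<le> \<eta> * norm (h, k)"
            using d1(2)[of "x + h" "s + k"] hk h s(2) by simp
          also have "\<dots> \<le> \<eta> * (norm h * L)" using hk \<open>0 < \<eta>\<close> by simp
          also have "\<dots> = b * \<theta> * norm h / 2" using L by (simp add: \<eta>_def)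
          finally have 1: "\<bar>F y (s + k) - (a \<bullet> h + b * k)\<bar> \<le> b * \<theta> * norm h / 2" by (simp add: h_def)
          define P where "P = b * \<theta> * norm h"
          have P: "0 < P" using \<open>0 < b\<close> \<open>0 < \<theta>\<close> h by (simp add: P_def)
          have 2: "a \<bullet> h + b * k = b * \<tau> * norm h" using \<open>0 < b\<close> by (simp add: k distrib_left right_diff_distrib)
          have "\<tau> = \<theta> \<or> \<tau> = - \<theta>" using \<tau> by (auto simp: abs_if split: if_splits)
          then have "0 < \<tau> \<and> a \<bullet> h + b * k = P \<or> \<tau> < 0 \<and> a \<bullet> h + b * k = - P"
            using 2 \<open>0 < \<theta>\<close> by (auto simp: P_def)
          with 1 P sk show ?thesis unfolding P_def[symmetric] by (elim disjE) linarith+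
        qed
        define k1 k2 where "k1 = - (a \<bullet> h) / b + \<theta> * norm h" and "k2 = - (a \<bullet> h) / b + (- \<theta>) * norm h"
        have 1: "0 < F y (s + k1)" "s + k1 \<in> {s0 - \<delta>..s0 + \<delta>}" using sgn[OF k1_def] \<open>0 < \<theta>\<close> by auto
        have 2: "F y (s + k2) < 0" "s + k2 \<in> {s0 - \<delta>..s0 + \<delta>}" using sgn[OF k2_def] \<open>0 < \<theta>\<close> by auto
        have \<sigma>y: "\<sigma> y \<in> {s0 - \<delta>..s0 + \<delta>}" "F y (\<sigma> y) = 0" using \<sigma>[OF yc] by auto
        have "\<sigma> y < s + k1"
          using mono[OF \<epsilon>r[OF yc] 1(2) \<sigma>y(1)] 1 \<sigma>y by (cases "\<sigma> y" "s + k1" rule: linorder_cases) auto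
        moreover have "s + k2 < \<sigma> y"
          using mono[OF \<epsilon>r[OF yc] \<sigma>y(1) 2(2)] 2 \<sigma>y by (cases "\<sigma> y" "s + k2" rule: linorder_cases) auto
        ultimately show ?thesis
          by (simp add: k1_def k2_def s_def h_def abs_le_iff)
      qed simp
      ultimately show ?thesis by blast
    qed
    then show ?thesis
      unfolding has_derivative_at_alt using bl by (simp add: a_def b_def s_def)
  qed
  show thesis
  proof (rule that[of \<epsilon> \<delta> \<sigma>])
    show "\<sigma> x0 = s0" using uniq[of x0 s0] e F0 \<epsilon> by auto
  qed (use \<epsilon> \<delta> UB \<epsilon>r \<sigma> uniq der in blast)+
qed

subsection \<open>A slice with turning normals\<close>

definition rot :: "real^2 \<Rightarrow> real^2" where
  "rot v = vector [- (v $ 2), v $ 1]"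

lemma rot_inner: "rot v \<bullet> w = cross2 v w" "w \<bullet> rot v = cross2 v w"
  by (simp_all add: rot_def cross2_def inner_vec_def sum_2)

lemma norm_rot: "rot v \<bullet> rot v = v \<bullet> v"
  by (simp add: rot_def inner_vec_def sum_2)

lemma cross2_self [simp]: "cross2 v v = 0"
  by (simp add: cross2_def)

lemma cross2_eq_0_of_orthogonal:
  assumes "v \<noteq> 0" "v \<bullet> x = 0" "v \<bullet> y = 0" shows "cross2 x y = 0"
proof -
  have "(v \<bullet> v) * cross2 x y = (v \<bullet> x) * (rot v \<bullet> y) - (v \<bullet> y) * (rot v \<bullet> x)"
    by (simp add: rot_def cross2_def inner_vec_def sum_2 algebra_simps)
  with assms show ?thesis by simp
qed

lemma vec2_decompose: "(e \<bullet> e) *\<^sub>R v = (v \<bullet> e) *\<^sub>R e + cross2 e v *\<^sub>R rot e"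
  by (simp add: vec_eq_iff forall_2 rot_def cross2_def inner_vec_def sum_2 algebra_simps)

lemma second_derivative_test_max:
  fixes \<phi> \<phi>' :: "real \<Rightarrow> real"
  assumes I: "t0 \<in> {a<..<b}" and d1: "\<And>t. t \<in> {a<..<b} \<Longrightarrow> (\<phi> has_real_derivative \<phi>' t) (at t)"
    and d2: "(\<phi>' has_real_derivative D) (at t0)" and "D < 0" "\<phi>' t0 = 0"
  shows "\<exists>\<epsilon>>0. \<forall>t. 0 < \<bar>t - t0\<bar> \<and> \<bar>t - t0\<bar> < \<epsilon> \<longrightarrow> \<phi> t < \<phi> t0"
proof -
  obtain e1 where e1: "0 < e1" "\<And>h. 0 < h \<Longrightarrow> h < e1 \<Longrightarrow> \<phi>' (t0 + h) < \<phi>' t0"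
    using DERIV_neg_dec_right[OF d2 \<open>D < 0\<close>] by blast
  obtain e2 where e2: "0 < e2" "\<And>h. 0 < h \<Longrightarrow> h < e2 \<Longrightarrow> \<phi>' t0 < \<phi>' (t0 - h)"
    using DERIV_neg_dec_left[OF d2 \<open>D < 0\<close>] by blast
  define e where "e = min (min e1 e2) (min (t0 - a) (b - t0))"
  have e: "0 < e" "e \<le> e1" "e \<le> e2" "e \<le> t0 - a" "e \<le> b - t0" using e1 e2 I by (auto simp: e_def)
  have "\<phi> t < \<phi> t0" if t: "0 < \<bar>t - t0\<bar>" "\<bar>t - t0\<bar> < e" for t
  proof (cases "t < t0")
    case True
    obtain z where "t < z" "z < t0" "\<phi> t0 - \<phi> t = (t0 - t) * \<phi>' z"
      using MVT2[OF True, of \<phi> \<phi>'] d1 t e by auto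
    moreover from this have "0 < \<phi>' z" using e2(2)[of "t0 - z"] t e \<open>\<phi>' t0 = 0\<close> by simp
    ultimately show ?thesis using True by (smt (verit) mult_pos_pos)
  next
    case False
    then have "t0 < t" using t by auto
    obtain z where "t0 < z" "z < t" "\<phi> t - \<phi> t0 = (t - t0) * \<phi>' z"
      using MVT2[OF \<open>t0 < t\<close>, of \<phi> \<phi>'] d1 t e by auto
    moreover from this have "\<phi>' z < 0" using e1(2)[of "z - t0"] t e \<open>\<phi>' t0 = 0\<close> by simp
    ultimately show ?thesis using \<open>t0 < t\<close> by (smt (verit) mult_pos_neg)
  qed
  with e(1) show ?thesis by blast
qed

text \<open>\<open>r\<close> is a defining function of the hypersurface, with gradient \<open>(n, m)\<close>; its slices are the sets
  \<open>{z. r z \<eta> = 0}\<close>.\<close>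

locale hypersurface =
  fixes Om :: "((real^2) \<times> (real^2)) set" and r :: "real^2 \<Rightarrow> real^2 \<Rightarrow> real" and n m :: "real^2 \<Rightarrow> real^2 \<Rightarrow> real^2"
  assumes open_O: "open Om"
    and deriv: "\<And>z e. (z, e) \<in> Om \<Longrightarrow> ((\<lambda>(z, e). r z e) has_derivative (\<lambda>(h, k). n z e \<bullet> h + m z e \<bullet> k)) (at (z, e))"
    and cont_n: "continuous_on Om (\<lambda>(z, e). n z e)" and cont_m: "continuous_on Om (\<lambda>(z, e). m z e)"
    and regular: "\<And>z e. (z, e) \<in> Om \<Longrightarrow> r z e = 0 \<Longrightarrow> n z e \<noteq> 0 \<or> m z e \<noteq> 0"
begin

text \<open>The sign condition keeps the normals in one open half-plane, where a direction is
  described by its slope relative to the initial normal; by continuity every slope between those at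
  the two ends then occurs.\<close>

definition turning :: "real^2 \<Rightarrow> bool" where
  "turning \<eta> \<longleftrightarrow> (\<exists>y. continuous_on {0..1::real} y \<and>
     (\<forall>t\<in>{0..1}. (y t, \<eta>) \<in> Om \<and> r (y t) \<eta> = 0 \<and> 0 < n (y 0) \<eta> \<bullet> n (y t) \<eta>) \<and>
     cross2 (n (y 0) \<eta>) (n (y 1) \<eta>) \<noteq> 0)"

lemma turningI:
  fixes t0 t1 \<epsilon> :: real
  assumes e: "0 < \<epsilon>" and y: "continuous_on {t0 - \<epsilon><..<t0 + \<epsilon>} y"
    and on: "\<And>t. \<bar>t - t0\<bar> < \<epsilon> \<Longrightarrow> (y t, \<eta>) \<in> Om \<and> r (y t) \<eta> = 0"
    and pos: "\<And>t. \<bar>t - t0\<bar> < \<epsilon> \<Longrightarrow> 0 < n (y t0) \<eta> \<bullet> n (y t) \<eta>"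
    and t1: "\<bar>t1 - t0\<bar> < \<epsilon>" "cross2 (n (y t0) \<eta>) (n (y t1) \<eta>) \<noteq> 0"
  shows "turning \<eta>"
proof -
  define c where "c s = t0 + s * (t1 - t0)" for s
  have c: "\<bar>c s - t0\<bar> < \<epsilon>" if "s \<in> {0..1}" for s
  proof -
    have "\<bar>c s - t0\<bar> \<le> 1 * \<bar>t1 - t0\<bar>"
      using that by (simp add: c_def abs_mult mult_left_le_one_le)
    with t1 show ?thesis by simp
  qed
  have c': "c s \<in> {t0 - \<epsilon><..<t0 + \<epsilon>}" if "s \<in> {0..1}" for s
    using c[OF that] by (simp add: abs_less_iff)
  have c01: "c 0 = t0" "c 1 = t1" by (simp_all add: c_def)
  show ?thesis
    unfolding turning_def
  proof (intro exI[of _ "\<lambda>s. y (c s)"] conjI ballI)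
    show "continuous_on {0..1} (\<lambda>s. y (c s))"
      by (rule continuous_on_compose2[OF y]) (use c' in \<open>auto simp: c_def intro!: continuous_intros\<close>)
  qed (use c on pos t1 c01 in auto)
qed

lemma deriv_along:
  assumes "(z, e) \<in> Om" "(x has_derivative x') (at t)" "(y has_derivative y') (at t)" "x t = z" "y t = e"
  shows "((\<lambda>t. r (x t) (y t)) has_derivative (\<lambda>h. n z e \<bullet> x' h + m z e \<bullet> y' h)) (at t)"
proof -
  have "((\<lambda>t. (x t, y t)) has_derivative (\<lambda>h. (x' h, y' h))) (at t)"
    using assms by (auto intro!: derivative_eq_intros)
  from has_derivative_compose[OF this, of "\<lambda>(z, e). r z e" "\<lambda>(h, k). n z e \<bullet> h + m z e \<bullet> k"] deriv[OF assms(1)] assms(4,5)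
  show ?thesis by simp
qed

text \<open>If the normals kept their direction, the velocity would be orthogonal to a fixed vector
  near \<open>t0\<close>, hence the acceleration too, and the two would be parallel.\<close>

lemma turning_of_regular_point:
  fixes x x1 :: "real \<Rightarrow> real^2"
  assumes t0: "t0 \<in> {a<..<b}"
    and on: "\<And>t. t \<in> {a<..<b} \<Longrightarrow> (x t, \<xi>) \<in> Om \<and> r (x t) \<xi> = 0"
    and x1: "\<And>t. t \<in> {a<..<b} \<Longrightarrow> (x has_vector_derivative x1 t) (at t)"
    and x2: "(x1 has_vector_derivative x2) (at t0)" and curved: "cross2 (x1 t0) x2 \<noteq> 0"
    and n0: "n (x t0) \<xi> \<noteq> 0"
  shows "turning \<xi>"
proof -
  let ?N = "\<lambda>t. n (x t) \<xi>"
  have cx: "continuous_on {a<..<b} x"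
    using x1 by (meson continuous_at_imp_continuous_on has_vector_derivative_continuous)
  have cN: "continuous_on {a<..<b} ?N"
    using continuous_on_compose2[OF cont_n continuous_on_Pair[OF cx continuous_on_const[of _ \<xi>]]] on by (simp add: image_subset_iff)
  then have "isCont (\<lambda>t. ?N t0 \<bullet> ?N t) t0"
    using t0 by (intro continuous_intros) (simp add: continuous_on_eq_continuous_at)
  moreover have "0 < ?N t0 \<bullet> ?N t0" using n0 by simp
  ultimately have "\<forall>\<^sub>F t in at t0. 0 < ?N t0 \<bullet> ?N t" unfolding isCont_def by (rule order_tendstoD(1))
  then obtain d where d: "0 < d" "\<And>t. t \<noteq> t0 \<Longrightarrow> \<bar>t - t0\<bar> < d \<Longrightarrow> 0 < ?N t0 \<bullet> ?N t"
    unfolding eventually_at by (auto simp: dist_real_def)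
  define \<epsilon> where "\<epsilon> = min d (min (t0 - a) (b - t0))"
  have \<epsilon>: "0 < \<epsilon>" using d t0 by (auto simp: \<epsilon>_def)
  have I: "t \<in> {a<..<b}" if "\<bar>t - t0\<bar> < \<epsilon>" for t using that by (auto simp: \<epsilon>_def abs_less_iff)
  have pos: "0 < ?N t0 \<bullet> ?N t" if "\<bar>t - t0\<bar> < \<epsilon>" for t
    using that d(2)[of t] n0 by (cases "t = t0") (auto simp: \<epsilon>_def)
  show ?thesis
  proof (rule ccontr)
    assume no: "\<not> turning \<xi>"
    have par: "cross2 (?N t0) (?N t) = 0" if t: "\<bar>t - t0\<bar> < \<epsilon>" for t
    proof (rule ccontr)
      assume "cross2 (?N t0) (?N t) \<noteq> 0"
      with t no show False
        using turningI[OF \<epsilon>, of t0 x \<xi> t] on I pos continuous_on_subset[OF cx] 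
        by (metis (no_types, lifting) I abs_diff_less_iff greaterThanLessThan_iff subsetI)
    qed
    have orth: "?N t0 \<bullet> x1 t = 0" if t: "\<bar>t - t0\<bar> < \<epsilon>" for t
    proof -
      have "((\<lambda>t. r (x t) \<xi>) has_derivative (\<lambda>h. ?N t \<bullet> (h *\<^sub>R x1 t) + m (x t) \<xi> \<bullet> 0)) (at t)"
        using on[OF I[OF t]] x1[OF I[OF t]] by (intro deriv_along) (auto simp: has_vector_derivative_def)
      moreover have "((\<lambda>t. r (x t) \<xi>) has_derivative (\<lambda>h. 0)) (at t)"
        by (rule has_derivative_transform_within_open[of "\<lambda>_. 0" _ _ _ "{a<..<b}"]) (use on I[OF t] in auto)
      ultimately have "(\<lambda>h. ?N t \<bullet> (h *\<^sub>R x1 t) + m (x t) \<xi> \<bullet> 0) = (\<lambda>h. 0)" by (rule has_derivative_unique)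
      from fun_cong[OF this, of 1] have "?N t \<bullet> x1 t = 0" by simp
      moreover have "(?N t0 \<bullet> ?N t0) *\<^sub>R ?N t = (?N t \<bullet> ?N t0) *\<^sub>R ?N t0"
        using vec2_decompose[of "?N t0" "?N t"] par[OF t] by simp
      ultimately have "(?N t \<bullet> ?N t0) * (?N t0 \<bullet> x1 t) = 0"
        by (metis inner_scaleR_left mult_zero_right)
      then show ?thesis using pos[OF t] by (simp add: inner_commute)
    qed
    have "((\<lambda>t. ?N t0 \<bullet> x1 t) has_vector_derivative ?N t0 \<bullet> x2) (at t0)"
      using x2 by (intro bounded_linear.has_vector_derivative[OF bounded_linear_inner_right])
    moreover have "((\<lambda>t. ?N t0 \<bullet> x1 t) has_vector_derivative 0) (at t0)"
      by (rule has_vector_derivative_transform_within_open[of "\<lambda>_. 0" _ _ "{t0 - \<epsilon><..<t0 + \<epsilon>}"])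
        (use orth \<epsilon> in \<open>auto simp: abs_less_iff\<close>)
    ultimately have "?N t0 \<bullet> x2 = 0" by (rule vector_derivative_unique_at)
    moreover have "?N t0 \<bullet> x1 t0 = 0" using orth[of t0] \<epsilon> by simp
    ultimately show False using cross2_eq_0_of_orthogonal[OF n0] curved by blast
  qed
qed

text \<open>If the hypersurface is tangent to the slice along the curve, it is a graph \<open>\<eta> = \<xi> + h(z) \<mu>\<close>
  near the given point. Outside a disc that is touched by the curve from within, \<open>h\<close> does not vanish, and at a
  minimum of \<open>h\<^sup>2 - \<kappa> dist\<^sup>2\<close> there the level set of \<open>h\<close> is regular and lies inside a disc.\<close>

lemma turning_of_tangent_point:
  fixes x x1 :: "real \<Rightarrow> real^2"
  assumes t0: "t0 \<in> {a<..<b}"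
    and on: "\<And>t. t \<in> {a<..<b} \<Longrightarrow> (x t, \<xi>) \<in> Om \<and> r (x t) \<xi> = 0"
    and x1: "\<And>t. t \<in> {a<..<b} \<Longrightarrow> (x has_vector_derivative x1 t) (at t)"
    and x2: "(x1 has_vector_derivative x2) (at t0)" and curved: "cross2 (x1 t0) x2 \<noteq> 0"
    and only: "\<And>\<epsilon>. 0 < \<epsilon> \<Longrightarrow> \<exists>\<rho>>0. \<forall>z. dist z (x t0) < \<rho> \<and> (z, \<xi>) \<in> Om \<and> r z \<xi> = 0 \<longrightarrow> (\<exists>t. \<bar>t - t0\<bar> < \<epsilon> \<and> z = x t)"
    and n0: "n (x t0) \<xi> = 0"
  shows "\<exists>\<eta>. turning \<eta>"
proof -
  define \<zeta> where "\<zeta> = x t0"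
  \<comment> \<open>As \<open>n\<close> vanishes at \<open>\<zeta>\<close>, the gradient there is
    \<open>(0, \<mu>)\<close>, and the equation can be solved for the displacement along
    \<open>\<mu>\<close>. The solution \<open>\<sigma>\<close> is the \<open>h\<close> of the
    description above.\<close>
  define \<mu> where "\<mu> = m \<zeta> \<xi>"
  have \<zeta>Om: "(\<zeta>, \<xi>) \<in> Om" "r \<zeta> \<xi> = 0" using on[OF t0] by (simp_all add: \<zeta>_def)
  have \<mu>: "\<mu> \<noteq> 0" using regular[OF \<zeta>Om] n0 by (simp add: \<mu>_def \<zeta>_def)
  define \<Phi> where "\<Phi> p = (fst p, \<xi> + snd p *\<^sub>R \<mu>)" for p :: "(real^2) \<times> real"
  have c\<Phi>: "continuous_on UNIV \<Phi>" unfolding \<Phi>_def by (intro continuous_intros)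
  define U where "U = \<Phi> -` Om"
  have U: "open U" "(\<zeta>, 0) \<in> U"
    unfolding U_def using open_vimage[OF open_O c\<Phi>] \<zeta>Om by (auto simp: \<Phi>_def)
  have F: "((\<lambda>(z, s). r z (\<xi> + s *\<^sub>R \<mu>)) has_derivative (\<lambda>(h, k). n z (\<xi> + s *\<^sub>R \<mu>) \<bullet> h + (m z (\<xi> + s *\<^sub>R \<mu>) \<bullet> \<mu>) * k)) (at (z, s))"
    if "(z, s) \<in> U" for z s
  proof -
    have "(\<Phi> has_derivative (\<lambda>p. (fst p, snd p *\<^sub>R \<mu>))) (at (z, s))"
      unfolding \<Phi>_def by (auto intro!: derivative_eq_intros)
    from has_derivative_compose[OF this, of "\<lambda>(z, e). r z e"
        "\<lambda>(h, k). n z (\<xi> + s *\<^sub>R \<mu>) \<bullet> h + m z (\<xi> + s *\<^sub>R \<mu>) \<bullet> k"] deriv[of z "\<xi> + s *\<^sub>R \<mu>"] that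
    show ?thesis by (simp add: \<Phi>_def U_def case_prod_beta' mult.commute)
  qed
  have cB: "continuous_on U (\<lambda>(z, s). m z (\<xi> + s *\<^sub>R \<mu>) \<bullet> \<mu>)"
  proof -
    have "continuous_on U (\<lambda>p. (case \<Phi> p of (z, e) \<Rightarrow> m z e) \<bullet> \<mu>)"
      by (intro continuous_intros continuous_on_compose2[OF cont_m continuous_on_subset[OF c\<Phi>]]) (auto simp: U_def)
    then show ?thesis by (simp add: \<Phi>_def case_prod_beta')
  qed
  obtain \<epsilon>1 \<delta> \<sigma> where \<epsilon>1: "0 < \<epsilon>1" "0 < \<delta>" "\<sigma> \<zeta> = 0"
    and box: "\<And>z s. z \<in> cball \<zeta> \<epsilon>1 \<Longrightarrow> s \<in> {0 - \<delta>..0 + \<delta>} \<Longrightarrow> (z, s) \<in> U \<and> 0 < m z (\<xi> + s *\<^sub>R \<mu>) \<bullet> \<mu>"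
    and \<sigma>: "\<And>z. z \<in> cball \<zeta> \<epsilon>1 \<Longrightarrow> \<sigma> z \<in> {0 - \<delta><..<0 + \<delta>} \<and> r z (\<xi> + \<sigma> z *\<^sub>R \<mu>) = 0"
    and uniq: "\<And>z s. z \<in> cball \<zeta> \<epsilon>1 \<Longrightarrow> s \<in> {0 - \<delta>..0 + \<delta>} \<Longrightarrow> r z (\<xi> + s *\<^sub>R \<mu>) = 0 \<Longrightarrow> s = \<sigma> z"
    and d\<sigma>: "\<And>z. z \<in> ball \<zeta> \<epsilon>1 \<Longrightarrow> (\<sigma> has_derivative (\<lambda>h. - (n z (\<xi> + \<sigma> z *\<^sub>R \<mu>) \<bullet> h) / (m z (\<xi> + \<sigma> z *\<^sub>R \<mu>) \<bullet> \<mu>))) (at z)"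
    using scalar_implicit_function[OF U F cB] \<zeta>Om \<mu> by (auto simp: \<mu>_def[symmetric])
  obtain \<nu> where \<nu>: "\<nu> \<bullet> x1 t0 = 0" "\<nu> \<bullet> x2 < 0"
  proof (cases "cross2 (x1 t0) x2 < 0")
    case True
    then show ?thesis by (intro that[of "rot (x1 t0)"]) (simp_all add: rot_inner)
  next
    case False
    with curved show ?thesis by (intro that[of "- rot (x1 t0)"]) (simp_all add: rot_inner)
  qed
  \<comment> \<open>\<open>\<nu>\<close> points away from the centre of curvature, and
    \<open>Q\<close> puts \<open>c\<close> beyond that centre: the squared distance to
    \<open>c\<close> has a negative second derivative along the curve, so near
    \<open>\<zeta>\<close> the curve lies inside the disc about \<open>c\<close> through
    \<open>\<zeta>\<close>.\<close>
  define Q where "Q = (x1 t0 \<bullet> x1 t0 + 1) / (- (\<nu> \<bullet> x2))"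
  have Q: "0 < Q" "x1 t0 \<bullet> x1 t0 + Q * (\<nu> \<bullet> x2) < 0"
    using \<nu> by (auto simp: Q_def add_nonneg_pos divide_pos_neg)
  define c where "c = \<zeta> - Q *\<^sub>R \<nu>"
  have \<zeta>c: "\<zeta> - c = Q *\<^sub>R \<nu>" by (simp add: c_def)
  have "\<nu> \<noteq> 0" using \<nu> by auto
  define R where "R = (\<zeta> - c) \<bullet> (\<zeta> - c)"
  have R: "0 < R" using Q \<open>\<nu> \<noteq> 0\<close> by (simp add: R_def \<zeta>c)
  have "\<exists>\<epsilon>>0. \<forall>t. 0 < \<bar>t - t0\<bar> \<and> \<bar>t - t0\<bar> < \<epsilon> \<longrightarrow> (x t - c) \<bullet> (x t - c) < (x t0 - c) \<bullet> (x t0 - c)"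
  proof (rule second_derivative_test_max[OF t0])
    show "((\<lambda>t. (x t - c) \<bullet> (x t - c)) has_real_derivative 2 * (x1 t \<bullet> (x t - c))) (at t)" if "t \<in> {a<..<b}" for t
      using x1[OF that] unfolding has_vector_derivative_def has_field_derivative_def
      by (auto intro!: derivative_eq_intros simp: fun_eq_iff inner_commute algebra_simps)
    show "((\<lambda>t. 2 * (x1 t \<bullet> (x t - c))) has_real_derivative 2 * (x2 \<bullet> (x t0 - c) + x1 t0 \<bullet> x1 t0)) (at t0)"
      using x1[OF t0] x2 unfolding has_vector_derivative_def has_field_derivative_def
      by (auto intro!: derivative_eq_intros simp: fun_eq_iff inner_commute algebra_simps)
    show "2 * (x2 \<bullet> (x t0 - c) + x1 t0 \<bullet> x1 t0) < 0"
      using Q \<zeta>c by (simp add: \<zeta>_def inner_commute)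
    show "2 * (x1 t0 \<bullet> (x t0 - c)) = 0" using \<nu> \<zeta>c by (simp add: \<zeta>_def inner_commute)
  qed
  then obtain \<epsilon>' where "0 < \<epsilon>'" and inside: "\<And>t. 0 < \<bar>t - t0\<bar> \<Longrightarrow> \<bar>t - t0\<bar> < \<epsilon>' \<Longrightarrow> (x t - c) \<bullet> (x t - c) < R"
    by (auto simp: R_def \<zeta>_def)
  obtain \<rho> where "0 < \<rho>" and \<rho>: "\<And>z. dist z \<zeta> < \<rho> \<Longrightarrow> (z, \<xi>) \<in> Om \<Longrightarrow> r z \<xi> = 0 \<Longrightarrow> \<exists>t. \<bar>t - t0\<bar> < \<epsilon>' \<and> z = x t"
    using only[OF \<open>0 < \<epsilon>'\<close>] by (auto simp: \<zeta>_def)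
  define \<psi> where "\<psi> z = (z - c) \<bullet> (z - c) - R" for z
  define \<epsilon> where "\<epsilon> = min \<epsilon>1 \<rho> / 2"
  have \<epsilon>: "0 < \<epsilon>" "\<epsilon> < \<epsilon>1" "\<epsilon> < \<rho>" using \<epsilon>1 \<open>0 < \<rho>\<close> by (auto simp: \<epsilon>_def)
  \<comment> \<open>Near \<open>\<zeta>\<close> the zeros of \<open>\<sigma>\<close> lie on the
    curve, and the curve meets the complement of the open disc only at
    \<open>\<zeta>\<close>.\<close>
  have \<sigma>nz: "\<sigma> z \<noteq> 0" if z: "z \<in> cball \<zeta> \<epsilon>" "z \<noteq> \<zeta>" "0 \<le> \<psi> z" for z
  proof
    assume "\<sigma> z = 0"
    then have "r z \<xi> = 0" "(z, 0) \<in> U" using \<sigma>[of z] box[of z 0] z \<epsilon> \<epsilon>1 by auto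
    then obtain t where t: "\<bar>t - t0\<bar> < \<epsilon>'" "z = x t"
      using \<rho>[of z] z \<epsilon> by (auto simp: U_def \<Phi>_def dist_commute)
    with z(2) have "0 < \<bar>t - t0\<bar>" by (auto simp: \<zeta>_def)
    from inside[OF this t(1)] z(3) t(2) show False by (simp add: \<psi>_def)
  qed
  define A where "A = cball \<zeta> \<epsilon> \<inter> {z. 0 \<le> \<psi> z}"
  have c\<psi>: "continuous_on S \<psi>" for S unfolding \<psi>_def by (intro continuous_intros)
  have c\<sigma>: "continuous_on S \<sigma>" if "S \<subseteq> cball \<zeta> \<epsilon>" for S
  proof (rule continuous_at_imp_continuous_on, rule ballI)
    fix z assume "z \<in> S"
    then have "z \<in> ball \<zeta> \<epsilon>1" using that \<epsilon> by auto
    from has_derivative_continuous[OF d\<sigma>[OF this]] show "isCont \<sigma> z" .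
  qed
  have cA: "compact A" unfolding A_def
    by (intro compact_Int_closed compact_cball closed_Collect_le continuous_intros c\<psi>)
  have \<zeta>A: "\<zeta> \<in> A" using \<epsilon> by (simp add: A_def \<psi>_def R_def)
  \<comment> \<open>So small that \<open>H\<close> below is positive on the part of the small sphere
    that belongs to \<open>A\<close>; a minimum with \<open>H \<le> 0\<close> cannot sit
    there.\<close>
  obtain \<kappa> where \<kappa>: "0 < \<kappa>" "\<And>z. z \<in> A \<Longrightarrow> dist \<zeta> z = \<epsilon> \<Longrightarrow> \<kappa> * \<psi> z < (\<sigma> z)\<^sup>2"
  proof -
    define B where "B = A \<inter> sphere \<zeta> \<epsilon>"
    have cB: "compact B" unfolding B_def by (intro compact_Int_closed cA) auto
    show ?thesis
    proof (cases "B = {}")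
      case True
      then show ?thesis by (intro that[of 1]) (auto simp: B_def)
    next
      case False
      have "B \<subseteq> cball \<zeta> \<epsilon>" by (auto simp: B_def A_def)
      then have "continuous_on B (\<lambda>z. (\<sigma> z)\<^sup>2)" by (intro continuous_intros c\<sigma>)
      then obtain z1 where z1: "z1 \<in> B" "\<And>z. z \<in> B \<Longrightarrow> (\<sigma> z1)\<^sup>2 \<le> (\<sigma> z)\<^sup>2"
        using continuous_attains_inf[OF cB False] by blast
      obtain z2 where z2: "z2 \<in> B" "\<And>z. z \<in> B \<Longrightarrow> \<psi> z \<le> \<psi> z2"
        using continuous_attains_sup[OF cB False c\<psi>] by blast
      have "\<sigma> z1 \<noteq> 0" using z1(1) \<epsilon> by (intro \<sigma>nz) (auto simp: B_def A_def)
      then have p: "0 < (\<sigma> z1)\<^sup>2" by simp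
      have q: "0 \<le> \<psi> z2" using z2 by (simp add: B_def A_def)
      show ?thesis
      proof (rule that[of "(\<sigma> z1)\<^sup>2 / (\<psi> z2 + 1)"])
        show "0 < (\<sigma> z1)\<^sup>2 / (\<psi> z2 + 1)" using p q by simp
        fix z assume "z \<in> A" "dist \<zeta> z = \<epsilon>"
        then have zB: "z \<in> B" by (simp add: B_def)
        have "(\<sigma> z1)\<^sup>2 / (\<psi> z2 + 1) * \<psi> z \<le> (\<sigma> z1)\<^sup>2 / (\<psi> z2 + 1) * \<psi> z2"
          using z2(2)[OF zB] p q by (intro mult_left_mono) auto
        also have "\<dots> < (\<sigma> z1)\<^sup>2" using p q by (simp add: divide_less_eq)
        also have "\<dots> \<le> (\<sigma> z)\<^sup>2" by (rule z1(2)[OF zB])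
        finally show "(\<sigma> z1)\<^sup>2 / (\<psi> z2 + 1) * \<psi> z < (\<sigma> z)\<^sup>2" .
      qed
    qed
  qed
  define H where "H z = (\<sigma> z)\<^sup>2 - \<kappa> * \<psi> z" for z
  have "continuous_on A H" unfolding H_def by (intro continuous_intros c\<sigma> c\<psi>) (auto simp: A_def)
  then obtain w where w: "w \<in> A" "\<And>z. z \<in> A \<Longrightarrow> H w \<le> H z"
    using continuous_attains_inf[OF cA] \<zeta>A by blast
  have "H \<zeta> = 0" by (simp add: H_def \<epsilon>1 \<psi>_def R_def)
  with w(2)[OF \<zeta>A] have Hw: "H w \<le> 0" by simp
  have wb: "dist \<zeta> w < \<epsilon>" using \<kappa>(2)[OF w(1)] Hw w(1) by (cases "dist \<zeta> w = \<epsilon>") (auto simp: H_def A_def)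
  define \<eta> where "\<eta> = \<xi> + \<sigma> w *\<^sub>R \<mu>"
  define e where "e = n w \<eta>"
  have w1: "w \<in> ball \<zeta> \<epsilon>1" "w \<in> cball \<zeta> \<epsilon>1" using wb \<epsilon> by auto
  define M where "M = m w \<eta> \<bullet> \<mu>"
  have M: "0 < M" "(w, \<eta>) \<in> Om" "r w \<eta> = 0"
    using box[OF w1(2), of "\<sigma> w"] \<sigma>[OF w1(2)] by (auto simp: M_def \<eta>_def U_def \<Phi>_def)
  have "R \<le> (w - c) \<bullet> (w - c)" using w(1) by (simp add: A_def \<psi>_def)
  with R have wc: "0 < (w - c) \<bullet> (w - c)" by linarith
  have dH: "((\<lambda>s. H (w + s *\<^sub>R (w - c))) has_real_derivative
      2 * \<sigma> w * (- (e \<bullet> (w - c)) / M) - 2 * \<kappa> * ((w - c) \<bullet> (w - c))) (at 0)"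
  proof -
    have "((\<lambda>s. w + s *\<^sub>R (w - c)) has_derivative (\<lambda>k. k *\<^sub>R (w - c))) (at 0)"
      by (auto intro!: derivative_eq_intros)
    from has_derivative_compose[OF this, of \<sigma> "\<lambda>h. - (e \<bullet> h) / M"] d\<sigma>[OF w1(1)]
    have "((\<lambda>s. \<sigma> (w + s *\<^sub>R (w - c))) has_derivative (\<lambda>k. - (e \<bullet> (k *\<^sub>R (w - c))) / M)) (at 0)"
      by (simp add: e_def M_def \<eta>_def)
    then have 1: "((\<lambda>s. \<sigma> (w + s *\<^sub>R (w - c))) has_real_derivative - (e \<bullet> (w - c)) / M) (at 0)"
      by (rule has_derivative_imp_has_field_derivative) simp
    have "\<psi> (w + s *\<^sub>R (w - c)) = (1 + s)\<^sup>2 * ((w - c) \<bullet> (w - c)) - R" for s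
    proof -
      have "w + s *\<^sub>R (w - c) - c = (1 + s) *\<^sub>R (w - c)" by (simp add: algebra_simps)
      then show ?thesis by (simp add: \<psi>_def power2_eq_square)
    qed
    then have "H (w + s *\<^sub>R (w - c)) = (\<sigma> (w + s *\<^sub>R (w - c)))\<^sup>2 - \<kappa> * ((1 + s)\<^sup>2 * ((w - c) \<bullet> (w - c)) - R)" for s
      by (simp add: H_def)
    then show ?thesis
      by (simp only:) (rule derivative_eq_intros 1 refl | simp)+
  qed
  have out: "\<forall>\<^sub>F s in at_right 0. w + s *\<^sub>R (w - c) \<in> A"
  proof -
    have "((\<lambda>s. dist \<zeta> (w + s *\<^sub>R (w - c))) \<longlongrightarrow> dist \<zeta> (w + 0 *\<^sub>R (w - c))) (at_right 0)"
      by (intro tendsto_intros)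
    then have "\<forall>\<^sub>F s in at_right 0. dist \<zeta> (w + s *\<^sub>R (w - c)) < \<epsilon>"
      using wb by (auto dest: order_tendstoD)
    moreover have "\<forall>\<^sub>F s in at_right 0. (0::real) < s" by (simp add: eventually_at_right_less)
    ultimately show ?thesis
    proof eventually_elim
      case (elim s)
      have "w + s *\<^sub>R (w - c) - c = (1 + s) *\<^sub>R (w - c)" by (simp add: algebra_simps)
      then have "\<psi> (w + s *\<^sub>R (w - c)) = (1 + s)\<^sup>2 * ((w - c) \<bullet> (w - c)) - R" by (simp add: \<psi>_def power2_eq_square)
      moreover have "1 * ((w - c) \<bullet> (w - c)) \<le> (1 + s)\<^sup>2 * ((w - c) \<bullet> (w - c))"
        using elim wc by (intro mult_right_mono) (auto simp: power2_eq_square algebra_simps)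
      moreover have "0 \<le> (w - c) \<bullet> (w - c) - R" using w(1) by (simp add: A_def \<psi>_def)
      ultimately show ?case using elim by (simp add: A_def)
    qed
  qed
  \<comment> \<open>Moving from \<open>w\<close> away from \<open>c\<close> stays in
    \<open>A\<close>, so \<open>H\<close> cannot decrease in this direction. If \<open>e\<close> or
    \<open>\<sigma> w\<close> were 0, only the negative term with \<open>\<kappa>\<close> would be
    left in its derivative.\<close>
  have e\<sigma>: "e \<noteq> 0 \<and> \<sigma> w \<noteq> 0"
  proof (rule ccontr)
    assume "\<not> (e \<noteq> 0 \<and> \<sigma> w \<noteq> 0)"
    then have "2 * \<sigma> w * (- (e \<bullet> (w - c)) / M) - 2 * \<kappa> * ((w - c) \<bullet> (w - c)) < 0" using wc \<kappa> by auto
    from DERIV_neg_dec_right[OF dH this] obtain d where d: "0 < d" "\<And>h. 0 < h \<Longrightarrow> h < d \<Longrightarrow> H (w + h *\<^sub>R (w - c)) < H w" by auto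
    have "\<forall>\<^sub>F s in at_right 0. s < d" using d by (simp add: eventually_at_right_field) blast
    moreover have "\<forall>\<^sub>F s in at_right 0. (0::real) < s" by (simp add: eventually_at_right_less)
    ultimately have "\<forall>\<^sub>F s in at_right (0::real). False"
      using out by eventually_elim (use d w(2) in force)
    then show False by simp
  qed
  \<comment> \<open>On the circle \<open>\<psi> = 0\<close> the function \<open>H\<close> is the
    square of \<open>\<sigma>\<close>, positive at \<open>w\<close> in contradiction to
    \<open>H w \<le> 0\<close>. Being off the circle, \<open>w\<close> has a full neighbourhood in
    \<open>A\<close>.\<close>
  have \<psi>w: "0 < \<psi> w"
    using w(1) Hw e\<sigma> \<kappa>(1) by (cases "\<psi> w = 0") (auto simp: A_def H_def)
  define L where "L = ball \<zeta> \<epsilon> \<inter> {z. 0 < \<psi> z}"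
  have L: "open L" "w \<in> L"
    using wb \<psi>w by (auto simp: L_def intro!: open_Int open_Collect_less continuous_intros c\<psi>)
  \<comment> \<open>The slice at \<open>\<eta>\<close> is a level set of \<open>\<sigma>\<close>,
    where the first term of \<open>H\<close> is constant. Minimality of \<open>H\<close> becomes
    maximality of \<open>\<psi>\<close>: locally the slice stays in the disc about \<open>c\<close>
    through \<open>w\<close>.\<close>
  have level: "\<psi> z \<le> \<psi> w" if "z \<in> L" "r z \<eta> = 0" for z
  proof -
    have "\<sigma> w = \<sigma> z"
      using that \<sigma>[OF w1(2)] \<epsilon> by (intro uniq) (auto simp: L_def \<eta>_def)
    moreover have "H w \<le> H z" using that by (intro w(2)) (auto simp: L_def A_def)
    ultimately show ?thesis using \<kappa>(1) by (simp add: H_def)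
  qed
  define \<Psi> where "\<Psi> p = (w + fst p *\<^sub>R rot e + snd p *\<^sub>R e, \<eta>)" for p :: "real \<times> real"
  have c\<Psi>: "continuous_on UNIV \<Psi>" unfolding \<Psi>_def by (intro continuous_intros)
  define U' where "U' = \<Psi> -` (Om \<inter> L \<times> UNIV)"
  have U': "open U'" "(0, 0) \<in> U'"
    unfolding U'_def using open_vimage[OF open_Int[OF open_O open_Times[OF L(1) open_UNIV]] c\<Psi>] M L(2)
    by (auto simp: \<Psi>_def)
  let ?y = "\<lambda>t s. w + t *\<^sub>R rot e + s *\<^sub>R e"
  have F': "((\<lambda>(t, s). r (?y t s) \<eta>) has_derivative (\<lambda>(h, k). (n (?y t s) \<eta> \<bullet> rot e) \<bullet> h + (n (?y t s) \<eta> \<bullet> e) * k)) (at (t, s))"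
    if "(t, s) \<in> U'" for t s
  proof -
    have "(\<Psi> has_derivative (\<lambda>p. (fst p *\<^sub>R rot e + snd p *\<^sub>R e, 0))) (at (t, s))"
      unfolding \<Psi>_def by (auto intro!: derivative_eq_intros)
    from has_derivative_compose[OF this, of "\<lambda>(z, e). r z e"
        "\<lambda>(h, k). n (?y t s) \<eta> \<bullet> h + m (?y t s) \<eta> \<bullet> k"] deriv[of "?y t s" \<eta>] that
    show ?thesis by (simp add: \<Psi>_def U'_def case_prod_beta' inner_add_right mult.commute)
  qed
  have cB': "continuous_on U' (\<lambda>(t, s). n (?y t s) \<eta> \<bullet> e)"
  proof -
    have "continuous_on U' (\<lambda>p. (case \<Psi> p of (z, e) \<Rightarrow> n z e) \<bullet> e)"
      by (intro continuous_intros continuous_on_compose2[OF cont_n continuous_on_subset[OF c\<Psi>]]) (auto simp: U'_def)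
    then show ?thesis by (simp add: \<Psi>_def case_prod_beta')
  qed
  have "0 < n (?y 0 0) \<eta> \<bullet> e" "r (?y 0 0) \<eta> = 0" using e\<sigma> M by (simp_all add: e_def)
  note implicit = scalar_implicit_function[OF U' F' cB' this(2,1)]
  have "\<exists>\<epsilon>2 s. 0 < \<epsilon>2 \<and> s 0 = 0 \<and>
      (\<forall>t\<in>cball 0 \<epsilon>2. (t, s t) \<in> U' \<and> 0 < n (?y t (s t)) \<eta> \<bullet> e \<and> r (?y t (s t)) \<eta> = 0) \<and>
      (\<forall>t\<in>ball 0 \<epsilon>2. (s has_derivative (\<lambda>h. - ((n (?y t (s t)) \<eta> \<bullet> rot e) \<bullet> h) / (n (?y t (s t)) \<eta> \<bullet> e))) (at t))"
  proof (rule implicit)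
    fix \<epsilon>2 \<delta>2 :: real and s :: "real \<Rightarrow> real"
    assume h: "0 < \<epsilon>2" "s 0 = 0"
      "\<And>t u. t \<in> cball 0 \<epsilon>2 \<Longrightarrow> u \<in> {0 - \<delta>2..0 + \<delta>2} \<Longrightarrow> (t, u) \<in> U' \<and> 0 < n (?y t u) \<eta> \<bullet> e"
      "\<And>t. t \<in> cball 0 \<epsilon>2 \<Longrightarrow> s t \<in> {0 - \<delta>2<..<0 + \<delta>2} \<and> r (?y t (s t)) \<eta> = 0"
      "\<And>t. t \<in> ball 0 \<epsilon>2 \<Longrightarrow> (s has_derivative (\<lambda>h. - ((n (?y t (s t)) \<eta> \<bullet> rot e) \<bullet> h) / (n (?y t (s t)) \<eta> \<bullet> e))) (at t)"
    show ?thesis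
    proof (intro exI[of _ \<epsilon>2] exI[of _ s] conjI ballI)
      fix t :: real assume t: "t \<in> cball 0 \<epsilon>2"
      then have "s t \<in> {0 - \<delta>2..0 + \<delta>2}" using h(4)[OF t] by auto
      from h(3)[OF t this] h(4)[OF t] show "(t, s t) \<in> U'" "0 < n (?y t (s t)) \<eta> \<bullet> e" "r (?y t (s t)) \<eta> = 0"
        by auto
    qed (use h in blast)+
  qed
  then obtain \<epsilon>2 s where \<epsilon>2: "0 < \<epsilon>2" "s 0 = 0"
    and s: "\<And>t. t \<in> cball 0 \<epsilon>2 \<Longrightarrow> (t, s t) \<in> U' \<and> 0 < n (?y t (s t)) \<eta> \<bullet> e \<and> r (?y t (s t)) \<eta> = 0"
    and ds: "\<And>t. t \<in> ball 0 \<epsilon>2 \<Longrightarrow> (s has_derivative (\<lambda>h. - ((n (?y t (s t)) \<eta> \<bullet> rot e) \<bullet> h) / (n (?y t (s t)) \<eta> \<bullet> e))) (at t)"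
    by blast
  define y where "y t = ?y t (s t)" for t
  have y0: "y 0 = w" by (simp add: y_def \<epsilon>2)
  have t2: "t \<in> cball 0 \<epsilon>2" "t \<in> ball 0 \<epsilon>2" if "\<bar>t - 0\<bar> < \<epsilon>2" for t :: real using that by (auto simp: dist_real_def)
  have yU: "(t, s t) \<in> U'" "0 < n (y t) \<eta> \<bullet> e" "r (y t) \<eta> = 0" if "\<bar>t - 0\<bar> < \<epsilon>2" for t
    using s[OF t2(1)[OF that]] by (auto simp: y_def)
  have "turning \<eta>"
  proof (rule ccontr)
    assume no: "\<not> turning \<eta>"
    have cs: "continuous_on {0 - \<epsilon>2<..<0 + \<epsilon>2} s"
    proof (rule continuous_at_imp_continuous_on, rule ballI)
      fix t assume "t \<in> {0 - \<epsilon>2<..<0 + \<epsilon>2}"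
      then have "\<bar>t - 0\<bar> < \<epsilon>2" by auto
      from has_derivative_continuous[OF ds[OF t2(2)[OF this]]] show "isCont s t" .
    qed
    then have cy: "continuous_on {0 - \<epsilon>2<..<0 + \<epsilon>2} y"
      unfolding y_def by (intro continuous_intros)
    have par: "cross2 e (n (y t) \<eta>) = 0" if t: "\<bar>t - 0\<bar> < \<epsilon>2" for t
    proof (rule ccontr)
      assume "cross2 e (n (y t) \<eta>) \<noteq> 0"
      then have "cross2 (n (y 0) \<eta>) (n (y t) \<eta>) \<noteq> 0" by (simp add: y0 e_def)
      with no show False
      proof (elim notE, intro turningI[OF \<epsilon>2(1) cy _ _ t])
        fix t assume "\<bar>t - 0\<bar> < \<epsilon>2"
        note yU = yU[OF this]
        have "(y t, \<eta>) \<in> Om" using yU(1) by (simp add: U'_def \<Psi>_def y_def)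
        with yU show "(y t, \<eta>) \<in> Om \<and> r (y t) \<eta> = 0" "0 < n (y 0) \<eta> \<bullet> n (y t) \<eta>"
          by (simp_all add: y0 e_def[symmetric] inner_commute)
      qed
    qed
    \<comment> \<open>With all normals parallel to \<open>e\<close> the implicit function has
      derivative 0, and the slice contains a segment centred at \<open>w\<close>. But
      \<open>\<psi>\<close> is strictly convex, so at one end of the segment it exceeds
      \<open>\<psi> w\<close>.\<close>
    have s0: "s t = 0" if t: "\<bar>t - 0\<bar> < \<epsilon>2" for t
    proof -
      have "(s has_derivative (\<lambda>h. 0)) (at t within ball 0 \<epsilon>2)" if "t \<in> ball 0 \<epsilon>2" for t
      proof -
        have "\<bar>t - 0\<bar> < \<epsilon>2" using that by (simp add: dist_real_def)
        from par[OF this] ds[OF that] show ?thesis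
          by (simp add: y_def[symmetric] rot_inner has_derivative_at_withinI)
      qed
      from has_derivative_zero_unique[OF convex_ball this t2(2)[OF t], of 0] \<epsilon>2 show ?thesis by simp
    qed
    define t where "t = \<epsilon>2 / 2"
    have t: "\<bar>t - 0\<bar> < \<epsilon>2" "\<bar>- t - 0\<bar> < \<epsilon>2" "0 < t" using \<epsilon>2 by (auto simp: t_def)
    have "\<psi> (w + t *\<^sub>R rot e) \<le> \<psi> w" "\<psi> (w + (- t) *\<^sub>R rot e) \<le> \<psi> w"
      using yU[OF t(1)] yU[OF t(2)] s0[OF t(1)] s0[OF t(2)]
      by (auto simp: U'_def \<Psi>_def y_def intro!: level)
    moreover have "\<psi> (w + u *\<^sub>R rot e) = \<psi> w + 2 * u * ((w - c) \<bullet> rot e) + u\<^sup>2 * (e \<bullet> e)" for u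
    proof -
      have "w + u *\<^sub>R rot e - c = (w - c) + u *\<^sub>R rot e" by simp
      moreover have "(d + u *\<^sub>R v) \<bullet> (d + u *\<^sub>R v) = d \<bullet> d + 2 * u * (d \<bullet> v) + u\<^sup>2 * (v \<bullet> v)" for d v :: "real^2"
        by (simp add: inner_add_left inner_add_right power2_eq_square inner_commute)
      ultimately show ?thesis
        by (simp only: \<psi>_def norm_rot)
    qed
    ultimately have "2 * (t\<^sup>2 * (e \<bullet> e)) \<le> 0" by (simp only: ) (simp add: algebra_simps)
    moreover have "0 < t\<^sup>2 * (e \<bullet> e)" using t(3) e\<sigma> by simp
    ultimately show False by linarith
  qed
  then show ?thesis ..
qed

end

section \<open>Directions and magnification at the points of a turning slice\<close>

context hypersurface
begin

text \<open>The slope of the normal is continuous along the path and takes every value between those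
  at the ends. Choosing one point for each value parametrises the points by slope, which is how the
  tubes are indexed; different slopes force different points, and compactness gives the
  bounds.\<close>

lemma turning_directions:
  assumes "turning \<eta>"
  shows "\<exists>w0 w1 c M \<alpha> s. cross2 w0 w1 \<noteq> 0 \<and> 0 < c \<and> inj_on \<alpha> {0..1::real} \<and>
    (\<forall>t\<in>{0..1}. (\<alpha> t, \<eta>) \<in> Om \<and> r (\<alpha> t) \<eta> = 0 \<and> n (\<alpha> t) \<eta> = s t *\<^sub>R (w0 + t *\<^sub>R w1) \<and>
       c \<le> s t \<and> norm (m (\<alpha> t) \<eta>) \<le> M)"
proof -
  obtain y where y: "continuous_on {0..1::real} y"
    and on: "\<And>t. t \<in> {0..1} \<Longrightarrow> (y t, \<eta>) \<in> Om \<and> r (y t) \<eta> = 0 \<and> 0 < n (y 0) \<eta> \<bullet> n (y t) \<eta>"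
    and ne: "cross2 (n (y 0) \<eta>) (n (y 1) \<eta>) \<noteq> 0"
    using assms unfolding turning_def by blast
  let ?N = "\<lambda>t. n (y t) \<eta>"
  define e where "e = ?N 0"
  have e: "e \<noteq> 0" using ne by (auto simp: e_def cross2_def)
  have cy: "continuous_on {0..1} (\<lambda>t. (y t, \<eta>))" by (intro continuous_intros y)
  have cN: "continuous_on {0..1} ?N"
    using continuous_on_compose2[OF cont_n cy] on by (simp add: image_subset_iff)
  have cM: "continuous_on {0..1} (\<lambda>t. norm (m (y t) \<eta>))"
    using continuous_on_compose2[OF cont_m cy] on by (intro continuous_intros) (simp add: image_subset_iff)
  obtain tm where tm: "tm \<in> {0..1}" "\<And>t. t \<in> {0..1} \<Longrightarrow> norm (m (y t) \<eta>) \<le> norm (m (y tm) \<eta>)"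
    using continuous_attains_sup[OF _ _ cM] by (auto simp: compact_Icc)
  have ceN: "continuous_on {0..1} (\<lambda>t. e \<bullet> ?N t)" by (intro continuous_intros cN)
  obtain tc where tc: "tc \<in> {0..1}" "\<And>t. t \<in> {0..1} \<Longrightarrow> e \<bullet> ?N tc \<le> e \<bullet> ?N t"
    using continuous_attains_inf[OF _ _ ceN] by (auto simp: compact_Icc)
  define \<tau> where "\<tau> t = (rot e \<bullet> ?N t) / (e \<bullet> ?N t)" for t
  have pos: "0 < e \<bullet> ?N t" if "t \<in> {0..1}" for t using on[OF that] by (simp add: e_def)
  have c\<tau>: "continuous_on {0..1} \<tau>"
    unfolding \<tau>_def by (intro continuous_intros cN) (use pos in force)
  have \<tau>0: "\<tau> 0 = 0" by (simp add: \<tau>_def rot_inner e_def)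
  have \<tau>1: "\<tau> 1 \<noteq> 0" using ne pos[of 1] by (simp add: \<tau>_def rot_inner e_def)
  have "\<exists>t\<in>{0..1}. \<tau> t = u * \<tau> 1" if u: "u \<in> {0..1}" for u
  proof (cases "0 < \<tau> 1")
    case True
    then have "\<exists>t\<ge>0. t \<le> 1 \<and> \<tau> t = u * \<tau> 1"
      using u by (intro IVT' c\<tau>) (auto simp: \<tau>0 mult_left_le_one_le)
    then show ?thesis by auto
  next
    case False
    then have "\<exists>t\<ge>0. t \<le> 1 \<and> - \<tau> t = u * - \<tau> 1"
      using u \<tau>1 by (intro IVT'[of "\<lambda>t. - \<tau> t"] continuous_on_minus c\<tau>) (auto simp: \<tau>0 mult_left_le_one_le mult_nonneg_nonpos)
    then show ?thesis by auto
  qed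
  then obtain T where T: "\<And>u. u \<in> {0..1} \<Longrightarrow> T u \<in> {0..1} \<and> \<tau> (T u) = u * \<tau> 1" by metis
  have N: "?N (T u) = ((e \<bullet> ?N (T u)) / (e \<bullet> e)) *\<^sub>R (e + u *\<^sub>R (\<tau> 1 *\<^sub>R rot e))" if u: "u \<in> {0..1}" for u
  proof -
    let ?v = "?N (T u)"
    have p: "0 < e \<bullet> ?v" using pos T[OF u] by blast
    have "cross2 e ?v = (e \<bullet> ?v) * \<tau> (T u)" using p by (simp add: \<tau>_def rot_inner)
    then have "(e \<bullet> e) *\<^sub>R ?v = (e \<bullet> ?v) *\<^sub>R e + ((e \<bullet> ?v) * (u * \<tau> 1)) *\<^sub>R rot e"
      using vec2_decompose[of e ?v] T[OF u] by (simp add: inner_commute)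
    then have "(e \<bullet> e) *\<^sub>R ?v = (e \<bullet> ?v) *\<^sub>R (e + u *\<^sub>R (\<tau> 1 *\<^sub>R rot e))"
      by (simp add: scaleR_add_right)
    then have "(1 / (e \<bullet> e)) *\<^sub>R ((e \<bullet> e) *\<^sub>R ?v) = (1 / (e \<bullet> e)) *\<^sub>R ((e \<bullet> ?v) *\<^sub>R (e + u *\<^sub>R (\<tau> 1 *\<^sub>R rot e)))"
      by (rule arg_cong)
    then show ?thesis using e by simp
  qed
  show ?thesis
  proof (intro exI conjI ballI)
    have "cross2 e (\<tau> 1 *\<^sub>R rot e) = \<tau> 1 * (e \<bullet> e)"
      by (simp add: cross2_def rot_def inner_vec_def sum_2 algebra_simps)
    then show "cross2 e (\<tau> 1 *\<^sub>R rot e) \<noteq> 0" using \<tau>1 e by simp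
    show "0 < (e \<bullet> ?N tc) / (e \<bullet> e)" using pos[OF tc(1)] e by simp
    show "inj_on (\<lambda>u. y (T u)) {0..1}"
    proof (rule inj_onI)
      fix u v :: real assume "u \<in> {0..1}" "v \<in> {0..1}" "y (T u) = y (T v)"
      then have "u * \<tau> 1 = v * \<tau> 1" using T[of u] T[of v] by (simp add: \<tau>_def[abs_def])
      with \<tau>1 show "u = v" by simp
    qed
    fix u :: real assume u: "u \<in> {0..1}"
    note Tu = conjunct1[OF T[OF u]]
    show "(y (T u), \<eta>) \<in> Om" "r (y (T u)) \<eta> = 0" using on[OF Tu] by auto
    show "?N (T u) = ((e \<bullet> ?N (T u)) / (e \<bullet> e)) *\<^sub>R (e + u *\<^sub>R (\<tau> 1 *\<^sub>R rot e))" by (rule N[OF u])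
    show "(e \<bullet> ?N tc) / (e \<bullet> e) \<le> (e \<bullet> ?N (T u)) / (e \<bullet> e)" using tc(2)[OF Tu] by (simp add: divide_right_mono)
    show "norm (m (y (T u)) \<eta>) \<le> norm (m (y tm) \<eta>)" by (rule tm(2)[OF Tu])
  qed
qed

lemma blow_up_sign:
  assumes O: "(\<alpha>, \<eta>) \<in> Om" "r \<alpha> \<eta> = 0" and L: "n \<alpha> \<eta> \<bullet> z + m \<alpha> \<eta> \<bullet> e \<noteq> 0"
  shows "\<forall>\<^sub>F k in sequentially. (\<alpha> + (1 / real k) *\<^sub>R z, \<eta> + (1 / real k) *\<^sub>R e) \<in> Om \<and>
    (r (\<alpha> + (1 / real k) *\<^sub>R z) (\<eta> + (1 / real k) *\<^sub>R e) < 0 \<longleftrightarrow> n \<alpha> \<eta> \<bullet> z + m \<alpha> \<eta> \<bullet> e < 0)"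
proof -
  let ?L = "n \<alpha> \<eta> \<bullet> z + m \<alpha> \<eta> \<bullet> e"
  define f where "f t = r (\<alpha> + t *\<^sub>R z) (\<eta> + t *\<^sub>R e)" for t
  have "(f has_derivative (\<lambda>h. n \<alpha> \<eta> \<bullet> (h *\<^sub>R z) + m \<alpha> \<eta> \<bullet> (h *\<^sub>R e))) (at 0)"
    unfolding f_def by (rule deriv_along[OF O(1)]) (auto intro!: derivative_eq_intros)
  then have "(f has_real_derivative ?L) (at 0)"
    by (rule has_derivative_imp_has_field_derivative) (simp add: algebra_simps)
  then have "((\<lambda>t. f t / t) \<longlongrightarrow> ?L) (at 0)"
    using O(2) by (simp add: has_field_derivative_iff f_def)
  moreover have inv: "filterlim (\<lambda>k. 1 / real k) (at 0) sequentially"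
    unfolding filterlim_at using lim_1_over_n
    by (auto intro!: eventually_mono[OF eventually_gt_at_top[of 0]])
  ultimately have "(\<lambda>k. f (1 / real k) / (1 / real k)) \<longlonglongrightarrow> ?L" by (rule filterlim_compose)
  then have "\<forall>\<^sub>F k in sequentially. f (1 / real k) / (1 / real k) < 0 \<longleftrightarrow> ?L < 0"
  proof (cases "?L < 0")
    case True
    assume "(\<lambda>k. f (1 / real k) / (1 / real k)) \<longlonglongrightarrow> ?L"
    from order_tendstoD(2)[OF this True] show ?thesis by eventually_elim (use True in simp)
  next
    case False
    assume "(\<lambda>k. f (1 / real k) / (1 / real k)) \<longlonglongrightarrow> ?L"
    moreover have "0 < ?L" using False L by simp
    ultimately have "\<forall>\<^sub>F k in sequentially. 0 < f (1 / real k) / (1 / real k)" by (rule order_tendstoD(1))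
    then show ?thesis by eventually_elim (use False in simp)
  qed
  moreover have "\<forall>\<^sub>F k in sequentially. (\<alpha> + (1 / real k) *\<^sub>R z, \<eta> + (1 / real k) *\<^sub>R e) \<in> Om"
  proof -
    have "(\<lambda>k. (\<alpha> + (1 / real k) *\<^sub>R z, \<eta> + (1 / real k) *\<^sub>R e)) \<longlonglongrightarrow> (\<alpha> + 0 *\<^sub>R z, \<eta> + 0 *\<^sub>R e)"
      by (intro tendsto_intros lim_1_over_n)
    then show ?thesis using topological_tendstoD[OF _ open_O] O(1) by simp
  qed
  ultimately show ?thesis
    using eventually_gt_at_top[of 0] by eventually_elim (simp add: f_def field_simps mult_less_0_iff zero_less_mult_iff)
qed

end

subsection \<open>The boundary piece in the coordinates of \<open>emb\<close>\<close>

lemma linear_emb: "linear (\<lambda>w. emb a j (fst w) (snd w))"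
  by (rule linearI) (simp_all add: emb_add[symmetric] emb_scaleR[symmetric])

lemma emb_partial_linear:
  "emb a j (z + z') 0 = emb a j z 0 + emb a j z' 0" "emb a j (c *\<^sub>R z) 0 = c *\<^sub>R emb a j z 0"
  "emb a j 0 (e + e') = emb a j 0 e + emb a j 0 e'" "emb a j 0 (c *\<^sub>R e) = c *\<^sub>R emb a j 0 e"
  by (simp_all add: emb_def vec_eq_iff)

text \<open>The gradient in the coordinates of \<open>emb\<close> consists of derivatives of
  \<open>\<rho>\<close> along \<open>\<Gamma>\<close>; it is continuous because the first partial
  derivatives are differentiable. Every vector of \<open>\<Gamma>\<close> has the form
  \<open>emb a j h k\<close>, so a differential that is nonzero on \<open>\<Gamma>\<close> gives a
  nonzero \<open>(n, m)\<close>.\<close>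

lemma hypersurface_of_boundary:
  fixes \<rho> :: "(real^2)^3 \<Rightarrow> real"
  assumes "a \<noteq> j" "open V" and \<rho>: "smooth_on V \<rho>"
    and regular: "\<And>\<xi>. \<xi> \<in> \<Gamma> \<inter> V \<Longrightarrow> \<rho> \<xi> = 0 \<Longrightarrow> \<exists>v\<in>\<Gamma>. frechet_derivative \<rho> (at \<xi>) v \<noteq> 0"
  shows "\<exists>n m. hypersurface {w. emb a j (fst w) (snd w) \<in> V} (\<lambda>z e. \<rho> (emb a j z e)) n m"
proof -
  let ?E = "\<lambda>w. emb a j (fst w) (snd w)"
  let ?O = "{w. ?E w \<in> V}"
  let ?d = "\<lambda>x. frechet_derivative \<rho> (at x)"
  have E: "bounded_linear ?E" using linear_emb by (rule linear_conv_bounded_linear[THEN iffD1])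
  have cE: "continuous_on S ?E" for S by (intro continuous_intros)
  have d: "(\<rho> has_derivative ?d x) (at x)" if "x \<in> V" for x
  proof -
    have "\<rho> differentiable (at x)" using \<rho> that unfolding smooth_on_def by (metis iter_deriv.simps(1) lists.Nil)
    then show ?thesis by (simp add: frechet_derivative_works)
  qed
  have cd: "continuous_on V (\<lambda>x. ?d x v)" for v
  proof -
    have "continuous_on V (\<lambda>x. ?d x b)" if "b \<in> Basis" for b
    proof (rule continuous_at_imp_continuous_on, rule ballI)
      fix x assume "x \<in> V"
      moreover have "[b] \<in> lists Basis" using that by simp
      ultimately have "iter_deriv [b] \<rho> differentiable (at x)" using \<rho> unfolding smooth_on_def by blast
      then show "isCont (\<lambda>x. ?d x b) x" using differentiable_imp_continuous_within by auto
    qed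
    then have "continuous_on V (\<lambda>x. \<Sum>b\<in>Basis. (v \<bullet> b) * ?d x b)" by (intro continuous_intros)
    moreover have "?d x v = (\<Sum>b\<in>Basis. (v \<bullet> b) * ?d x b)" if "x \<in> V" for x
    proof -
      have l: "linear (?d x)" using d[OF that] has_derivative_linear by blast
      have "?d x v = ?d x (\<Sum>b\<in>Basis. (v \<bullet> b) *\<^sub>R b)" by (simp add: euclidean_representation)
      then show ?thesis by (simp add: linear_sum[OF l] linear_scale[OF l])
    qed
    ultimately show ?thesis by (subst continuous_on_cong[OF refl]) auto
  qed
  define n where "n z e = (\<Sum>b\<in>Basis. ?d (emb a j z e) (emb a j b 0) *\<^sub>R b)" for z e
  define m where "m z e = (\<Sum>b\<in>Basis. ?d (emb a j z e) (emb a j 0 b) *\<^sub>R b)" for z e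
  have rep: "?d (emb a j z e) (emb a j h k) = n z e \<bullet> h + m z e \<bullet> k" if "emb a j z e \<in> V" for z e h k
  proof -
    let ?x = "emb a j z e"
    have l: "linear (?d ?x)" using d[OF that] has_derivative_linear by blast
    have l1: "linear (\<lambda>h. ?d ?x (emb a j h 0))"
      by (rule linearI) (simp_all add: linear_add[OF l] linear_scale[OF l] emb_partial_linear)
    have l2: "linear (\<lambda>k. ?d ?x (emb a j 0 k))"
      by (rule linearI) (simp_all add: linear_add[OF l] linear_scale[OF l] emb_partial_linear)
    have "emb a j h k = emb a j h 0 + emb a j 0 k" by (simp add: emb_add[symmetric])
    then have "?d ?x (emb a j h k) = ?d ?x (emb a j h 0) + ?d ?x (emb a j 0 k)" by (simp add: linear_add[OF l])
    also have "?d ?x (emb a j h 0) = n z e \<bullet> h"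
    proof -
      have "?d ?x (emb a j h 0) = (\<lambda>h. ?d ?x (emb a j h 0)) (\<Sum>b\<in>Basis. (h \<bullet> b) *\<^sub>R b)" by (simp add: euclidean_representation)
      also have "\<dots> = (\<Sum>b\<in>Basis. (h \<bullet> b) *\<^sub>R ?d ?x (emb a j b 0))" by (simp add: linear_sum[OF l1] linear_scale[OF l1])
      finally show ?thesis by (simp add: n_def inner_sum_left inner_sum_right inner_commute mult.commute)
    qed
    also have "?d ?x (emb a j 0 k) = m z e \<bullet> k"
    proof -
      have "?d ?x (emb a j 0 k) = (\<lambda>k. ?d ?x (emb a j 0 k)) (\<Sum>b\<in>Basis. (k \<bullet> b) *\<^sub>R b)" by (simp add: euclidean_representation)
      also have "\<dots> = (\<Sum>b\<in>Basis. (k \<bullet> b) *\<^sub>R ?d ?x (emb a j 0 b))" by (simp add: linear_sum[OF l2] linear_scale[OF l2])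
      finally show ?thesis by (simp add: m_def inner_sum_left inner_sum_right inner_commute mult.commute)
    qed
    finally show ?thesis .
  qed
  have "hypersurface ?O (\<lambda>z e. \<rho> (emb a j z e)) n m"
  proof
    show "open ?O" using open_vimage[OF \<open>open V\<close> cE] by (simp add: vimage_def)
    have cc: "continuous_on ?O (\<lambda>w. ?d (?E w) v)" for v
      by (rule continuous_on_compose2[OF cd cE]) auto
    show "continuous_on ?O (\<lambda>(z, e). n z e)" "continuous_on ?O (\<lambda>(z, e). m z e)"
      unfolding n_def m_def case_prod_beta' by (intro continuous_intros cc)+
    fix z e assume "(z, e) \<in> ?O"
    then have V: "emb a j z e \<in> V" by simp
    show "((\<lambda>(z, e). \<rho> (emb a j z e)) has_derivative (\<lambda>(h, k). n z e \<bullet> h + m z e \<bullet> k)) (at (z, e))"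
      using has_derivative_compose[OF bounded_linear_imp_has_derivative[OF E], of \<rho> "?d (emb a j z e)" "(z, e)" UNIV] d[OF V]
      by (simp add: case_prod_beta' rep[OF V])
    assume "\<rho> (emb a j z e) = 0"
    then obtain v where v: "v \<in> \<Gamma>" "?d (emb a j z e) v \<noteq> 0"
      using regular[of "emb a j z e"] V emb_in_Gamma[OF \<open>a \<noteq> j\<close>] by auto
    then have "?d (emb a j z e) (emb a j (v $ a) (v $ j)) \<noteq> 0"
      using Gamma_eq_emb[OF v(1) \<open>a \<noteq> j\<close>] by simp
    then show "n z e \<noteq> 0 \<or> m z e \<noteq> 0" by (auto simp: rep[OF V])
  qed
  then show ?thesis by blast
qed

lemma ex_third_index: "\<exists>b::3. b \<noteq> a \<and> b \<noteq> j"
proof (rule ccontr)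
  assume "\<not> ?thesis"
  then have "(UNIV :: 3 set) = {a, j}" by auto
  then have "card (UNIV :: 3 set) = card {a, j}" by simp
  then show False by (simp add: card_insert_if split: if_splits)
qed

lemma inner_emb_0: "a \<noteq> j \<Longrightarrow> emb a j u 0 \<bullet> emb a j w 0 = 2 * (u \<bullet> w)"
proof -
  assume ne: "a \<noteq> j"
  obtain b where b: "b \<noteq> a" "b \<noteq> j" using ex_third_index[of a j] by blast
  show ?thesis
    unfolding inner_vec_def[of "emb a j u 0"] UNIV_3_eq[OF ne b]
    using ne b by (simp add: emb_components)
qed


text \<open>In a slice the component \<open>a\<close> determines the curve, and by
  \<open>inner_emb_0\<close> this embedding doubles inner products. The expression under the root in
  \<open>curvature\<close> is therefore 4 times the square of \<open>cross2\<close>.\<close>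

lemma slice_curve:
  assumes ne: "a \<noteq> j" and \<gamma>: "smooth_on {c<..<d} \<gamma>"
    and slice: "\<And>t. t \<in> {c<..<d} \<Longrightarrow> \<gamma> t \<in> \<Gamma> \<inter> coordinate_slice j \<xi>"
    and curv: "\<And>t. t \<in> {c<..<d} \<Longrightarrow> curvature \<gamma> t \<noteq> 0"
  shows "\<exists>x1 x2. \<forall>t\<in>{c<..<d::real}. ((\<lambda>t. \<gamma> t $ a) has_vector_derivative x1 t) (at t) \<and>
     (x1 has_vector_derivative x2 t) (at t) \<and> cross2 (x1 t) (x2 t) \<noteq> 0"
proof -
  let ?I = "{c<..<d}"
  define v1 where "v1 t = vector_derivative \<gamma> (at t)" for t
  define v2 where "v2 t = vector_derivative v1 (at t)" for t
  have v1: "(\<gamma> has_vector_derivative v1 t) (at t)" if "t \<in> ?I" for t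
  proof -
    have "\<gamma> differentiable (at t)" using \<gamma> that unfolding smooth_on_def by (metis iter_deriv.simps(1) lists.Nil)
    then show ?thesis by (simp add: v1_def vector_derivative_works)
  qed
  have v1': "frechet_derivative \<gamma> (at t) 1 = v1 t" if "t \<in> ?I" for t
    using frechet_derivative_at[OF v1[OF that, unfolded has_vector_derivative_def]] by (metis scaleR_one)
  have v2: "(v1 has_vector_derivative v2 t) (at t)" if t: "t \<in> ?I" for t
  proof -
    have "[1] \<in> lists (Basis :: real set)" by simp
    then have "iter_deriv [1] \<gamma> differentiable (at t)" using \<gamma> t unfolding smooth_on_def by blast
    then have "(\<lambda>t. frechet_derivative \<gamma> (at t) 1) differentiable (at t)" by simp
    then obtain D where "((\<lambda>t. frechet_derivative \<gamma> (at t) 1) has_derivative D) (at t)" unfolding differentiable_def by blast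
    then have "(v1 has_derivative D) (at t)"
      by (rule has_derivative_transform_within_open[of _ _ _ _ ?I]) (use t v1' in auto)
    then have "v1 differentiable (at t)" unfolding differentiable_def by blast
    then show ?thesis by (simp add: v2_def vector_derivative_works)
  qed
  have comp: "((\<lambda>t. f t $ a) has_vector_derivative f' $ a) (at t)"
    if "(f has_vector_derivative f') (at t)" for f :: "real \<Rightarrow> (real^2)^3" and f' t
    using bounded_linear.has_vector_derivative[OF bounded_linear_vec_nth that] .
  have emb': "((\<lambda>t. emb a j (f t) 0) has_vector_derivative emb a j f' 0) (at t)"
    if "(f has_vector_derivative f') (at t)" for f :: "real \<Rightarrow> real^2" and f' t
  proof -
    have "bounded_linear (\<lambda>z. emb a j z 0)"
      unfolding linear_conv_bounded_linear[symmetric]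
      by (rule linearI) (simp_all add: emb_partial_linear)
    from bounded_linear.has_vector_derivative[OF this that] show ?thesis .
  qed
  have e\<gamma>: "\<gamma> t = emb a j (\<gamma> t $ a) 0 + emb a j 0 \<xi>" if "t \<in> ?I" for t
    using Gamma_eq_emb[of "\<gamma> t" a j] slice[OF that] ne by (simp add: coordinate_slice_def emb_add[symmetric])
  have e1: "v1 t = emb a j (v1 t $ a) 0" if t: "t \<in> ?I" for t
  proof -
    have "((\<lambda>t. emb a j (\<gamma> t $ a) 0 + emb a j 0 \<xi>) has_vector_derivative emb a j (v1 t $ a) 0) (at t)"
      using has_vector_derivative_add[OF emb'[OF comp[OF v1[OF t]]] has_vector_derivative_const] by simp
    then have "(\<gamma> has_vector_derivative emb a j (v1 t $ a) 0) (at t)"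
      by (rule has_vector_derivative_transform_within_open[of _ _ _ ?I]) (use t e\<gamma>[symmetric] in auto)
    with v1[OF t] show ?thesis by (rule vector_derivative_unique_at)
  qed
  have e2: "v2 t = emb a j (v2 t $ a) 0" if t: "t \<in> ?I" for t
  proof -
    have "(v1 has_vector_derivative emb a j (v2 t $ a) 0) (at t)"
      by (rule has_vector_derivative_transform_within_open[OF emb'[OF comp[OF v2[OF t]]], of ?I]) (use t e1[symmetric] in auto)
    with v2[OF t] show ?thesis by (rule vector_derivative_unique_at)
  qed
  have cr: "cross2 (v1 t $ a) (v2 t $ a) \<noteq> 0" if t: "t \<in> ?I" for t
  proof
    assume 0: "cross2 (v1 t $ a) (v2 t $ a) = 0"
    have i: "v1 t \<bullet> v1 t = 2 * ((v1 t $ a) \<bullet> (v1 t $ a))" "v2 t \<bullet> v2 t = 2 * ((v2 t $ a) \<bullet> (v2 t $ a))"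
      "v1 t \<bullet> v2 t = 2 * ((v1 t $ a) \<bullet> (v2 t $ a))"
      using inner_emb_0[OF ne] e1[OF t] e2[OF t] by metis+
    have "(norm (v1 t))\<^sup>2 * (norm (v2 t))\<^sup>2 - (v1 t \<bullet> v2 t)\<^sup>2 = 4 * (cross2 (v1 t $ a) (v2 t $ a))\<^sup>2"
      unfolding power2_norm_eq_inner i
      by (simp add: cross2_def inner_vec_def[where 'b = 2] sum_2 power2_eq_square algebra_simps)
    then have "curvature \<gamma> t = 0"
      using 0 by (simp add: curvature_def Let_def v1_def[symmetric] v2_def[symmetric] v1_def[abs_def, symmetric])
    with curv[OF t] show False by simp
  qed
  show ?thesis
    using comp[OF v1] comp[OF v2] cr by (intro exI[of _ "\<lambda>t. v1 t $ a"] exI[of _ "\<lambda>t. v2 t $ a"]) auto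
qed

text \<open>The interface between geometry and analysis: points of a common slice whose normals have
  all slopes \<open>t\<close>, uniform bounds, and membership in \<open>D\<close> decided by the
  tangent half-space after magnification. The slice at \<open>\<eta>\<close> may differ from the one
  at \<open>\<xi>\<close>.\<close>

lemma boundary_directions:
  assumes ne: "a \<noteq> j" and piece: "smooth_boundary_piece D U"
    and curve: "curve_of_nonzero_curvature (bdry D \<inter> U \<inter> coordinate_slice j \<xi>)"
  shows "\<exists>\<eta> w0 w1 c M \<alpha> m s. cross2 w0 w1 \<noteq> 0 \<and> 0 < c \<and> inj_on \<alpha> {0..1::real} \<and>
    (\<forall>t\<in>{0..1}. c \<le> s t \<and> norm (m t) \<le> M \<and>
      (\<forall>z e. (s t *\<^sub>R (w0 + t *\<^sub>R w1)) \<bullet> z + m t \<bullet> e \<noteq> 0 \<longrightarrow>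
        (\<forall>\<^sub>F k in sequentially. emb a j (\<alpha> t + (1 / real k) *\<^sub>R z) (\<eta> + (1 / real k) *\<^sub>R e) \<in> D \<longleftrightarrow>
           (s t *\<^sub>R (w0 + t *\<^sub>R w1)) \<bullet> z + m t \<bullet> e < 0)))"
proof -
  let ?M = "bdry D \<inter> U \<inter> coordinate_slice j \<xi>"
  obtain q where q: "q \<in> ?M" using curve unfolding curve_of_nonzero_curvature_def by blast
  then obtain W c d \<gamma> g where W: "open W" "q \<in> W" "c < d" and \<gamma>: "smooth_on {c<..<d} \<gamma>"
    and hom: "homeomorphism {c<..<d} (?M \<inter> W) \<gamma> g" and curv: "\<And>t. t \<in> {c<..<d} \<Longrightarrow> curvature \<gamma> t \<noteq> 0"
  proof -
    from curve q have "\<exists>W c d \<gamma> g. open W \<and> q \<in> W \<and> c < d \<and>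
        smooth_on {c<..<d} \<gamma> \<and> homeomorphism {c<..<d} (?M \<inter> W) \<gamma> g \<and>
        (\<forall>t\<in>{c<..<d}. vector_derivative \<gamma> (at t) \<noteq> 0 \<and> curvature \<gamma> t \<noteq> 0)"
      unfolding curve_of_nonzero_curvature_def by (elim conjE bspec)
    then show ?thesis by (elim exE conjE) (rule that, assumption+, blast)
  qed
  obtain V and \<rho> :: "(real^2)^3 \<Rightarrow> real" where V: "open V" "q \<in> V" and \<rho>: "smooth_on V \<rho>"
    and reg: "\<forall>\<xi> \<in> bdry D \<inter> U \<inter> V. \<exists>v\<in>\<Gamma>. frechet_derivative \<rho> (at \<xi>) v \<noteq> 0"
    and bd: "bdry D \<inter> U \<inter> V = {\<xi> \<in> \<Gamma> \<inter> V. \<rho> \<xi> = 0}" and D: "D \<inter> V = {\<xi> \<in> \<Gamma> \<inter> V. \<rho> \<xi> < 0}"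
  proof -
    have "q \<in> bdry D \<inter> U" using q by blast
    with piece have "\<exists>V (\<rho> :: (real^2)^3 \<Rightarrow> real). open V \<and> q \<in> V \<and> smooth_on V \<rho> \<and>
        (\<forall>\<xi> \<in> bdry D \<inter> U \<inter> V. \<exists>v\<in>\<Gamma>. frechet_derivative \<rho> (at \<xi>) v \<noteq> 0) \<and>
        bdry D \<inter> U \<inter> V = {\<xi> \<in> \<Gamma> \<inter> V. \<rho> \<xi> = 0} \<and>
        D \<inter> V = {\<xi> \<in> \<Gamma> \<inter> V. \<rho> \<xi> < 0}"
      unfolding smooth_boundary_piece_def by (rule bspec)
    then show ?thesis by (elim exE conjE) (rule that)
  qed
  let ?O = "{w. emb a j (fst w) (snd w) \<in> V}" and ?r = "\<lambda>z e. \<rho> (emb a j z e)"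
  obtain n m where "hypersurface ?O ?r n m"
    using hypersurface_of_boundary[OF ne V(1) \<rho>] reg bd by blast
  then interpret hypersurface ?O ?r n m .
  have \<gamma>M: "\<gamma> t \<in> ?M \<inter> W" if "t \<in> {c<..<d}" for t using hom that unfolding homeomorphism_def by blast
  have M\<Gamma>: "?M \<subseteq> \<Gamma>" using frontier_of_subset_topspace[of "top_of_set \<Gamma>" D] by auto
  obtain x1 x2 where x12: "\<And>t. t \<in> {c<..<d} \<Longrightarrow> ((\<lambda>t. \<gamma> t $ a) has_vector_derivative x1 t) (at t)"
     "\<And>t. t \<in> {c<..<d} \<Longrightarrow> (x1 has_vector_derivative x2 t) (at t)" "\<And>t. t \<in> {c<..<d} \<Longrightarrow> cross2 (x1 t) (x2 t) \<noteq> 0"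
    using slice_curve[OF ne \<gamma> _ curv, of \<xi>] \<gamma>M M\<Gamma> by blast
  define x where "x t = \<gamma> t $ a" for t
  have ex: "emb a j (x t) \<xi> = \<gamma> t" if "t \<in> {c<..<d}" for t
    using Gamma_eq_emb[of "\<gamma> t" a j] \<gamma>M[OF that] M\<Gamma> ne by (auto simp: x_def coordinate_slice_def)
  define t0 where "t0 = g q"
  have t0: "t0 \<in> {c<..<d}" "\<gamma> t0 = q" using hom q W unfolding t0_def homeomorphism_def by auto
  have "continuous_on {c<..<d} \<gamma>" using hom by (simp add: homeomorphism_def)
  then have "open ({c<..<d} \<inter> \<gamma> -` V)" by (rule continuous_open_preimage[OF _ open_greaterThanLessThan V(1)])
  moreover have "t0 \<in> {c<..<d} \<inter> \<gamma> -` V" using t0 V by simp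
  ultimately obtain \<epsilon>0 where \<epsilon>0: "0 < \<epsilon>0" "ball t0 \<epsilon>0 \<subseteq> {c<..<d} \<inter> \<gamma> -` V" using open_contains_ball by metis
  let ?J = "{t0 - \<epsilon>0<..<t0 + \<epsilon>0}"
  have J: "t \<in> {c<..<d} \<and> \<gamma> t \<in> V" if "t \<in> ?J" for t
  proof -
    have "t \<in> ball t0 \<epsilon>0" using that by (auto simp: dist_real_def)
    with \<epsilon>0 show ?thesis by blast
  qed
  have t0J: "t0 \<in> ?J" using \<epsilon>0 by simp
  have on: "(x t, \<xi>) \<in> ?O \<and> ?r (x t) \<xi> = 0" if "t \<in> ?J" for t
    using J[OF that] ex[of t] \<gamma>M[of t] bd by auto
  have dx: "(x has_vector_derivative x1 t) (at t)" if "t \<in> ?J" for t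
    using x12(1) J[OF that] by (simp add: x_def[abs_def])
  \<comment> \<open>The inverse \<open>g\<close> of the parametrisation is continuous, so points of
    the slice near \<open>q\<close> have parameters near \<open>t0\<close>; this excludes further
    branches through \<open>q\<close>.\<close>
  have only: "\<exists>\<rho>>0. \<forall>z. dist z (x t0) < \<rho> \<and> (z, \<xi>) \<in> ?O \<and> ?r z \<xi> = 0 \<longrightarrow> (\<exists>t. \<bar>t - t0\<bar> < \<epsilon> \<and> z = x t)" if "0 < \<epsilon>" for \<epsilon>
  proof -
    have "continuous_on (?M \<inter> W) g" using hom by (simp add: homeomorphism_def)
    then obtain \<delta> where \<delta>: "0 < \<delta>" "\<And>p. p \<in> ?M \<inter> W \<Longrightarrow> dist p q < \<delta> \<Longrightarrow> dist (g p) (g q) < \<epsilon>"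
    proof -
      have "q \<in> ?M \<inter> W" using q W by blast
      from bspec[OF \<open>continuous_on (?M \<inter> W) g\<close>[unfolded continuous_on_iff] this] \<open>0 < \<epsilon>\<close>
      have "\<exists>\<delta>>0. \<forall>p\<in>?M \<inter> W. dist p q < \<delta> \<longrightarrow> dist (g p) (g q) < \<epsilon>" by simp
      with that show ?thesis by (elim exE conjE) simp
    qed
    obtain \<delta>' where \<delta>': "0 < \<delta>'" "ball q \<delta>' \<subseteq> W" using W open_contains_ball by metis
    have "continuous_on UNIV (\<lambda>z. emb a j z \<xi>)" by (intro continuous_intros)
    then have "isCont (\<lambda>z. emb a j z \<xi>) (x t0)" by (simp add: continuous_on_eq_continuous_at)
    moreover have "emb a j (x t0) \<xi> = q" using ex t0 by simp
    ultimately obtain \<rho>0 where \<rho>0: "0 < \<rho>0" "\<And>z. dist z (x t0) < \<rho>0 \<Longrightarrow> dist (emb a j z \<xi>) q < min \<delta> \<delta>'"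
      unfolding continuous_at_eps_delta using \<delta>(1) \<delta>'(1) by (metis min_less_iff_conj)
    have "\<exists>t. \<bar>t - t0\<bar> < \<epsilon> \<and> z = x t" if z: "dist z (x t0) < \<rho>0" "(z, \<xi>) \<in> ?O" "?r z \<xi> = 0" for z
    proof -
      let ?p = "emb a j z \<xi>"
      have p: "dist ?p q < \<delta>" "?p \<in> W" using \<rho>0(2)[OF z(1)] \<delta>' by (auto simp: dist_commute)
      have "?p \<in> bdry D \<inter> U \<inter> V" unfolding bd using z emb_in_Gamma[OF ne] by simp
      then have pM: "?p \<in> ?M \<inter> W" using p ne by (simp add: coordinate_slice_def emb_components)
      have "dist (g ?p) t0 < \<epsilon>" using \<delta>(2)[OF pM p(1)] by (simp add: t0_def)
      moreover have "x (g ?p) = z" using hom pM by (simp add: homeomorphism_def x_def emb_components)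
      ultimately show ?thesis by (intro exI[of _ "g ?p"]) (auto simp: dist_real_def)
    qed
    with \<rho>0(1) show ?thesis by blast
  qed
  have "\<exists>\<eta>. turning \<eta>"
  proof (cases "n (x t0) \<xi> = 0")
    case True
    show ?thesis
      by (rule turning_of_tangent_point[OF t0J on dx x12(2) x12(3) only True]) (use t0 in auto)
  next
    case False
    have "turning \<xi>"
      by (rule turning_of_regular_point[OF t0J on dx x12(2) x12(3) False]) (use t0 in auto)
    then show ?thesis ..
  qed
  then obtain \<eta> where "turning \<eta>" ..
  from turning_directions[OF this] obtain w0 w1 c' M' \<alpha> s where
    *: "cross2 w0 w1 \<noteq> 0" "0 < c'" "inj_on \<alpha> {0..1::real}"
    and t: "\<And>t. t \<in> {0..1} \<Longrightarrow> (\<alpha> t, \<eta>) \<in> ?O \<and> ?r (\<alpha> t) \<eta> = 0 \<and> n (\<alpha> t) \<eta> = s t *\<^sub>R (w0 + t *\<^sub>R w1) \<and>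
       c' \<le> s t \<and> norm (m (\<alpha> t) \<eta>) \<le> M'"
    by blast
  have "\<forall>\<^sub>F k in sequentially. emb a j (\<alpha> t + (1 / real k) *\<^sub>R z) (\<eta> + (1 / real k) *\<^sub>R e) \<in> D \<longleftrightarrow>
           (s t *\<^sub>R (w0 + t *\<^sub>R w1)) \<bullet> z + m (\<alpha> t) \<eta> \<bullet> e < 0"
    if "t \<in> {0..1}" "(s t *\<^sub>R (w0 + t *\<^sub>R w1)) \<bullet> z + m (\<alpha> t) \<eta> \<bullet> e \<noteq> 0" for t z e
  proof -
    have n: "n (\<alpha> t) \<eta> = s t *\<^sub>R (w0 + t *\<^sub>R w1)" using t[OF that(1)] by blast
    have "\<forall>\<^sub>F k in sequentially. (\<alpha> t + (1 / real k) *\<^sub>R z, \<eta> + (1 / real k) *\<^sub>R e) \<in> ?O \<and>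
      (?r (\<alpha> t + (1 / real k) *\<^sub>R z) (\<eta> + (1 / real k) *\<^sub>R e) < 0 \<longleftrightarrow> n (\<alpha> t) \<eta> \<bullet> z + m (\<alpha> t) \<eta> \<bullet> e < 0)"
      using t[OF that(1)] that(2) unfolding n[symmetric] by (intro blow_up_sign) auto
    then show ?thesis
    proof eventually_elim
      case (elim k)
      let ?p = "emb a j (\<alpha> t + (1 / real k) *\<^sub>R z) (\<eta> + (1 / real k) *\<^sub>R e)"
      have "?p \<in> \<Gamma> \<inter> V" using elim emb_in_Gamma[OF ne] by simp
      then have "?p \<in> D \<longleftrightarrow> \<rho> ?p < 0" using D by blast
      with elim show ?case by (simp add: n)
    qed
  qed
  with * t show ?thesis
    by (intro exI[of _ \<eta>] exI[of _ w0] exI[of _ w1] exI[of _ c'] exI[of _ M'] exI[of _ \<alpha>]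
        exI[of _ "\<lambda>t. m (\<alpha> t) \<eta>"] exI[of _ s]) blast
qed

subsection \<open>Norms of the test functions\<close>

lemma packets_sum:
  assumes "finite I" "I \<noteq> {}" "\<And>i. i \<in> I \<Longrightarrow> f i \<in> packets"
  shows "(\<lambda>x. \<Sum>i\<in>I. f i x) \<in> packets"
  using assms by (induction rule: finite_ne_induct) (simp_all add: packets.sum)

lemma fourier_sum:
  assumes "\<And>i. i \<in> I \<Longrightarrow> integrable lborel (f i)"
  shows "fourier (\<lambda>x. \<Sum>i\<in>I. f i x) \<xi> = (\<Sum>i\<in>I. fourier (f i) \<xi>)"
  unfolding fourier_eq sum_distrib_right
  by (intro Bochner_Integration.integral_sum integrable_mult_unit_wave assms) auto

lemma Lp_norm_scaleR:
  fixes f :: "real^2 \<Rightarrow> complex"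
  assumes "0 < c"
  shows "Lp_norm p (\<lambda>x. f (c *\<^sub>R x)) = (1 / c\<^sup>2) powr (1 / p) * Lp_norm p f"
proof -
  have "(LINT x|lborel. norm (f (0 + c *\<^sub>R x)) powr p) = (1 / \<bar>c\<bar> ^ DIM(real^2)) *\<^sub>R (LINT x|lborel. norm (f x) powr p)"
    using assms by (intro integral_lborel_affine) auto
  then show ?thesis
    using assms by (simp add: Lp_norm_def powr_mult[symmetric])
qed

lemma Lp_norm_nonneg: "0 \<le> Lp_norm p f"
  by (simp add: Lp_norm_def)

text \<open>Splitting at height \<open>K\<close> replaces Hoelder's inequality for functions with small support.\<close>

lemma integral_powr_le_of_small_support:
  fixes f :: "real^2 \<Rightarrow> complex"
  assumes [measurable]: "f \<in> borel_measurable borel" and f2: "integrable lborel (\<lambda>x. (norm (f x))\<^sup>2)"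
    and E: "E \<in> sets borel" "emeasure lborel E \<le> ennreal \<epsilon>" "0 \<le> \<epsilon>" and supp: "\<And>x. f x \<noteq> 0 \<Longrightarrow> x \<in> E"
    and p: "0 < p" "p < 2" and K: "0 < K"
  shows "(LINT x|lborel. norm (f x) powr p) \<le> K powr (p - 2) * (LINT x|lborel. (norm (f x))\<^sup>2) + K powr p * \<epsilon>"
proof -
  have le: "norm (f x) powr p \<le> K powr (p - 2) * (norm (f x))\<^sup>2 + K powr p * indicator E x" for x
  proof (cases "f x = 0")
    case False
    show ?thesis
    proof (cases "norm (f x) \<le> K")
      case True
      then have "norm (f x) powr p \<le> K powr p" using p by (intro powr_mono2) auto
      with supp[OF False] show ?thesis by (simp add: add_increasing)
    next
      case False': False
      have "norm (f x) powr p = norm (f x) powr ((p - 2) + 2)" by simp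
      also have "\<dots> = norm (f x) powr (p - 2) * norm (f x) powr 2" by (rule powr_add)
      also have "\<dots> = norm (f x) powr (p - 2) * (norm (f x))\<^sup>2" using False by simp
      also have "\<dots> \<le> K powr (p - 2) * (norm (f x))\<^sup>2"
        using False' K p by (intro mult_right_mono powr_mono2') auto
      finally show ?thesis using K by (simp add: add_increasing2)
    qed
  qed (use p in simp)
  have Ef: "emeasure lborel E < \<infinity>" using E(2) by (simp add: ennreal_less_top le_less_trans)
  have iE: "integrable lborel (indicator E :: _ \<Rightarrow> real)" using E Ef by (intro integrable_real_indicator) auto
  have "(LINT x|lborel. norm (f x) powr p) \<le> (LINT x|lborel. K powr (p - 2) * (norm (f x))\<^sup>2 + K powr p * indicator E x)"
    by (intro integral_mono' Bochner_Integration.integrable_add integrable_mult_right f2 iE le) auto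
  also have "\<dots> = K powr (p - 2) * (LINT x|lborel. (norm (f x))\<^sup>2) + K powr p * measure lborel E"
    using f2 iE E by (subst Bochner_Integration.integral_add) auto
  also have "measure lborel E \<le> \<epsilon>"
    using E Ef by (metis emeasure_eq_ennreal_measure ennreal_le_iff infinity_ennreal_def less_irrefl)
  finally show ?thesis by (simp add: mult_left_mono)
qed

text \<open>Inverting only the second tile turns the integral into a pairing of its transform at
  \<open>\<xi>\<close> with that of the first at \<open>- \<xi> - k v\<close>. The latter tends to 0
  pointwise and is bounded, while the former is integrable.\<close>

lemma tile_product_decay:
  assumes "cross2 p q \<noteq> 0" "cross2 p' q' \<noteq> 0" "v \<noteq> 0"
  shows "(\<lambda>k. LINT x|lborel. of_real (tile p r q s x * tile p' r' q' s' x) * unit_wave (real k *\<^sub>R v) x) \<longlonglongrightarrow> 0"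
proof -
  let ?f = "\<lambda>x. of_real (tile p r q s x) :: complex" and ?g = "\<lambda>x. of_real (tile p' r' q' s' x) :: complex"
  have f: "integrable lborel ?f" "integrable lborel (tile p r q s)" using integrable_tile[OF assms(1)] by simp_all
  have g: "integrable lborel (fourier ?g)" by (rule integrable_fourier_tile[OF assms(2)])
  have [measurable]: "fourier ?g \<in> borel_measurable borel" "fourier ?f \<in> borel_measurable borel" by (intro borel_measurable_fourier; measurable)+
  have eq: "(LINT x|lborel. of_real (tile p r q s x * tile p' r' q' s' x) * unit_wave w x) = (LINT \<xi>|lborel. fourier ?g \<xi> * fourier ?f (- \<xi> - w))" for w
  proof -
    let ?F = "\<lambda>x \<xi>. ?f x * unit_wave w x * (fourier ?g \<xi> * unit_wave x \<xi>)"
    have int: "integrable (lborel \<Otimes>\<^sub>M lborel) (\<lambda>(x, \<xi>). ?F x \<xi>)"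
    proof (rule Bochner_Integration.integrable_bound)
      show "integrable (lborel \<Otimes>\<^sub>M lborel) (\<lambda>(x, \<xi>). ?f x * fourier ?g \<xi>)"
        by (rule integrable_lborel_times[OF f(1) g])
    qed (auto simp: norm_mult)
    have "(LINT x|lborel. of_real (tile p r q s x * tile p' r' q' s' x) * unit_wave w x) = (LINT x|lborel. LINT \<xi>|lborel. ?F x \<xi>)"
      by (simp only: integral_mult_right_zero fourier_tile_inversion[OF assms(2)]) (simp add: mult_ac)
    also have "\<dots> = (LINT \<xi>|lborel. LINT x|lborel. ?F x \<xi>)" by (rule lborel_pair.Fubini_integral[OF int, symmetric])
    also have "\<dots> = (LINT \<xi>|lborel. fourier ?g \<xi> * fourier ?f (- \<xi> - w))"
    proof (rule Bochner_Integration.integral_cong[OF refl])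
      fix \<xi>
      have "?F x \<xi> = fourier ?g \<xi> * (?f x * unit_wave (- (- \<xi> - w)) x)" for x
        by (simp add: unit_wave_add unit_wave_commute[of x] mult_ac)
      then have "(LINT x|lborel. ?F x \<xi>) = (LINT x|lborel. fourier ?g \<xi> * (?f x * unit_wave (- (- \<xi> - w)) x))" by (simp only:)
      also have "\<dots> = fourier ?g \<xi> * fourier ?f (- \<xi> - w)" unfolding fourier_eq[of ?f] by (rule integral_mult_right_zero)
      finally show "(LINT x|lborel. ?F x \<xi>) = fourier ?g \<xi> * fourier ?f (- \<xi> - w)" .
    qed
    finally show ?thesis .
  qed
  have "(\<lambda>k. LINT \<xi>|lborel. fourier ?g \<xi> * fourier ?f (- \<xi> - real k *\<^sub>R v)) \<longlonglongrightarrow> (LINT \<xi>|(lborel :: (real^2) measure). (0::complex))"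
  proof (rule integral_dominated_convergence[where w = "\<lambda>\<xi>. norm (fourier ?g \<xi>) * (LINT x|lborel. norm (?f x))"])
    show "AE \<xi> in lborel. (\<lambda>k. fourier ?g \<xi> * fourier ?f (- \<xi> - real k *\<^sub>R v)) \<longlonglongrightarrow> 0"
    proof (rule AE_I2)
      fix \<xi>
      have "(\<lambda>k. fourier ?f (- \<xi> + real k *\<^sub>R (- v))) \<longlonglongrightarrow> 0"
        by (rule fourier_tile_tendsto_0[OF assms(1)]) (use assms(3) in simp)
      from tendsto_mult_right_zero[OF this, of "fourier ?g \<xi>"]
      show "(\<lambda>k. fourier ?g \<xi> * fourier ?f (- \<xi> - real k *\<^sub>R v)) \<longlonglongrightarrow> 0" by simp
    qed
    show "AE \<xi> in lborel. norm (fourier ?g \<xi> * fourier ?f (- \<xi> - real k *\<^sub>R v)) \<le> norm (fourier ?g \<xi>) * (LINT x|lborel. norm (?f x))" for k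
      unfolding norm_mult by (intro AE_I2 mult_left_mono norm_fourier_le f) auto
    show "integrable lborel (\<lambda>\<xi>. norm (fourier ?g \<xi>) * (LINT x|lborel. norm (?f x)))"
      by (intro integrable_mult_left integrable_norm g)
  qed measurable
  then show ?thesis unfolding eq by simp
qed

text \<open>In the expanded square the off-diagonal terms carry the frequencies
  \<open>k (\<alpha> i - \<alpha> l)\<close> and die out: in the limit the packets are orthogonal
  however much the tiles overlap. This stands in for random signs.\<close>

lemma tile_sum_L2_limit:
  fixes p q :: "'i \<Rightarrow> real^2" and r s :: "'i \<Rightarrow> real"
  assumes fin: "finite I" and c: "\<And>i. i \<in> I \<Longrightarrow> cross2 (p i) (q i) \<noteq> 0" and inj: "inj_on \<alpha> I"
  defines "T \<equiv> \<lambda>i. tile (p i) (r i) (q i) (s i)"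
  shows "(\<lambda>k. LINT x|lborel. (norm (\<Sum>i\<in>I. of_real (T i x) * unit_wave (real k *\<^sub>R \<alpha> i) x))\<^sup>2) \<longlonglongrightarrow> (\<Sum>i\<in>I. LINT x|lborel. (T i x)\<^sup>2)"
    and "integrable lborel (\<lambda>x. (norm (\<Sum>i\<in>I. of_real (T i x) * unit_wave (real k *\<^sub>R \<alpha> i) x))\<^sup>2)"
proof -
  let ?P = "\<lambda>k i l x. of_real (T i x * T l x) * unit_wave (real k *\<^sub>R (\<alpha> i - \<alpha> l)) x :: complex"
  have Tm[measurable]: "T i \<in> borel_measurable borel" for i unfolding T_def by measurable
  have TT: "integrable lborel (\<lambda>x. T i x * T l x)" if "i \<in> I" "l \<in> I" for i l
    by (rule Bochner_Integration.integrable_bound[OF integrable_tile[OF c[OF that(1)], of "r i" "s i"]])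
      (auto simp: T_def abs_mult tile_nonneg tile_le_1 mult_left_le)
  have Pi: "integrable lborel (?P k i l)" if "i \<in> I" "l \<in> I" for k i l
    by (intro integrable_mult_unit_wave integrable_of_real TT that) auto
  have sq: "of_real ((norm (\<Sum>i\<in>I. of_real (T i x) * unit_wave (real k *\<^sub>R \<alpha> i) x))\<^sup>2) = (\<Sum>i\<in>I. \<Sum>l\<in>I. ?P k i l x)" for k x
  proof -
    let ?S = "\<Sum>i\<in>I. of_real (T i x) * unit_wave (real k *\<^sub>R \<alpha> i) x"
    have "cnj (unit_wave \<beta> x) = unit_wave (- \<beta>) x" for \<beta>
      by (simp add: unit_wave_def exp_cnj)
    then have "cnj ?S = (\<Sum>l\<in>I. of_real (T l x) * unit_wave (- (real k *\<^sub>R \<alpha> l)) x)" by simp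
    then have "of_real ((norm ?S)\<^sup>2) = ?S * (\<Sum>l\<in>I. of_real (T l x) * unit_wave (- (real k *\<^sub>R \<alpha> l)) x)"
      using complex_norm_square[of ?S] by simp
    also have "\<dots> = (\<Sum>i\<in>I. \<Sum>l\<in>I. ?P k i l x)"
      unfolding sum_product
    proof (intro sum.cong refl)
      fix i l
      have "real k *\<^sub>R (\<alpha> i - \<alpha> l) = real k *\<^sub>R \<alpha> i + - (real k *\<^sub>R \<alpha> l)" by (simp add: scaleR_diff_right)
      then show "of_real (T i x) * unit_wave (real k *\<^sub>R \<alpha> i) x * (of_real (T l x) * unit_wave (- (real k *\<^sub>R \<alpha> l)) x) = ?P k i l x"
        by (simp only: unit_wave_add of_real_mult mult_ac)
    qed
    finally show ?thesis .
  qed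
  have "integrable lborel (\<lambda>x. complex_of_real ((norm (\<Sum>i\<in>I. of_real (T i x) * unit_wave (real k *\<^sub>R \<alpha> i) x))\<^sup>2))" for k
    unfolding sq by (intro Bochner_Integration.integrable_sum Pi)
  then show int: "integrable lborel (\<lambda>x. (norm (\<Sum>i\<in>I. of_real (T i x) * unit_wave (real k *\<^sub>R \<alpha> i) x))\<^sup>2)" for k
    by (simp only: complex_of_real_integrable_eq)
  have I: "of_real (LINT x|lborel. (norm (\<Sum>i\<in>I. of_real (T i x) * unit_wave (real k *\<^sub>R \<alpha> i) x))\<^sup>2) = (\<Sum>i\<in>I. \<Sum>l\<in>I. LINT x|lborel. ?P k i l x)" for k
  proof -
    have "complex_of_real (LINT x|lborel. (norm (\<Sum>i\<in>I. of_real (T i x) * unit_wave (real k *\<^sub>R \<alpha> i) x))\<^sup>2) = (LINT x|lborel. (\<Sum>i\<in>I. \<Sum>l\<in>I. ?P k i l x))"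
      unfolding sq[symmetric] by (rule integral_complex_of_real[symmetric])
    also have "\<dots> = (\<Sum>i\<in>I. LINT x|lborel. (\<Sum>l\<in>I. ?P k i l x))"
      by (intro Bochner_Integration.integral_sum Bochner_Integration.integrable_sum Pi)
    also have "\<dots> = (\<Sum>i\<in>I. \<Sum>l\<in>I. LINT x|lborel. ?P k i l x)"
      by (intro sum.cong refl Bochner_Integration.integral_sum Pi)
    finally show ?thesis .
  qed
  have "(\<lambda>k. LINT x|lborel. ?P k i l x) \<longlonglongrightarrow> (if i = l then of_real (LINT x|lborel. (T i x)\<^sup>2) else 0)" if il: "i \<in> I" "l \<in> I" for i l
  proof (cases "i = l")
    case True
    have "(LINT x|lborel. ?P k i i x) = of_real (LINT x|lborel. (T i x)\<^sup>2)" for k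
      unfolding integral_complex_of_real[symmetric] by (simp add: power2_eq_square)
    with True show ?thesis by simp
  next
    case False
    then have "\<alpha> i - \<alpha> l \<noteq> 0" using inj il by (auto simp: inj_on_def)
    from tile_product_decay[OF c[OF il(1)] c[OF il(2)] this] False show ?thesis by (simp add: T_def)
  qed
  then have "(\<lambda>k. \<Sum>i\<in>I. \<Sum>l\<in>I. LINT x|lborel. ?P k i l x) \<longlonglongrightarrow> (\<Sum>i\<in>I. \<Sum>l\<in>I. if i = l then of_real (LINT x|lborel. (T i x)\<^sup>2) else 0)"
    by (intro tendsto_sum)
  also have "(\<Sum>i\<in>I. \<Sum>l\<in>I. if i = l then complex_of_real (LINT x|lborel. (T i x)\<^sup>2) else 0) = of_real (\<Sum>i\<in>I. LINT x|lborel. (T i x)\<^sup>2)"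
    using fin by simp
  finally show "(\<lambda>k. LINT x|lborel. (norm (\<Sum>i\<in>I. of_real (T i x) * unit_wave (real k *\<^sub>R \<alpha> i) x))\<^sup>2) \<longlonglongrightarrow> (\<Sum>i\<in>I. LINT x|lborel. (T i x)\<^sup>2)"
    unfolding I[symmetric] by (simp only: tendsto_of_real_iff)
qed

section \<open>Sizes of tiles and their interaction\<close>

lemma tile_nonzero: "tile p r q s x \<noteq> 0 \<Longrightarrow> p \<bullet> x + r \<in> {0<..<1} \<and> q \<bullet> x + s \<in> {0<..<1}"
  by (auto simp: tile_def not_less not_le intro: ccontr bump_eq_0)

lemma integral_tile_le:
  assumes "cross2 p q \<noteq> 0"
  shows "(LINT x|lborel. tile p r q s x) \<le> 1 / \<bar>cross2 p q\<bar>"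
proof -
  let ?S = "{x. p \<bullet> x \<in> {- r..1 - r} \<and> q \<bullet> x \<in> {- s..1 - s}}"
  have e: "emeasure lborel ?S = ennreal (1 / \<bar>cross2 p q\<bar>)"
    using emeasure_cross2[OF assms, of "- r" "1 - r" "- s" "1 - s"] by simp
  have "closed ?S" by (auto intro!: closed_Collect_conj closed_Collect_le continuous_intros)
  then have S: "?S \<in> sets borel" by simp
  have "(LINT x|lborel. tile p r q s x) \<le> (LINT x|lborel. indicator ?S x)"
  proof (rule integral_mono')
    show "integrable lborel (indicator ?S :: _ \<Rightarrow> real)" using S e by (intro integrable_real_indicator) auto
    show "tile p r q s x \<le> indicator ?S x" for x
      using tile_le_1[of p r q s x] tile_nonzero[of p r q s x] by (cases "tile p r q s x = 0") (auto simp: indicator_def)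
  qed auto
  also have "\<dots> = 1 / \<bar>cross2 p q\<bar>" using S e by (simp add: measure_def)
  finally show ?thesis .
qed

lemma integral_tile_square_le:
  assumes "cross2 p q \<noteq> 0"
  shows "(LINT x|lborel. (tile p r q s x)\<^sup>2) \<le> 1 / \<bar>cross2 p q\<bar>"
proof (rule order_trans[OF _ integral_tile_le[OF assms, of r s]])
  show "(LINT x|lborel. (tile p r q s x)\<^sup>2) \<le> (LINT x|lborel. tile p r q s x)"
    by (rule integral_mono'[OF integrable_tile[OF assms]])
      (auto simp: tile_nonneg tile_le_1 power2_eq_square mult_left_le)
qed

lemma scaled_tile_in_packets:
  assumes "cross2 p q \<noteq> 0" "c \<noteq> 0"
  shows "(\<lambda>x. of_real (tile p r q s (c *\<^sub>R x)) * unit_wave \<alpha> (c *\<^sub>R x)) \<in> packets"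
  using tile_in_packets[of "c *\<^sub>R p" "c *\<^sub>R q" 1 r s "c *\<^sub>R \<alpha>"] assms
  by (simp add: cross2_scaleR tile_scaleR unit_wave_scaleR)

lemma bump_lower_bound: "\<exists>\<nu>>0. \<forall>x\<in>{1 / 10..9 / 10}. \<nu> \<le> bump x"
proof -
  have "continuous_on {1 / 10..9 / 10 :: real} bump" by (intro continuous_intros)
  then obtain y where "y \<in> {1 / 10..9 / 10}" "\<And>x. x \<in> {1 / 10..9 / 10} \<Longrightarrow> bump y \<le> bump x"
    using continuous_attains_inf[of "{1 / 10..9 / 10 :: real}" bump] by auto
  then show ?thesis by (intro exI[of _ "bump y"]) (auto intro: bump_pos)
qed

text \<open>Each tile interacts with its translate along the normal direction, with the same sign for all tiles.\<close>

lemma half_space_tiles: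
  assumes c: "cross2 p q \<noteq> 0" and gc: "cross2 gp gq \<noteq> 0" and \<nu>: "0 < \<nu>" "\<And>x. x \<in> {1 / 10..9 / 10} \<Longrightarrow> \<nu> \<le> bump x"
    and n: "p \<bullet> n = \<sigma>" "0 < \<sigma>" "q \<bullet> n = 0"
    and g: "\<And>x t. p \<bullet> x \<in> {2..3} \<Longrightarrow> q \<bullet> x + d \<in> {0..1} \<Longrightarrow> t \<in> {7 / (4 * \<sigma>)..9 / (4 * \<sigma>)} \<Longrightarrow>
      \<nu>\<^sup>2 \<le> tile gp gr gq gs (x - t *\<^sub>R m)"
  shows "\<exists>X. (2 / 9) * (\<nu> ^ 6 * (4 / 25) / \<bar>cross2 p q\<bar>) \<le> X \<and>
    (LINT w|lborel. (case w of (z, e) \<Rightarrow> if n \<bullet> z + m \<bullet> e < 0 then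
        fourier (\<lambda>x. of_real (tile p 0 q d x)) z * fourier (\<lambda>x. of_real (tile gp gr gq gs x)) e *
        fourier (\<lambda>x. of_real (tile p (- 2) q d x)) (- z - e) else 0)) = - \<i> / (2 * pi) * of_real X"
proof -
  let ?F = "tile p 0 q d" and ?g = "tile gp gr gq gs" and ?H = "tile p (- 2) q d"
  let ?\<Theta> = "\<lambda>(z, e). fourier (\<lambda>x. of_real (?F x)) z * fourier (\<lambda>x. of_real (?g x)) e * fourier (\<lambda>x. of_real (?H x)) (- z - e)"
  define G where "G t = (LINT x|lborel. ?F (x - t *\<^sub>R n) * ?g (x - t *\<^sub>R m) * ?H x)" for t
  have Hi: "integrable lborel ?H" by (rule integrable_tile[OF c])
  have Hi': "integrable lborel (\<lambda>x. complex_of_real (?H x))" using Hi by simp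
  note triple = fourier_triple[OF integrable_fourier_tile[OF c] fourier_tile_inversion[OF c]
    integrable_fourier_tile[OF gc] fourier_tile_inversion[OF gc] Hi']
  have \<Theta>: "integrable lborel ?\<Theta>" by (rule triple(1))
  have GF: "fourier ?\<Theta> (t *\<^sub>R (n, m)) = of_real (G t)" for t
  proof -
    have "fourier ?\<Theta> (t *\<^sub>R (n, m)) = (LINT x|lborel. of_real (?F (x - t *\<^sub>R n)) * of_real (?g (x - t *\<^sub>R m)) * of_real (?H x))"
      by (rule triple(2))
    then show ?thesis unfolding G_def integral_complex_of_real[symmetric] by simp
  qed
  \<comment> \<open>To bring the tile over the unit interval onto the one between 2 and 3, the
    displacement \<open>t * \<sigma>\<close> must lie between 1 and 3. All such \<open>t\<close> are
    positive, which is the origin of the common sign.\<close>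
  have G0: "G t = 0" if t: "t \<notin> {1 / \<sigma><..<3 / \<sigma>}" for t
  proof -
    have "?F (x - t *\<^sub>R n) * ?H x = 0" for x
    proof (rule ccontr)
      assume "?F (x - t *\<^sub>R n) * ?H x \<noteq> 0"
      then have "p \<bullet> (x - t *\<^sub>R n) + 0 \<in> {0<..<1}" "p \<bullet> x + - 2 \<in> {0<..<1}"
        using tile_nonzero[of p 0 q d "x - t *\<^sub>R n"] tile_nonzero[of p "- 2" q d x] by auto
      then have "1 < t * \<sigma>" "t * \<sigma> < 3" by (auto simp: inner_diff_right n(1))
      then show False using t n(2) by (auto simp: field_simps)
    qed
    then have "?F (x - t *\<^sub>R n) * ?g (x - t *\<^sub>R m) * ?H x = 0" for x
      by (metis mult.assoc mult.commute mult_zero_right)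
    then show ?thesis unfolding G_def by (simp only:) simp
  qed
  have n0: "n \<noteq> 0" using n by auto
  define X where "X = (LINT t|lborel. indicator {1 / \<sigma>..3 / \<sigma>} t * (G t / t))"
  have "(LINT w|lborel. (if (n, m) \<bullet> w < 0 then ?\<Theta> w else 0)) =
    - \<i> / (2 * pi) * (LINT t|lborel. indicator {1 / \<sigma>..3 / \<sigma>} t *\<^sub>R (fourier ?\<Theta> (t *\<^sub>R (n, m)) / t))"
    by (rule half_space_integral[OF \<Theta>]) (use n0 n(2) G0 GF in \<open>auto simp: zero_prod_def\<close>)
  also have "(LINT t|lborel. indicator {1 / \<sigma>..3 / \<sigma>} t *\<^sub>R (fourier ?\<Theta> (t *\<^sub>R (n, m)) / t)) = of_real X"
    unfolding GF X_def integral_complex_of_real[symmetric] by (simp add: scaleR_conv_of_real)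
  also have "(LINT w|lborel. (if (n, m) \<bullet> w < 0 then ?\<Theta> w else 0)) =
    (LINT w|lborel. (case w of (z, e) \<Rightarrow> if n \<bullet> z + m \<bullet> e < 0 then
        fourier (\<lambda>x. of_real (?F x)) z * fourier (\<lambda>x. of_real (?g x)) e * fourier (\<lambda>x. of_real (?H x)) (- z - e) else 0))"
    by (intro Bochner_Integration.integral_cong) (auto simp: inner_prod_def)
  finally have eq: "(LINT w|lborel. (case w of (z, e) \<Rightarrow> if n \<bullet> z + m \<bullet> e < 0 then
        fourier (\<lambda>x. of_real (?F x)) z * fourier (\<lambda>x. of_real (?g x)) e * fourier (\<lambda>x. of_real (?H x)) (- z - e) else 0)) = - \<i> / (2 * pi) * of_real X" .
  define \<kappa> where "\<kappa> = \<nu> ^ 6 * (4 / 25) / \<bar>cross2 p q\<bar>"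
  have \<kappa>0: "0 \<le> \<kappa>" using \<nu> by (simp add: \<kappa>_def)
  have int: "integrable lborel (\<lambda>x. ?F (x - t *\<^sub>R n) * ?g (x - t *\<^sub>R m) * ?H x)" for t
    by (rule Bochner_Integration.integrable_bound[OF Hi])
      (auto simp: abs_mult tile_nonneg tile_le_1 intro!: AE_I2 mult_left_le_one_le mult_le_one mult_nonneg_nonneg)
  have Gnn: "0 \<le> G t" for t
    unfolding G_def by (intro Bochner_Integration.integral_nonneg mult_nonneg_nonneg tile_nonneg)
  have Gle: "G t \<le> (LINT x|lborel. ?H x)" for t
    unfolding G_def
    by (rule integral_mono'[OF Hi]) (auto simp: tile_nonneg tile_le_1 intro!: mult_left_le_one_le mult_le_one mult_nonneg_nonneg)
  \<comment> \<open>Here \<open>t * \<sigma>\<close> lies between 7/4 and 9/4, so for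
    \<open>p \<bullet> x\<close> between 12/5 and 13/5 the bump arguments of both tubes stay between
    1/10 and 9/10. Each of the three tiles gives a factor \<open>\<nu> ^ 2\<close>, and 4/25 is 1/5
    times 4/5.\<close>
  have Glow: "\<kappa> \<le> G t" if t: "t \<in> {7 / (4 * \<sigma>)..9 / (4 * \<sigma>)}" for t
  proof -
    have t\<sigma>: "7 / 4 \<le> t * \<sigma>" "t * \<sigma> \<le> 9 / 4" using t n(2) by (auto simp: field_simps)
    let ?S = "{x. p \<bullet> x \<in> {12 / 5..13 / 5} \<and> q \<bullet> x \<in> {1 / 10 - d..9 / 10 - d}}"
    have e: "emeasure lborel ?S = ennreal ((4 / 25) / \<bar>cross2 p q\<bar>)"
      using emeasure_cross2[OF c, of "12 / 5" "13 / 5" "1 / 10 - d" "9 / 10 - d"] by simp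
    have "closed ?S" by (auto intro!: closed_Collect_conj closed_Collect_le continuous_intros)
    then have S: "?S \<in> sets borel" by simp
    have "(LINT x|lborel. \<nu> ^ 6 * indicator ?S x) \<le> G t"
      unfolding G_def
    proof (rule integral_mono'[OF int])
      fix x
      show "\<nu> ^ 6 * indicator ?S x \<le> ?F (x - t *\<^sub>R n) * ?g (x - t *\<^sub>R m) * ?H x"
      proof (cases "x \<in> ?S")
        case True
        have "\<nu> * \<nu> \<le> ?F (x - t *\<^sub>R n)"
          unfolding tile_def using True t\<sigma> \<nu>(1) by (intro mult_mono \<nu>(2) bump_nonneg) (auto simp: inner_diff_right n)
        moreover have "\<nu> * \<nu> \<le> ?H x"
          unfolding tile_def using True \<nu>(1) by (intro mult_mono \<nu>(2) bump_nonneg) auto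
        moreover have "\<nu> * \<nu> \<le> ?g (x - t *\<^sub>R m)"
          using g[of x t] True t by (auto simp: power2_eq_square)
        ultimately have "(\<nu> * \<nu>) * (\<nu> * \<nu>) * (\<nu> * \<nu>) \<le> ?F (x - t *\<^sub>R n) * ?g (x - t *\<^sub>R m) * ?H x"
          using \<nu>(1) by (intro mult_mono) (auto simp: tile_nonneg)
        moreover have "(\<nu> * \<nu>) * (\<nu> * \<nu>) * (\<nu> * \<nu>) = \<nu> ^ 6" by (simp add: eval_nat_numeral)
        ultimately show ?thesis using True by simp
      qed (simp add: tile_nonneg)
    qed (simp add: tile_nonneg)
    moreover have "(LINT x|lborel. \<nu> ^ 6 * indicator ?S x) = \<kappa>"
      using S e by (simp add: measure_def \<kappa>_def)
    ultimately show ?thesis by simp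
  qed
  have Gm[measurable]: "G \<in> borel_measurable borel"
    unfolding G_def[abs_def] by (intro lborel.borel_measurable_lebesgue_integral) measurable
  \<comment> \<open>The interval has length \<open>1 / (2 * \<sigma>)\<close> and
    \<open>1 / t\<close> is at least \<open>4 * \<sigma> / 9\<close> on it. The product 2/9 is
    independent of \<open>\<sigma>\<close>, so the unknown lengths of the normals do no
    harm.\<close>
  have "(LINT t|lborel. (4 * \<sigma> / 9) * \<kappa> * indicator {7 / (4 * \<sigma>)..9 / (4 * \<sigma>)} t) \<le> X"
    unfolding X_def
  proof (rule integral_mono')
    show "integrable lborel (\<lambda>t. indicator {1 / \<sigma>..3 / \<sigma>} t * (G t / t))"
    proof (rule Bochner_Integration.integrable_bound)
      show "integrable lborel (\<lambda>t. indicator {1 / \<sigma>..3 / \<sigma>} t * ((LINT x|lborel. ?H x) * \<sigma>))"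
        using n(2) by (intro integrable_mult_left integrable_real_indicator) (auto simp: emeasure_lborel_Icc_eq divide_right_mono)
      show "AE t in lborel. norm (indicator {1 / \<sigma>..3 / \<sigma>} t * (G t / t)) \<le> norm (indicator {1 / \<sigma>..3 / \<sigma>} t * ((LINT x|lborel. ?H x) * \<sigma>))"
      proof (rule AE_I2)
        fix t
        have "G t / t \<le> (LINT x|lborel. ?H x) * \<sigma>" "0 \<le> G t / t" if "t \<in> {1 / \<sigma>..3 / \<sigma>}"
        proof -
          have t0: "0 < t" using that n(2) by (auto intro: less_le_trans[of 0 "1 / \<sigma>"])
          then have "1 / t \<le> \<sigma>" using that n(2) by (simp add: field_simps)
          then have "G t * (1 / t) \<le> (LINT x|lborel. ?H x) * \<sigma>"
            using Gle[of t] Gnn[of t] t0 by (intro mult_mono) auto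
          then show "G t / t \<le> (LINT x|lborel. ?H x) * \<sigma>" by simp
          show "0 \<le> G t / t" using Gnn[of t] t0 by simp
        qed
        then show "norm (indicator {1 / \<sigma>..3 / \<sigma>} t * (G t / t)) \<le> norm (indicator {1 / \<sigma>..3 / \<sigma>} t * ((LINT x|lborel. ?H x) * \<sigma>))"
          by (auto simp: indicator_def)
      qed
    qed measurable
    fix t
    show "(4 * \<sigma> / 9) * \<kappa> * indicator {7 / (4 * \<sigma>)..9 / (4 * \<sigma>)} t \<le> indicator {1 / \<sigma>..3 / \<sigma>} t * (G t / t)"
    proof (cases "t \<in> {7 / (4 * \<sigma>)..9 / (4 * \<sigma>)}")
      case True
      then have t\<sigma>: "7 / 4 \<le> t * \<sigma>" "t * \<sigma> \<le> 9 / 4" using n(2) by (auto simp: field_simps)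
      then have "0 < t * \<sigma>" by simp
      then have t0: "0 < t" using n(2) by (simp add: zero_less_mult_iff)
      have "4 * \<sigma> / 9 \<le> 1 / t" using t\<sigma> t0 by (simp add: field_simps)
      then have "(4 * \<sigma> / 9) * \<kappa> \<le> (1 / t) * G t"
        using Glow[OF True] \<kappa>0 t0 by (intro mult_mono) auto
      moreover have "t \<in> {1 / \<sigma>..3 / \<sigma>}" using t\<sigma> n(2) by (auto simp: field_simps)
      ultimately show ?thesis using True by simp
    qed (auto simp: indicator_def Gnn intro!: divide_nonneg_nonneg order_trans[of 0 "1 / \<sigma>"] less_imp_le[OF n(2)])
    show "0 \<le> indicator {1 / \<sigma>..3 / \<sigma>} t * (G t / t)"
      by (auto simp: indicator_def Gnn intro!: divide_nonneg_nonneg order_trans[of 0 "1 / \<sigma>"] less_imp_le[OF n(2)])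
  qed
  moreover have "(LINT t|lborel. (4 * \<sigma> / 9) * \<kappa> * indicator {7 / (4 * \<sigma>)..9 / (4 * \<sigma>)} t) = (2 / 9) * \<kappa>"
    using n(2) by (simp add: field_simps)
  ultimately have "(2 / 9) * \<kappa> \<le> X" by (simp only:)
  with eq show ?thesis unfolding \<kappa>_def by blast
qed

subsection \<open>Unboundedness\<close>

lemma dual_normals:
  assumes "cross2 w0 w1 \<noteq> 0"
  shows "dual1 w0 w1 \<bullet> w0 = 1" "dual1 w0 w1 \<bullet> w1 = 0" "dual2 w0 w1 \<bullet> w0 = 0" "dual2 w0 w1 \<bullet> w1 = 1"
    and "x = (dual1 w0 w1 \<bullet> x) *\<^sub>R w0 + (dual2 w0 w1 \<bullet> x) *\<^sub>R w1"
proof -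
  have "dual1 w0 w1 \<bullet> x = (1 / cross2 w0 w1) * cross2 x w1" "dual2 w0 w1 \<bullet> x = (1 / cross2 w0 w1) * cross2 w0 x" for x
    unfolding dual1_def dual2_def inner_scaleR_left
    by (simp_all add: cross2_def[of x] cross2_def[of w0 x] inner_vec_def sum_2 mult.commute)
  then show "dual1 w0 w1 \<bullet> w0 = 1" "dual1 w0 w1 \<bullet> w1 = 0" "dual2 w0 w1 \<bullet> w0 = 0" "dual2 w0 w1 \<bullet> w1 = 1"
    using assms by simp_all
  show "x = (dual1 w0 w1 \<bullet> x) *\<^sub>R w0 + (dual2 w0 w1 \<bullet> x) *\<^sub>R w1"
  proof (rule vector_eq_ldot[THEN iffD1], rule allI)
    show "y \<bullet> x = y \<bullet> ((dual1 w0 w1 \<bullet> x) *\<^sub>R w0 + (dual2 w0 w1 \<bullet> x) *\<^sub>R w1)" for y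
      using inner_eq_dual[OF assms, of y x] by (simp add: inner_add_right inner_commute[of y] mult.commute)
  qed
qed

lemma intercept_bounds: "A \<subseteq> {1..N} \<Longrightarrow> \<bar>intercept N A\<bar> \<le> 1"
proof -
  assume A: "A \<subseteq> {1..N}"
  have "\<bar>intercept N A\<bar> = (\<Sum>k\<in>A. (1 / 2) ^ k * (real k / real N))"
    unfolding intercept_def by (simp add: sum_nonneg)
  also have "\<dots> \<le> slope A"
    unfolding slope_def
  proof (rule sum_mono)
    fix k assume "k \<in> A"
    with A have "1 \<le> k" "k \<le> N" by auto
    then have "real k / real N \<le> 1" by simp
    then show "(1 / 2) ^ k * (real k / real N) \<le> (1 / 2 :: real) ^ k" by (rule mult_left_le) simp
  qed
  also have "\<dots> \<le> 1" by (rule slope_bounds[OF A])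
  finally show ?thesis .
qed

text \<open>Lower bound: \<open>2 ^ N\<close> tubes of area proportional to
  \<open>(1 / 2) ^ N\<close> contribute a constant in total. Upper bound: the norms of
  \<open>f j\<close> and \<open>f b\<close> are bounded independently of \<open>N\<close>, and that
  of \<open>f a\<close> supplies the negative power of \<open>N\<close>.\<close>

lemma kakeya_test:
  fixes D :: "((real^2)^3) set" and p :: "3 \<Rightarrow> real" and a j b :: 3
  assumes ne: "a \<noteq> j" "b \<noteq> a" "b \<noteq> j" and D: "D \<in> sets borel"
    and w: "cross2 w0 w1 \<noteq> 0" and c: "0 < c" and inj: "inj_on \<alpha> {0..1::real}"
    and sm: "\<And>t. t \<in> {0..1} \<Longrightarrow> c \<le> s t \<and> norm (m t) \<le> M"
    and tangent: "\<And>t z e. t \<in> {0..1} \<Longrightarrow> (s t *\<^sub>R (w0 + t *\<^sub>R w1)) \<bullet> z + m t \<bullet> e \<noteq> 0 \<Longrightarrow>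
        \<forall>\<^sub>F k in sequentially. emb a j (\<alpha> t + (1 / real k) *\<^sub>R z) (\<eta> + (1 / real k) *\<^sub>R e) \<in> D \<longleftrightarrow>
           (s t *\<^sub>R (w0 + t *\<^sub>R w1)) \<bullet> z + m t \<bullet> e < 0"
    and sum_p: "(\<Sum>k\<in>UNIV. 1 / p k) = 1" and p1: "\<And>k. 1 < p k" and pa: "p a < 2"
    and C: "\<And>f. (\<And>k. schwartz (f k)) \<Longrightarrow> norm (trilinear_form D f) \<le> C * (\<Prod>k\<in>UNIV. Lp_norm (p k) (f k))" and C0: "0 \<le> C"
  shows "\<exists>c0 B. 0 < c0 \<and> (\<forall>N\<ge>1. c0 \<le> B * (real N powr ((p a - 2) / 2)) powr (1 / p a))"
proof -
  define P Q where "P = dual1 w0 w1" and "Q = dual2 w0 w1"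
  have PQ: "P \<bullet> w0 = 1" "P \<bullet> w1 = 0" "Q \<bullet> w0 = 0" "Q \<bullet> w1 = 1" "cross2 P Q \<noteq> 0"
    using dual_normals[OF w] w by (simp_all add: P_def Q_def cross2_dual)
  define \<Delta> where "\<Delta> = \<bar>cross2 P Q\<bar>"
  have \<Delta>: "0 < \<Delta>" using PQ by (simp add: \<Delta>_def)
  obtain \<nu> where \<nu>: "0 < \<nu>" "\<And>x. x \<in> {1 / 10..9 / 10} \<Longrightarrow> \<nu> \<le> bump x" using bump_lower_bound by blast
  have M0: "0 \<le> M" using sm[of 0] order_trans[OF norm_ge_zero, of "m 0" M] by simp
  \<comment> \<open>Radius of a disc containing all points \<open>x - t m\<close> met below, where
    \<open>P \<bullet> x \<le> 3\<close>, \<open>\<bar>Q \<bullet> x\<bar> \<le> 5\<close> and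
    \<open>t \<le> 9 / (4 * c)\<close>.\<close>
  define R0 where "R0 = 3 * norm w0 + 5 * norm w1 + 9 / (4 * c) * M"
  have R0: "0 \<le> R0" using M0 c by (simp add: R0_def)
  \<comment> \<open>At this scale the disc stays within 1/3 of the midpoint 1/2 in both coordinates
    of \<open>g\<close>, where \<open>bump\<close> is at least \<open>\<nu>\<close>. Neither radius
    depends on \<open>N\<close>.\<close>
  define Rg where "Rg = 3 * (1 + R0)"
  have Rg: "0 < Rg" "R0 / Rg \<le> 1 / 3" using R0 by (simp_all add: Rg_def field_simps)
  define gp gq :: "real^2" where "gp = (1 / Rg) *\<^sub>R axis 1 1" and "gq = (1 / Rg) *\<^sub>R axis 2 1"
  have gpq: "cross2 gp gq \<noteq> 0" using Rg by (simp add: gp_def gq_def cross2_scaleR) (simp add: cross2_def axis_def)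
  define g where "g = tile gp (1 / 2) gq (1 / 2)"
  have g_low: "\<nu>\<^sup>2 \<le> g y" if "norm y \<le> R0" for y
  proof -
    have "\<bar>y $ i / Rg\<bar> \<le> 1 / 3" for i
    proof -
      have "\<bar>y $ i / Rg\<bar> \<le> R0 / Rg"
        using component_le_norm_cart[of y i] that Rg by (simp add: abs_divide divide_right_mono)
      with Rg show ?thesis by linarith
    qed
    then have "y $ i / Rg + 1 / 2 \<in> {1 / 10..9 / 10}" for i
    proof -
      have "\<bar>y $ i / Rg\<bar> \<le> 1 / 3" by fact
      then show ?thesis unfolding atLeastAtMost_iff abs_le_iff by linarith
    qed
    moreover have "gp \<bullet> y = y $ 1 / Rg" "gq \<bullet> y = y $ 2 / Rg" by (simp_all add: gp_def gq_def inner_axis')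
    ultimately show ?thesis
      unfolding g_def tile_def power2_eq_square using \<nu> by (intro mult_mono \<nu>(2) bump_nonneg) auto
  qed
  define Kg where "Kg = Lp_norm (p j) (\<lambda>x. of_real (g x))"
  define Kb where "Kb = (1 / \<Delta>) powr (1 / p b)"
  define c0 where "c0 = 1 / (2 * pi) * ((2 / 9) * (\<nu> ^ 6 * (4 / 25) / \<Delta>))"
  have c00: "0 < c0" using \<nu> \<Delta> by (simp add: c0_def)
  \<comment> \<open>\<open>1 / \<Delta> + 1\<close> bounds the squared L2 norm of
    \<open>fa k\<close> for large \<open>k\<close>, the 1 being slack for the limit;
    \<open>5 / \<Delta>\<close> comes from the measure of the Kakeya set.\<close>
  define B0 where "B0 = 1 / \<Delta> + 1 + 5 / \<Delta>"
  have B0: "0 \<le> B0" using \<Delta> by (simp add: B0_def)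
  have main: "c0 \<le> C * ((real N powr ((p a - 2) / 2) * B0) powr (1 / p a) * (Kg * Kb))" if N: "1 \<le> N" for N
  proof -
    define I where "I = Pow {1..N}"
    have fin: "finite I" and Ine: "I \<noteq> {}" by (auto simp: I_def)
    \<comment> \<open>\<open>q A\<close> annihilates the normal \<open>n A\<close>, so that the tube
      runs along the normal. The factor \<open>2 ^ N\<close> makes it thin and \<open>d A\<close>
      places it on the line with the prescribed intercept.\<close>
    define q where "q A = 2 ^ N *\<^sub>R (Q - slope A *\<^sub>R P)" for A
    define d where "d A = - (2 ^ N * intercept N A)" for A
    have cq: "cross2 P (q A) = 2 ^ N * cross2 P Q" for A by (simp add: q_def cross2_shear)
    have cq0: "cross2 P (q A) \<noteq> 0" for A using PQ by (simp add: cq)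
    have cqa: "\<bar>cross2 P (q A)\<bar> = 2 ^ N * \<Delta>" for A by (simp add: cq \<Delta>_def abs_mult)
    have qd: "q A \<bullet> x + d A = 2 ^ N * (Q \<bullet> x - (slope A * (P \<bullet> x) + intercept N A))" for A x
      by (simp add: q_def d_def inner_diff_left algebra_simps)
    have sl: "slope A \<in> {0..1}" if "A \<in> I" for A using slope_bounds[of A N] that by (auto simp: I_def)
    \<comment> \<open>The same tube in two places: over the unit interval, where the tubes cluster,
      and between 2 and 3, where they are disjoint.\<close>
    define F H where "F A = tile P 0 (q A) (d A)" and "H A = tile P (- 2) (q A) (d A)" for A
    define n where "n A = s (slope A) *\<^sub>R (w0 + slope A *\<^sub>R w1)" for A
    define \<alpha>' where "\<alpha>' A = \<alpha> (slope A)" for A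
    have inj': "inj_on \<alpha>' I"
    proof -
      have "slope ` I \<subseteq> {0..1}" using sl by blast
      from comp_inj_on[OF inj_on_slope[of N, folded I_def] inj_on_subset[OF inj this]]
      show ?thesis by (simp add: \<alpha>'_def[abs_def] comp_def)
    qed
    have nP: "P \<bullet> n A = s (slope A)" "0 < s (slope A)" "q A \<bullet> n A = 0" if "A \<in> I" for A
      using sm[OF sl[OF that]] c by (simp_all add: n_def q_def inner_diff_left inner_add_right PQ)
    have n0: "n A \<noteq> 0" if "A \<in> I" for A using nP[OF that] by auto
    have strip: "\<bar>Q \<bullet> x - (slope A * (P \<bullet> x) + intercept N A)\<bar> \<le> 1" if "q A \<bullet> x + d A \<in> {0..1}" for A x
    proof -
      let ?v = "Q \<bullet> x - (slope A * (P \<bullet> x) + intercept N A)"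
      have "0 \<le> 2 ^ N * ?v" "2 ^ N * ?v \<le> 1" using that by (simp_all add: qd)
      moreover have "0 \<le> v \<and> v \<le> 1 / 2 ^ N" if "0 \<le> 2 ^ N * v" "2 ^ N * v \<le> 1" for v :: real
      proof
        show "0 \<le> v" using that(1) mult_pos_neg[of "2 ^ N" v] by (auto simp: not_less[symmetric])
        show "v \<le> 1 / 2 ^ N" using that(2) by (simp add: field_simps)
      qed
      ultimately have "0 \<le> ?v" "?v \<le> 1 / 2 ^ N" by blast+
      moreover have "1 / 2 ^ N \<le> (1 :: real)" by (simp add: divide_le_eq)
      ultimately show ?thesis by linarith
    qed
    have g_near: "\<nu>\<^sup>2 \<le> g (x - t *\<^sub>R m (slope A))"
      if A: "A \<in> I" and x: "P \<bullet> x \<in> {2..3}" "q A \<bullet> x + d A \<in> {0..1}" and t: "t \<in> {7 / (4 * s (slope A))..9 / (4 * s (slope A))}" for A x t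
    proof (rule g_low)
      have "\<bar>slope A * (P \<bullet> x)\<bar> \<le> 1 * 3"
        using sl[OF A] x(1) unfolding abs_mult by (intro mult_mono) auto
      then have "\<bar>Q \<bullet> x\<bar> \<le> 5" using strip[OF x(2)] intercept_bounds[of A N] A by (auto simp: I_def)
      have "norm x \<le> norm ((P \<bullet> x) *\<^sub>R w0) + norm ((Q \<bullet> x) *\<^sub>R w1)"
        using dual_normals(5)[OF w, of x] norm_triangle_ineq[of "(P \<bullet> x) *\<^sub>R w0" "(Q \<bullet> x) *\<^sub>R w1"] by (simp add: P_def Q_def)
      also have "\<dots> \<le> 3 * norm w0 + 5 * norm w1"
        using x(1) \<open>\<bar>Q \<bullet> x\<bar> \<le> 5\<close> by (auto intro!: add_mono mult_right_mono)
      finally have 1: "norm x \<le> 3 * norm w0 + 5 * norm w1" .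
      have s: "c \<le> s (slope A)" "norm (m (slope A)) \<le> M" using sm[OF sl[OF A]] by auto
      have "0 \<le> 7 / (4 * s (slope A))" using nP(2)[OF A] by simp
      then have "0 \<le> t" using t by auto
      moreover have "9 / (4 * s (slope A)) \<le> 9 / (4 * c)" using s c by (intro divide_left_mono) auto
      ultimately have "\<bar>t\<bar> \<le> 9 / (4 * c)" using t by auto
      then have "norm (t *\<^sub>R m (slope A)) \<le> 9 / (4 * c) * M"
        unfolding norm_scaleR using s c by (intro mult_mono) auto
      with 1 norm_triangle_ineq4[of x "t *\<^sub>R m (slope A)"] show "norm (x - t *\<^sub>R m (slope A)) \<le> R0"
        by (simp add: R0_def)
    qed
    define V where "V A = (LINT w|lborel. (case w of (z, e) \<Rightarrow> if n A \<bullet> z + m (slope A) \<bullet> e < 0 then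
        fourier (\<lambda>x. of_real (F A x)) z * fourier (\<lambda>x. of_real (g x)) e *
        fourier (\<lambda>x. of_real (H A x)) (- z - e) else 0))" for A
    have "\<exists>X. (2 / 9) * (\<nu> ^ 6 * (4 / 25) / (2 ^ N * \<Delta>)) \<le> X \<and>
      V A = - \<i> / (2 * pi) * of_real X" if A: "A \<in> I" for A
      using half_space_tiles[OF cq0[of A] gpq \<nu> nP(1,2,3)[OF A], of "d A" "1 / 2" "1 / 2" "m (slope A)"] g_near[OF A]
      unfolding V_def F_def H_def g_def cqa by blast
    then obtain X where X: "\<And>A. A \<in> I \<Longrightarrow> (2 / 9) * (\<nu> ^ 6 * (4 / 25) / (2 ^ N * \<Delta>)) \<le> X A"
      and XI: "\<And>A. A \<in> I \<Longrightarrow> V A = - \<i> / (2 * pi) * of_real (X A)"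
      by metis
    \<comment> \<open>For \<open>k > 0\<close> the frequencies of a piece of \<open>fa\<close>, of
      \<open>fj\<close> and of a piece of \<open>fb\<close> sum to zero exactly when both pieces
      belong to the same tube.\<close>
    define fa fj fb where "fa k x = (\<Sum>A\<in>I. of_real (F A x) * unit_wave (real k *\<^sub>R \<alpha>' A) x)"
      and "fj k x = of_real (g x) * unit_wave (real k *\<^sub>R \<eta>) x"
      and "fb k x = (\<Sum>A\<in>I. of_real (H A x) * unit_wave (- (real k *\<^sub>R (\<alpha>' A + \<eta>))) x)" for k :: nat and x
    define f where "f k l = (if l = a then fa k else if l = j then fj k else fb k)" for k l
    have f_simps: "f k a = fa k" "f k j = fj k" "f k b = fb k" for k using ne by (auto simp: f_def)
    have Fi: "integrable lborel (\<lambda>x. complex_of_real (F A x))" and Hi: "integrable lborel (\<lambda>x. complex_of_real (H A x))" for A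
      unfolding F_def H_def using integrable_tile[OF cq0] by simp_all
    have four_a: "fourier (f k a) z = (\<Sum>A\<in>I. fourier (\<lambda>x. of_real (F A x)) (z - real k *\<^sub>R \<alpha>' A))" for k z
      unfolding f_simps fa_def
      by (subst fourier_sum) (auto intro!: integrable_mult_unit_wave Fi simp: fourier_mult_unit_wave)
    have four_j: "fourier (f k j) e = fourier (\<lambda>x. of_real (g x)) (e - real k *\<^sub>R \<eta>)" for k e
      unfolding f_simps fj_def by (simp add: fourier_mult_unit_wave)
    have four_b: "fourier (f k b) x = (\<Sum>A\<in>I. fourier (\<lambda>x. of_real (H A x)) (x + real k *\<^sub>R (\<alpha>' A + \<eta>)))" for k x
      unfolding f_simps fb_def
      by (subst fourier_sum) (auto intro!: integrable_mult_unit_wave Hi simp: fourier_mult_unit_wave)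
    have lim: "(\<lambda>k. trilinear_form {\<xi>. (1 / real k) *\<^sub>R \<xi> \<in> D} (f k)) \<longlonglongrightarrow>
      (\<Sum>A\<in>I. V A)"
      unfolding V_def
    proof (rule trilinear_form_blow_up[OF ne D fin inj' _ _ _ _ _ n0 _ four_a four_j four_b,
          where K = "Max ((\<lambda>A. LINT x|lborel. norm (complex_of_real (H A x))) ` I)"])
      show "integrable lborel (fourier (\<lambda>x. of_real (F A x)))" for A
        unfolding F_def by (rule integrable_fourier_tile[OF cq0])
      show "integrable lborel (fourier (\<lambda>x. of_real (g x)))"
        unfolding g_def by (rule integrable_fourier_tile[OF gpq])
      show "fourier (\<lambda>x. of_real (H A x)) \<in> borel_measurable borel" for A
        unfolding H_def by measurable
      show "norm (fourier (\<lambda>x. complex_of_real (H A x)) \<xi>) \<le> Max ((\<lambda>A. LINT x|lborel. norm (complex_of_real (H A x))) ` I)" if "A \<in> I" for A \<xi>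
        by (rule order_trans[OF norm_fourier_le[OF Hi] Max_ge]) (use fin that in auto)
      show "(\<lambda>k. fourier (\<lambda>x. complex_of_real (H A x)) (w + real k *\<^sub>R v)) \<longlonglongrightarrow> 0" if "v \<noteq> 0" for A v w
        unfolding H_def by (rule fourier_tile_tendsto_0[OF cq0 that])
      show "\<forall>\<^sub>F k in sequentially. emb a j (\<alpha>' A + (1 / real k) *\<^sub>R z) (\<eta> + (1 / real k) *\<^sub>R e) \<in> D \<longleftrightarrow> n A \<bullet> z + m (slope A) \<bullet> e < 0"
        if "A \<in> I" "n A \<bullet> z + m (slope A) \<bullet> e \<noteq> 0" for A z e
        using tangent[OF sl[OF that(1)]] that(2) by (simp add: n_def \<alpha>'_def)
    qed
    have "(\<Sum>A\<in>I. V A) =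
        - \<i> / (2 * pi) * of_real (\<Sum>A\<in>I. X A)"
      by (simp add: XI sum_distrib_left)
    with lim have lim': "(\<lambda>k. norm (trilinear_form {\<xi>. (1 / real k) *\<^sub>R \<xi> \<in> D} (f k))) \<longlonglongrightarrow> norm (- \<i> / (2 * pi) * of_real (\<Sum>A\<in>I. X A))"
      by (simp only: tendsto_norm)
    have "(\<Sum>A\<in>I. (2 / 9) * (\<nu> ^ 6 * (4 / 25) / (2 ^ N * \<Delta>))) \<le> (\<Sum>A\<in>I. X A)" by (intro sum_mono X)
    then have "(2 / 9) * (\<nu> ^ 6 * (4 / 25) / \<Delta>) \<le> (\<Sum>A\<in>I. X A)"
      by (simp add: I_def card_Pow)
    then have low: "c0 \<le> norm (- \<i> / (2 * pi) * complex_of_real (\<Sum>A\<in>I. X A))"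
    proof -
      have "norm (- \<i> / (2 * pi) * complex_of_real (\<Sum>A\<in>I. X A)) = 1 / (2 * pi) * \<bar>\<Sum>A\<in>I. X A\<bar>"
        by (simp add: norm_mult norm_divide del: of_real_sum)
      moreover have "(2 / 9) * (\<nu> ^ 6 * (4 / 25) / \<Delta>) \<le> \<bar>\<Sum>A\<in>I. X A\<bar>"
        by (rule order_trans[OF \<open>(2 / 9) * (\<nu> ^ 6 * (4 / 25) / \<Delta>) \<le> (\<Sum>A\<in>I. X A)\<close>]) simp
      ultimately show ?thesis unfolding c0_def by (simp only:) (rule mult_left_mono, simp_all)
    qed
    \<comment> \<open>The assumed bound is applied to dilated functions, and the powers of
      \<open>k\<close> cancel because the \<open>1 / p l\<close> sum to one.\<close>
    have upper: "norm (trilinear_form {\<xi>. (1 / real k) *\<^sub>R \<xi> \<in> D} (f k)) \<le> C * (\<Prod>l\<in>UNIV. Lp_norm (p l) (f k l))" if k: "1 \<le> k" for k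
    proof -
      let ?c = "1 / real k"
      have c: "0 < ?c" "?c \<noteq> 0" using k by auto
      have "schwartz (\<lambda>x. f k l (?c *\<^sub>R x))" for l
      proof -
        have "(\<lambda>x. fa k (?c *\<^sub>R x)) \<in> packets" unfolding fa_def F_def
          by (intro packets_sum fin Ine scaled_tile_in_packets cq0 c)
        moreover have "(\<lambda>x. fj k (?c *\<^sub>R x)) \<in> packets" unfolding fj_def g_def
          by (intro scaled_tile_in_packets gpq c)
        moreover have "(\<lambda>x. fb k (?c *\<^sub>R x)) \<in> packets" unfolding fb_def H_def
          by (intro packets_sum fin Ine scaled_tile_in_packets cq0 c)
        ultimately have "(\<lambda>x. f k l (?c *\<^sub>R x)) \<in> packets" by (simp add: f_def)
        then show ?thesis by (rule packets_schwartz)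
      qed
      from C[OF this] have "norm (trilinear_form D (\<lambda>l x. f k l (?c *\<^sub>R x))) \<le> C * (\<Prod>l\<in>UNIV. Lp_norm (p l) (\<lambda>x. f k l (?c *\<^sub>R x)))" .
      also have "(\<Prod>l\<in>UNIV. Lp_norm (p l) (\<lambda>x. f k l (?c *\<^sub>R x))) = (1 / ?c\<^sup>2) * (\<Prod>l\<in>UNIV. Lp_norm (p l) (f k l))"
      proof -
        have "(\<Prod>l\<in>UNIV. Lp_norm (p l) (\<lambda>x. f k l (?c *\<^sub>R x))) = (\<Prod>l\<in>UNIV. (1 / ?c\<^sup>2) powr (1 / p l)) * (\<Prod>l\<in>UNIV. Lp_norm (p l) (f k l))"
          unfolding Lp_norm_scaleR[OF c(1)] by (rule prod.distrib)
        also have "(\<Prod>l\<in>UNIV. (1 / ?c\<^sup>2) powr (1 / p l)) = (1 / ?c\<^sup>2) powr (\<Sum>l\<in>UNIV. 1 / p l)"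
          using c by (intro powr_sum[symmetric]) auto
        also have "\<dots> = 1 / ?c\<^sup>2" using k by (simp add: sum_p)
        finally show ?thesis .
      qed
      finally have "norm (complex_of_real (1 / ?c\<^sup>2) * trilinear_form {\<xi>. ?c *\<^sub>R \<xi> \<in> D} (f k)) \<le> (1 / ?c\<^sup>2) * (C * (\<Prod>l\<in>UNIV. Lp_norm (p l) (f k l)))"
        by (simp only: trilinear_form_scaleR[OF c(2)] mult.left_commute)
      moreover have pos: "0 < 1 / ?c\<^sup>2" using c by simp
      ultimately show ?thesis unfolding norm_mult norm_of_real abs_of_pos[OF pos] by (rule mult_left_le_imp_le)
    qed
    have fm: "fa k \<in> borel_measurable borel" "fb k \<in> borel_measurable borel" for k
      unfolding fa_def[abs_def] fb_def[abs_def] F_def H_def by measurable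
    obtain E where E: "E \<in> sets borel" "emeasure lborel E \<le> ennreal (5 / (N * \<Delta>))"
      "\<And>A x. A \<subseteq> {1..N} \<Longrightarrow> P \<bullet> x \<in> {0..1} \<Longrightarrow>
        Q \<bullet> x - (slope A * (P \<bullet> x) + intercept N A) \<in> {0..(1 / 2) ^ N} \<Longrightarrow> x \<in> E"
      using kakeya_set[OF N PQ(5)] unfolding \<Delta>_def by blast
    have thin: "Q \<bullet> x - (slope A * (P \<bullet> x) + intercept N A) \<in> {0<..<(1 / 2) ^ N}" if "q A \<bullet> x + d A \<in> {0<..<1}" for A x
    proof -
      have "v \<in> {0<..<(1 / 2) ^ N}" if "2 ^ N * v \<in> {0<..<1}" for v :: real
        using that zero_less_mult_pos[of "2 ^ N" v] by (auto simp: power_one_over field_simps)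
      with that show ?thesis unfolding qd by blast
    qed
    have supp: "x \<in> E" if "fa k x \<noteq> 0" for k x
    proof -
      from that obtain A where A: "A \<in> I" "F A x \<noteq> 0" unfolding fa_def by (metis (no_types, lifting) mult_zero_left of_real_0 sum.neutral)
      from tile_nonzero[OF A(2)[unfolded F_def]] have "P \<bullet> x \<in> {0..1}" "q A \<bullet> x + d A \<in> {0<..<1}" by auto
      from E(3)[OF _ this(1)] thin[OF this(2)] A(1) show ?thesis by (auto simp: I_def)
    qed
    have L2: "(\<lambda>k. LINT x|lborel. (norm (fa k x))\<^sup>2) \<longlonglongrightarrow> (\<Sum>A\<in>I. LINT x|lborel. (F A x)\<^sup>2)"
      and L2i: "integrable lborel (\<lambda>x. (norm (fa k x))\<^sup>2)" for k
      unfolding fa_def F_def using tile_sum_L2_limit[where p = "\<lambda>_. P" and q = q and r = "\<lambda>_. 0" and s = d, OF fin cq0 inj'] by auto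
    have "(\<Sum>A\<in>I. LINT x|lborel. (F A x)\<^sup>2) \<le> (\<Sum>A\<in>I. 1 / (2 ^ N * \<Delta>))"
      unfolding F_def using integral_tile_square_le[OF cq0] by (intro sum_mono) (simp add: cqa)
    also have "\<dots> = 1 / \<Delta>" by (simp add: I_def card_Pow)
    finally have "(\<Sum>A\<in>I. LINT x|lborel. (F A x)\<^sup>2) < 1 / \<Delta> + 1" by simp
    from order_tendstoD(2)[OF L2 this]
    have L2ev: "\<forall>\<^sub>F k in sequentially. (LINT x|lborel. (norm (fa k x))\<^sup>2) < 1 / \<Delta> + 1" .
    have La: "Lp_norm (p a) (f k a) \<le> (real N powr ((p a - 2) / 2) * B0) powr (1 / p a)"
      if k: "(LINT x|lborel. (norm (fa k x))\<^sup>2) < 1 / \<Delta> + 1" for k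
      unfolding Lp_norm_def f_simps
    proof (rule powr_mono2)
      \<comment> \<open>This height balances the two parts: the square integral is of order one and
        the measure of \<open>E\<close> of order \<open>1 / N\<close>, so both parts are
        \<open>N powr ((p a - 2) / 2)\<close> up to constants.\<close>
      define K where "K = real N powr (1 / 2)"
      have K: "0 < K" using N by (simp add: K_def)
      have Kp: "K powr (p a - 2) = real N powr ((p a - 2) / 2)" by (simp add: K_def powr_powr)
      have "K powr p a * (5 / (N * \<Delta>)) = real N powr (p a / 2) / real N powr 1 * (5 / \<Delta>)"
        using N by (simp add: K_def powr_powr)
      also have "real N powr (p a / 2) / real N powr 1 = real N powr (p a / 2 - 1)" by (rule powr_diff[symmetric])
      also have "p a / 2 - 1 = (p a - 2) / 2" by simp
      finally have Kp': "K powr p a * (5 / (N * \<Delta>)) = real N powr ((p a - 2) / 2) * (5 / \<Delta>)" .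
      have "(LINT x|lborel. norm (fa k x) powr p a) \<le> K powr (p a - 2) * (LINT x|lborel. (norm (fa k x))\<^sup>2) + K powr p a * (5 / (N * \<Delta>))"
        by (rule integral_powr_le_of_small_support[OF fm(1) L2i E(1,2) _ supp]) (use K p1[of a] pa \<Delta> in auto)
      also have "\<dots> \<le> real N powr ((p a - 2) / 2) * (1 / \<Delta> + 1) + real N powr ((p a - 2) / 2) * (5 / \<Delta>)"
        unfolding Kp Kp' using k by (intro add_right_mono mult_left_mono) auto
      finally show "(LINT x|lborel. norm (fa k x) powr p a) \<le> real N powr ((p a - 2) / 2) * B0"
        by (simp only: B0_def distrib_left)
    qed (use p1[of a] in auto)
    have one: "norm (fb k x) \<le> 1 \<and> norm (fb k x) \<le> (\<Sum>A\<in>I. H A x)" for k x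
    proof -
      have "norm (fb k x) \<le> (\<Sum>A\<in>I. norm (of_real (H A x) * unit_wave (- (real k *\<^sub>R (\<alpha>' A + \<eta>))) x))"
        unfolding fb_def by (rule norm_sum)
      also have "\<dots> = (\<Sum>A\<in>I. H A x)" by (simp add: norm_mult H_def tile_nonneg)
      finally have 1: "norm (fb k x) \<le> (\<Sum>A\<in>I. H A x)" .
      have "(\<Sum>A\<in>I. H A x) \<le> 1"
      proof (cases "\<exists>A\<in>I. H A x \<noteq> 0")
        case True
        then obtain A where A: "A \<in> I" "H A x \<noteq> 0" by blast
        \<comment> \<open>If two tubes met at \<open>x\<close>, their lines would be less than
          \<open>(1 / 2) ^ N\<close> apart there, against \<open>lines_separated\<close>.\<close>
        have "H A' x = 0" if A': "A' \<in> I - {A}" for A'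
        proof (rule ccontr)
          assume "H A' x \<noteq> 0"
          from tile_nonzero[OF this[unfolded H_def]] tile_nonzero[OF A(2)[unfolded H_def]]
          have t: "2 \<le> P \<bullet> x" "q A' \<bullet> x + d A' \<in> {0<..<1}" "q A \<bullet> x + d A \<in> {0<..<1}" by auto
          have "(1 / 2) ^ N \<le> \<bar>(slope A * (P \<bullet> x) + intercept N A) - (slope A' * (P \<bullet> x) + intercept N A')\<bar>"
            using A A' by (intro lines_separated[OF _ _ _ t(1)]) (auto simp: I_def)
          with thin[OF t(2)] thin[OF t(3)] show False by (auto simp: abs_if split: if_splits)
        qed
        then have "(\<Sum>A\<in>I. H A x) = H A x" using fin A(1) by (subst sum.remove[of _ A]) auto
        then show ?thesis by (simp add: H_def tile_le_1)
      next
        case False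
        then have "(\<Sum>A\<in>I. H A x) = 0" by (intro sum.neutral) auto
        then show ?thesis by simp
      qed
      with 1 show ?thesis by simp
    qed
    have Lb: "Lp_norm (p b) (f k b) \<le> Kb" for k
      unfolding Lp_norm_def f_simps Kb_def
    proof (rule powr_mono2)
      have "(LINT x|lborel. norm (fb k x) powr p b) \<le> (LINT x|lborel. (\<Sum>A\<in>I. H A x))"
      proof (rule integral_mono')
        show "integrable lborel (\<lambda>x. \<Sum>A\<in>I. H A x)"
          unfolding H_def by (intro Bochner_Integration.integrable_sum integrable_tile cq0)
        show "norm (fb k x) powr p b \<le> (\<Sum>A\<in>I. H A x)" for x
        proof -
          have "norm (fb k x) powr p b \<le> norm (fb k x) powr 1"
            using one[of k x] p1[of b] by (intro powr_mono') auto
          with one[of k x] show ?thesis by simp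
        qed
        show "0 \<le> (\<Sum>A\<in>I. H A x)" for x by (intro sum_nonneg) (simp add: H_def tile_nonneg)
      qed
      also have "\<dots> = (\<Sum>A\<in>I. LINT x|lborel. H A x)"
        unfolding H_def by (intro Bochner_Integration.integral_sum integrable_tile cq0)
      also have "\<dots> \<le> (\<Sum>A\<in>I. 1 / (2 ^ N * \<Delta>))"
        unfolding H_def using integral_tile_le[OF cq0] by (intro sum_mono) (simp add: cqa)
      also have "\<dots> = 1 / \<Delta>" by (simp add: I_def card_Pow)
      finally show "(LINT x|lborel. norm (fb k x) powr p b) \<le> 1 / \<Delta>" .
    qed (use p1[of b] in auto)
    have Lj: "Lp_norm (p j) (f k j) = Kg" for k
      unfolding Kg_def Lp_norm_def f_simps fj_def by (simp add: norm_mult)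
    have "\<forall>\<^sub>F k in sequentially. norm (trilinear_form {\<xi>. (1 / real k) *\<^sub>R \<xi> \<in> D} (f k)) \<le> C * ((real N powr ((p a - 2) / 2) * B0) powr (1 / p a) * (Kg * Kb))"
      using L2ev eventually_ge_at_top[of 1]
    proof eventually_elim
      case (elim k)
      have "(\<Prod>l\<in>UNIV. Lp_norm (p l) (f k l)) = Lp_norm (p a) (f k a) * (Lp_norm (p j) (f k j) * Lp_norm (p b) (f k b))"
        unfolding UNIV_3_eq[OF ne] using ne by simp
      also have "\<dots> \<le> (real N powr ((p a - 2) / 2) * B0) powr (1 / p a) * (Kg * Kb)"
        using La[OF elim(1)] Lb[of k] unfolding Lj
        by (intro mult_mono) (auto simp: Kg_def Lp_norm_nonneg intro!: mult_nonneg_nonneg)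
      finally have "C * (\<Prod>l\<in>UNIV. Lp_norm (p l) (f k l)) \<le> C * ((real N powr ((p a - 2) / 2) * B0) powr (1 / p a) * (Kg * Kb))"
        using C0 by (rule mult_left_mono)
      with upper[OF elim(2)] show ?case by linarith
    qed
    from tendsto_upperbound[OF lim' this] low show ?thesis by simp
  qed
  show ?thesis
  proof (rule exI[of _ c0], rule exI[of _ "C * (B0 powr (1 / p a) * (Kg * Kb))"], intro conjI c00 allI impI)
    fix N :: nat assume "1 \<le> N"
    from main[OF this] show "c0 \<le> C * (B0 powr (1 / p a) * (Kg * Kb)) * (real N powr ((p a - 2) / 2)) powr (1 / p a)"
      using B0 by (simp add: powr_mult mult_ac)
  qed
qed

theorem mainTheorem1:
  fixes D U :: "((real^2)^3) set" and j :: 3 and \<xi>\<^sub>0 :: "real^2" and p :: "3 \<Rightarrow> real"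
  assumes "openin (top_of_set \<Gamma>) D" and "connected D" and "D \<noteq> {}"
    and "openin (top_of_set \<Gamma>) U"
    and "smooth_boundary_piece D U"
    and "connected (bdry D \<inter> U)"
    and "curve_of_nonzero_curvature (bdry D \<inter> U \<inter> coordinate_slice j \<xi>\<^sub>0)"
    and "(\<Sum>k\<in>UNIV. 1 / p k) = 1"
    and "\<And>k. 1 < p k"
    and "\<exists>i. i \<noteq> j \<and> p i < 2"
  shows "\<not> of_type (trilinear_form D) p"
proof
  assume "of_type (trilinear_form D) p"
  then obtain C where C: "\<And>f. (\<forall>k. schwartz (f k)) \<Longrightarrow> norm (trilinear_form D f) \<le> C * (\<Prod>k\<in>UNIV. Lp_norm (p k) (f k))"
    unfolding of_type_def by blast
  \<comment> \<open>A nonnegative constant lets upper bounds for the norms be inserted.\<close>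
  have C': "norm (trilinear_form D f) \<le> max C 0 * (\<Prod>k\<in>UNIV. Lp_norm (p k) (f k))" if "\<And>k. schwartz (f k)" for f
  proof -
    have "C * (\<Prod>k\<in>UNIV. Lp_norm (p k) (f k)) \<le> max C 0 * (\<Prod>k\<in>UNIV. Lp_norm (p k) (f k))"
      by (intro mult_right_mono prod_nonneg) (auto simp: Lp_norm_nonneg)
    with C[of f] that show ?thesis by force
  qed
  obtain a where a: "a \<noteq> j" "p a < 2" using assms(10) by blast
  obtain b where b: "b \<noteq> a" "b \<noteq> j" using ex_third_index by blast
  have "closed \<Gamma>"
    unfolding \<Gamma>_def by (intro closed_Collect_eq continuous_intros)
  moreover obtain T where "open T" "D = \<Gamma> \<inter> T" using assms(1) by (auto simp: openin_open)
  ultimately have D: "D \<in> sets borel" by simp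
  obtain \<eta> w0 w1 c M \<alpha> m s where "cross2 w0 w1 \<noteq> 0" "0 < c" "inj_on \<alpha> {0..1::real}"
    and *: "\<forall>t\<in>{0..1}. c \<le> s t \<and> norm (m t) \<le> M \<and>
      (\<forall>z e. (s t *\<^sub>R (w0 + t *\<^sub>R w1)) \<bullet> z + m t \<bullet> e \<noteq> 0 \<longrightarrow>
        (\<forall>\<^sub>F k in sequentially. emb a j (\<alpha> t + (1 / real k) *\<^sub>R z) (\<eta> + (1 / real k) *\<^sub>R e) \<in> D \<longleftrightarrow>
           (s t *\<^sub>R (w0 + t *\<^sub>R w1)) \<bullet> z + m t \<bullet> e < 0))"
    using boundary_directions[OF a(1) assms(5,7)] by blast
  with kakeya_test[OF a(1) b D, of w0 w1 c \<alpha> s m M \<eta> p "max C 0"] assms(8,9) a(2) C'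
  obtain c0 B where c0: "0 < c0" "\<And>N. 1 \<le> N \<Longrightarrow> c0 \<le> B * (real N powr ((p a - 2) / 2)) powr (1 / p a)"
    by auto
  \<comment> \<open>Since \<open>p a < 2\<close> the exponent is negative, and the upper bound
    eventually drops below \<open>c0\<close>.\<close>
  have "(\<lambda>N. real N powr ((p a - 2) / 2 * (1 / p a))) \<longlonglongrightarrow> 0"
    using a(2) assms(9)[of a] by (intro tendsto_neg_powr filterlim_real_sequentially) (auto simp: divide_neg_pos)
  then have "(\<lambda>N. B * (real N powr ((p a - 2) / 2)) powr (1 / p a)) \<longlonglongrightarrow> B * 0"
    unfolding powr_powr by (rule tendsto_mult_left)
  moreover have "\<forall>\<^sub>F N in sequentially. c0 \<le> B * (real N powr ((p a - 2) / 2)) powr (1 / p a)"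
    using eventually_ge_at_top[of 1] by eventually_elim (rule c0(2))
  ultimately have "c0 \<le> B * 0" by (rule tendsto_lowerbound) simp
  with c0(1) show False by simp
qed

end
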